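(* Let $\Lambda\cong\mathbb{Z}^d$ be a lattice with an endomorphism $F$ satisfying $\ker(F-1)=\ker(F-1)^2$, and let $\Lambda'\subseteq\Lambda$ be a full-rank $F$-stable sublattice. Write the characteristic polynomial of $F$ on $\Lambda$ as $\pm(t-1)^r p(t)$ with $p(1)>0$. Then $$\left|\left(\Lambda/\Lambda'\right)^{F}\right|=\left|\frac{\Lambda^F}{\Lambda'^F}\right|\cdot\frac{p(1)}{|\mathfrak{B}|\cdot|\mathcal{T}'|},$$ and for all integers $e\ge1$, $$\left|\left(\Lambda/e\Lambda'\right)^{F}\right|=\left|\left(\Lambda/\Lambda'\right)^{F}\right|\cdot|\mathfrak{B}[e]|\cdot e^r.$$ Moreover $\mathcal{T}'$ and $\mathfrak{B}$ are finite abelian groups and $|\mathcal{T}'|\cdot|\mathfrak{B}|$ divides $p(1)$. If $\Lambda'$ is the dual lattice of $\Lambda$ with respect to a non-degenerate $F$-invariant symmetric $\mathbb{Q}$-valued bilinear pairing on $\Lambda\otimes\mathbb{Q}$, then $\mathcal{T}\cong\mathcal{T}'$ and $\mathfrak{B}$ admits a perfect antisymmetric $\mathbb{Q}/\mathbb{Z}$-valued pairing; in particular the orders of $\mathfrak{B}$ and of $\mathfrak{B}[e]$ are each either a square or twice a square.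
   Context: $V=\Lambda\otimes_{\mathbb{Z}}\mathbb{Q}$ with $F$ extended linearly; $V^F$ is the $1$-eigenspace and $W=(F-1)V$ (the sum of generalised eigenspaces of $F$ for eigenvalues other than $1$), so $V=V^F\oplus W$. For a full-rank $F$-stable lattice $M\subseteq V$, the separation group is $\mathcal{T}(M)=M/\big((M\cap V^F)+(M\cap W)\big)$; write $\mathcal{T}=\mathcal{T}(\Lambda)$, $\mathcal{T}'=\mathcal{T}(\Lambda')$. Define $\mathfrak{B}=\mathfrak{B}_{\Lambda,\Lambda'}=\dfrac{\Lambda+\{v\in V: Fv-v\in\Lambda'\}}{\Lambda+V^F}$ (equivalently, the image in $V/\Lambda$ of $F$-invariant elements of $V/\Lambda'$, modulo the image of $V^F$). $M^F$ denotes $F$-fixed points and $\mathfrak{B}[e]$ the $e$-torsion. The dual lattice of $\Lambda$ is $\{v\in V:(v,\lambda)\in\mathbb{Z}\ \forall\lambda\in\Lambda\}$. *)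

theory Defs
  imports
    "HOL-Algebra.Coset"
    "HOL-Library.Set_Algebras"
    "Jordan_Normal_Form.Char_Poly"
begin

text \<open>
  The rational vector space \<open>V\<close> is the whole type \<open>'v\<close>, with scalar multiplication \<open>scale\<close>.
  A full-rank lattice in \<open>V\<close> is the integral span of a rational basis of \<open>V\<close>, so that
  \<open>V\<close> is the lattice tensored with the rationals. An endomorphism of the lattice is given by
  its linear extension to \<open>V\<close>. The sum \<open>A + B\<close> of two sets is the elementwise sum.
\<close>

definition lattice_basis ::
    "(rat \<Rightarrow> 'v::ab_group_add \<Rightarrow> 'v) \<Rightarrow> nat \<Rightarrow> (nat \<Rightarrow> 'v) \<Rightarrow> 'v set \<Rightarrow> bool" where
  "lattice_basis scale d b M \<longleftrightarrow>
     inj_on b {..<d} \<and>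
     \<not> Modules.module.dependent scale (b ` {..<d}) \<and>
     Modules.module.span scale (b ` {..<d}) = UNIV \<and>
     M = range (\<lambda>c :: nat \<Rightarrow> int. \<Sum>i<d. scale (of_int (c i)) (b i))"

definition full_rank_lattice ::
    "(rat \<Rightarrow> 'v::ab_group_add \<Rightarrow> 'v) \<Rightarrow> nat \<Rightarrow> 'v set \<Rightarrow> bool" where
  "full_rank_lattice scale d M \<longleftrightarrow> (\<exists>b. lattice_basis scale d b M)"

definition lattice_mat ::
    "(rat \<Rightarrow> 'v::ab_group_add \<Rightarrow> 'v) \<Rightarrow> nat \<Rightarrow> (nat \<Rightarrow> 'v) \<Rightarrow> ('v \<Rightarrow> 'v) \<Rightarrow> int mat" where
  "lattice_mat scale d b F =
     (THE A. A \<in> carrier_mat d d \<and>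
        (\<forall>j<d. F (b j) = (\<Sum>i<d. scale (of_int (A $$ (i, j))) (b i))))"

definition fixed_space :: "('v \<Rightarrow> 'v) \<Rightarrow> 'v set" where
  "fixed_space F = {v. F v = v}"

definition moved_space :: "('v::ab_group_add \<Rightarrow> 'v) \<Rightarrow> 'v set" where
  "moved_space F = range (\<lambda>v. F v - v)"

definition add_group :: "'v::ab_group_add set \<Rightarrow> 'v monoid" where
  "add_group M = \<lparr>carrier = M, monoid.mult = (+), one = 0\<rparr>"

definition separation_group :: "('v::ab_group_add \<Rightarrow> 'v) \<Rightarrow> 'v set \<Rightarrow> 'v set monoid" where
  "separation_group F M =
     add_group M Mod ((M \<inter> fixed_space F) + (M \<inter> moved_space F))"

definition B_group ::
    "('v::ab_group_add \<Rightarrow> 'v) \<Rightarrow> 'v set \<Rightarrow> 'v set \<Rightarrow> 'v set monoid" where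
  "B_group F L L' = add_group (L + {v. F v - v \<in> L'}) Mod (L + fixed_space F)"

text \<open>
  For an \<open>F\<close>-stable \<open>N\<close>, the map induced by \<open>F\<close> on cosets of \<open>N\<close> sends
  \<open>C = N + x\<close> to \<open>N + F x = N + F ` C\<close>.
\<close>

definition quotient_fixed :: "('v::ab_group_add \<Rightarrow> 'v) \<Rightarrow> 'v set \<Rightarrow> 'v set \<Rightarrow> 'v set set" where
  "quotient_fixed F M N = {C \<in> carrier (add_group M Mod N). N + F ` C = C}"

definition torsion :: "('a, 'b) monoid_scheme \<Rightarrow> nat \<Rightarrow> 'a set" where
  "torsion G e = {x \<in> carrier G. x [^]\<^bsub>G\<^esub> e = \<one>\<^bsub>G\<^esub>}"

definition nondegenerate_symmetric_form ::
    "(rat \<Rightarrow> 'v::ab_group_add \<Rightarrow> 'v) \<Rightarrow> ('v \<Rightarrow> 'v \<Rightarrow> rat) \<Rightarrow> bool" where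
  "nondegenerate_symmetric_form scale \<beta> \<longleftrightarrow>
     (\<forall>v. Vector_Spaces.linear scale (*) (\<beta> v)) \<and>
     (\<forall>w. Vector_Spaces.linear scale (*) (\<lambda>v. \<beta> v w)) \<and>
     (\<forall>v w. \<beta> v w = \<beta> w v) \<and>
     (\<forall>v. (\<forall>w. \<beta> v w = 0) \<longrightarrow> v = 0)"

definition dual_lattice :: "('v \<Rightarrow> 'v \<Rightarrow> rat) \<Rightarrow> 'v set \<Rightarrow> 'v set" where
  "dual_lattice \<beta> M = {v. \<forall>l\<in>M. \<beta> v l \<in> \<int>}"

definition rat_mod_int :: "rat set monoid" where
  "rat_mod_int = add_group UNIV Mod \<int>"

text \<open>
  Perfectness: both maps from \<open>G\<close> to the group of homomorphisms from \<open>G\<close> to the rationals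
  modulo the integers are bijective. Homomorphisms are represented by functions that are
  extensional on the carrier, since \<^const>\<open>hom\<close> does not constrain values outside it.
\<close>

definition perfect_pairing ::
    "('a, 'b) monoid_scheme \<Rightarrow> ('a \<Rightarrow> 'a \<Rightarrow> rat set) \<Rightarrow> bool" where
  "perfect_pairing G \<phi> \<longleftrightarrow>
     (\<forall>x\<in>carrier G. \<phi> x \<in> hom G rat_mod_int) \<and>
     (\<forall>y\<in>carrier G. (\<lambda>x. \<phi> x y) \<in> hom G rat_mod_int) \<and>
     bij_betw (\<lambda>x. restrict (\<phi> x) (carrier G))
       (carrier G) (hom G rat_mod_int \<inter> extensional (carrier G)) \<and>
     bij_betw (\<lambda>y. restrict (\<lambda>x. \<phi> x y) (carrier G))
       (carrier G) (hom G rat_mod_int \<inter> extensional (carrier G))"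

definition antisymmetric_pairing ::
    "('a, 'b) monoid_scheme \<Rightarrow> ('a \<Rightarrow> 'a \<Rightarrow> rat set) \<Rightarrow> bool" where
  "antisymmetric_pairing G \<phi> \<longleftrightarrow>
     (\<forall>x\<in>carrier G. \<forall>y\<in>carrier G. \<phi> x y = inv\<^bsub>rat_mod_int\<^esub> (\<phi> y x))"

definition square_or_twice_square :: "nat \<Rightarrow> bool" where
  "square_or_twice_square n \<longleftrightarrow> (\<exists>k. n = k\<^sup>2 \<or> n = 2 * k\<^sup>2)"

end

theory Submission
  imports Defs "HOL-Algebra.Multiplicative_Group" "HOL-Computational_Algebra.Nth_Powers"
    "HOL-Library.Function_Algebras" "HOL-Library.Product_Plus"
begin

text \<open>
  Put \<open>\<Delta> = F - 1\<close>, so that \<open>W = \<Delta> V\<close>. Applying \<open>\<Delta>\<close> identifies \<open>T'\<close> with \<open>\<Delta> L' / \<Delta> (L' \<inter> W)\<close>, the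
  group \<open>B\<close> with \<open>(L' \<inter> W) / (L' \<inter> \<Delta> L)\<close>, and the fixed points of \<open>L / L'\<close> modulo the image of
  \<open>L\<^sup>F\<close> with \<open>(L' \<inter> \<Delta> L) / \<Delta> L'\<close>. These are the successive quotients of the chain
  \<open>\<Delta> (L' \<inter> W) \<subseteq> \<Delta> L' \<subseteq> L' \<inter> \<Delta> L \<subseteq> L' \<inter> W\<close>, whose total index is the absolute value of the
  determinant of \<open>\<Delta>\<close> on \<open>W\<close>, which is \<open>p(1)\<close>. The second formula follows by applying the first one
  to \<open>e L'\<close>, which replaces \<open>B\<close> by \<open>e B\<close>.

  If \<open>L'\<close> is dual to \<open>L\<close>, then \<open>(u, v) \<mapsto> \<beta> (P u) v\<close>, with \<open>P\<close> the projection onto \<open>V\<^sup>F\<close> along \<open>W\<close>,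
  induces a perfect pairing of \<open>T\<close> with \<open>T'\<close>, and \<open>(v, w) \<mapsto> \<beta> v (\<Delta> w)\<close> one of \<open>B\<close> with itself, where
  \<open>v\<close> and \<open>w\<close> satisfy \<open>\<Delta> v, \<Delta> w \<in> L'\<close>. Finite groups in perfect duality are isomorphic.
\<close>

section \<open>Additive subgroups and their quotients\<close>

lemma add_group_simps [simp]:
  "carrier (add_group A) = A" "x \<otimes>\<^bsub>add_group A\<^esub> y = x + y" "\<one>\<^bsub>add_group A\<^esub> = 0"
  by (simp_all add: add_group_def)

definition add_subgroup :: "'a::ab_group_add set \<Rightarrow> bool" where
  "add_subgroup A \<longleftrightarrow> 0 \<in> A \<and> (\<forall>x\<in>A. \<forall>y\<in>A. x - y \<in> A)"

lemma add_subgroupI: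
  "0 \<in> A \<Longrightarrow> (\<And>x y. x \<in> A \<Longrightarrow> y \<in> A \<Longrightarrow> x - y \<in> A) \<Longrightarrow> add_subgroup A"
  by (simp add: add_subgroup_def)

lemma add_subgroup_zero: "add_subgroup A \<Longrightarrow> 0 \<in> A"
  and add_subgroup_diff: "add_subgroup A \<Longrightarrow> x \<in> A \<Longrightarrow> y \<in> A \<Longrightarrow> x - y \<in> A"
  by (simp_all add: add_subgroup_def)

lemma add_subgroup_uminus: "add_subgroup A \<Longrightarrow> x \<in> A \<Longrightarrow> - x \<in> A"
  using add_subgroup_diff[of A 0 x] by (simp add: add_subgroup_zero)

lemma add_subgroup_add: "add_subgroup A \<Longrightarrow> x \<in> A \<Longrightarrow> y \<in> A \<Longrightarrow> x + y \<in> A"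
  using add_subgroup_diff[of A x "- y"] by (simp add: add_subgroup_uminus)

lemmas add_subgroup_closed =
  add_subgroup_zero add_subgroup_diff add_subgroup_uminus add_subgroup_add

lemma add_subgroup_cancel_right:
  "add_subgroup A \<Longrightarrow> y \<in> A \<Longrightarrow> x + y \<in> A \<longleftrightarrow> x \<in> A"
  by (metis add_diff_cancel_right' add_subgroup_add add_subgroup_diff)

lemma add_subgroup_cong:
  "add_subgroup A \<Longrightarrow> x - y \<in> A \<Longrightarrow> x \<in> A \<longleftrightarrow> y \<in> A"
  by (metis add.commute add_subgroup_cancel_right diff_add_cancel)

lemma add_subgroup_Int: "add_subgroup A \<Longrightarrow> add_subgroup B \<Longrightarrow> add_subgroup (A \<inter> B)"
  by (auto simp: add_subgroup_def)

lemma add_subgroup_UNIV: "add_subgroup UNIV"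
  by (simp add: add_subgroup_def)

lemma add_subgroup_Ints: "add_subgroup (\<int> :: rat set)"
  by (simp add: add_subgroup_def)

lemma add_subgroup_image:
  assumes "additive f" "add_subgroup A" shows "add_subgroup (f ` A)"
proof (rule add_subgroupI)
  show "0 \<in> f ` A"
    using additive.zero[OF assms(1)] add_subgroup_zero[OF assms(2)] by (metis imageI)
qed (auto simp: additive.diff[OF assms(1), symmetric] add_subgroup_diff[OF assms(2)])

lemma uminus_image_add_subgroup:
  assumes "add_subgroup A" shows "uminus ` A = A"
proof
  show "A \<subseteq> uminus ` A" using add_subgroup_uminus[OF assms] by (metis image_eqI minus_minus subsetI)
qed (auto simp: add_subgroup_uminus[OF assms])

lemma add_subgroup_vimage:
  "additive f \<Longrightarrow> add_subgroup A \<Longrightarrow> add_subgroup {x. f x \<in> A}"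
  by (auto intro!: add_subgroupI simp: additive.zero additive.diff add_subgroup_closed)

lemma add_subgroup_plus:
  assumes "add_subgroup A" "add_subgroup B" shows "add_subgroup (A + B)"
proof (rule add_subgroupI)
  show "0 \<in> A + B"
    using assms by (metis add_0 add_subgroup_zero set_plus_intro)
  fix x y assume "x \<in> A + B" "y \<in> A + B"
  then obtain a b a' b' where "a \<in> A" "b \<in> B" "a' \<in> A" "b' \<in> B" "x = a + b" "y = a' + b'"
    by (auto elim!: set_plus_elim)
  then show "x - y \<in> A + B"
    using set_plus_intro[of "a - a'" A "b - b'" B] assms
    by (simp add: add_subgroup_diff algebra_simps)
qed

lemma subset_plus_left: "add_subgroup B \<Longrightarrow> A \<subseteq> A + B"
  by (metis add.right_neutral add_subgroup_zero set_plus_intro subsetI)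

lemma subset_plus_right: "add_subgroup A \<Longrightarrow> B \<subseteq> A + B"
  by (metis add.left_neutral add_subgroup_zero set_plus_intro subsetI)

lemma plus_subset_add_subgroup:
  "add_subgroup C \<Longrightarrow> A \<subseteq> C \<Longrightarrow> B \<subseteq> C \<Longrightarrow> A + B \<subseteq> C"
  by (auto elim!: set_plus_elim intro: add_subgroup_add)

lemma add_subgroup_plus_absorb:
  assumes "add_subgroup M" "add_subgroup N" "N \<subseteq> M" shows "M + N = M"
  using plus_subset_add_subgroup[OF assms(1) order_refl assms(3)] subset_plus_left[OF assms(2)]
  by blast

lemma mem_plus_iff: "(x :: 'a::ab_group_add) \<in> A + B \<longleftrightarrow> (\<exists>a\<in>A. x - a \<in> B)"
proof
  assume "x \<in> A + B"
  then obtain a b where "a \<in> A" "b \<in> B" "x = a + b" by (rule set_plus_elim)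
  then show "\<exists>a\<in>A. x - a \<in> B" by (intro bexI[of _ a]) auto
next
  assume "\<exists>a\<in>A. x - a \<in> B"
  then obtain a where "a \<in> A" "x - a \<in> B" by blast
  then have "a + (x - a) \<in> A + B" by (rule set_plus_intro)
  then show "x \<in> A + B" by simp
qed

lemma image_plus:
  assumes "additive f" shows "f ` (A + B) = f ` A + f ` B"
proof
  show "f ` (A + B) \<subseteq> f ` A + f ` B"
    by (auto elim!: set_plus_elim simp: additive.add[OF assms] intro!: set_plus_intro)
  show "f ` A + f ` B \<subseteq> f ` (A + B)"
    by (auto elim!: set_plus_elim simp: additive.add[OF assms, symmetric] intro!: imageI)
qed

lemma comm_group_add_group:
  assumes "add_subgroup A" shows "comm_group (add_group A)"
proof (rule comm_groupI)
  show "\<exists>y\<in>carrier (add_group A). y \<otimes>\<^bsub>add_group A\<^esub> x = \<one>\<^bsub>add_group A\<^esub>"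
    if "x \<in> carrier (add_group A)" for x
    using that assms by (auto intro!: bexI[of _ "- x"] add_subgroup_uminus)
qed (use assms in \<open>auto simp: add_subgroup_closed algebra_simps\<close>)

lemma inv_add_group:
  assumes "add_subgroup A" "x \<in> A" shows "inv\<^bsub>add_group A\<^esub> x = - x"
proof -
  interpret comm_group "add_group A" by (rule comm_group_add_group[OF assms(1)])
  show ?thesis using assms by (intro inv_equality) (auto simp: add_subgroup_uminus)
qed

lemma subgroup_add_group:
  assumes "add_subgroup A" "add_subgroup B" "B \<subseteq> A" shows "subgroup B (add_group A)"
proof -
  interpret comm_group "add_group A" by (rule comm_group_add_group[OF assms(1)])
  show ?thesis
  proof (rule subgroupI)
    show "inv\<^bsub>add_group A\<^esub> a \<in> B" if "a \<in> B" for a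
      using inv_add_group[OF assms(1), of a] that assms by (auto simp: add_subgroup_uminus)
  qed (use assms in \<open>auto simp: add_subgroup_add dest: add_subgroup_zero\<close>)
qed

lemma normal_add_group:
  assumes "add_subgroup A" "add_subgroup B" "B \<subseteq> A" shows "B \<lhd> add_group A"
  using comm_group.normal_iff_subgroup[OF comm_group_add_group[OF assms(1)]]
    subgroup_add_group[OF assms] by blast

lemma comm_group_Mod:
  assumes "add_subgroup A" "add_subgroup B" "B \<subseteq> A" shows "comm_group (add_group A Mod B)"
  using comm_group.abelian_FactGroup[OF comm_group_add_group subgroup_add_group] assms by blast

abbreviation coset :: "'a::ab_group_add set \<Rightarrow> 'a \<Rightarrow> 'a set" where
  "coset B a \<equiv> B #>\<^bsub>add_group UNIV\<^esub> a"

lemma coset_altdef: "coset B a = {x. x - a \<in> B}"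
  by (force simp: r_coset_def)

lemma coset_eq_plus: "coset M x = M + {x}"
  by (auto simp: r_coset_def set_plus_def)

lemma carrier_Mod: "carrier (add_group A Mod B) = coset B ` A"
  by (auto simp: carrier_FactGroup r_coset_def)

lemma coset_eq_iff:
  assumes "add_subgroup B" shows "coset B x = coset B y \<longleftrightarrow> x - y \<in> B"
proof
  assume "coset B x = coset B y"
  moreover have "x \<in> coset B x" using assms by (simp add: coset_altdef add_subgroup_zero)
  ultimately show "x - y \<in> B" by (simp add: coset_altdef)
next
  assume "x - y \<in> B"
  moreover have "u - y = (u - x) + (x - y)" for u by simp
  ultimately show "coset B x = coset B y"
    unfolding coset_altdef using add_subgroup_cancel_right[OF assms] by metis
qed

lemma coset_eq_self_iff: "add_subgroup B \<Longrightarrow> coset B x = B \<longleftrightarrow> x \<in> B"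
  using coset_eq_iff[of B x 0] by (simp add: coset_altdef)

lemma coset_epi:
  assumes "add_subgroup A" "add_subgroup B" "B \<subseteq> A"
  shows "coset B \<in> epi (add_group A) (add_group A Mod B)"
  using normal.r_coset_hom_Mod[OF normal_add_group[OF assms]]
  by (simp add: epi_def carrier_Mod r_coset_def)

declare mult_FactGroup [simp del]

lemma mult_Mod:
  assumes "add_subgroup A" "add_subgroup B" "B \<subseteq> A" "x \<in> A" "y \<in> A"
  shows "coset B x \<otimes>\<^bsub>add_group A Mod B\<^esub> coset B y = coset B (x + y)"
  using coset_epi[OF assms(1-3)] assms(4,5) by (auto simp: epi_def hom_def)

theorem Mod_iso_Mod:
  assumes f: "additive f" and A: "add_subgroup A" and B: "add_subgroup B" "B \<subseteq> A"
    and A': "add_subgroup A'" and B': "add_subgroup B'" "B' \<subseteq> A'"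
    and maps: "f ` A \<subseteq> A'" and kernel: "\<And>a. a \<in> A \<Longrightarrow> f a \<in> B' \<longleftrightarrow> a \<in> B"
    and onto: "A' \<subseteq> f ` A + B'"
  shows "add_group A Mod B \<cong> add_group A' Mod B'"
proof -
  let ?h = "\<lambda>a. coset B' (f a)"
  interpret G: comm_group "add_group A" by (rule comm_group_add_group[OF A])
  interpret H: comm_group "add_group A' Mod B'" by (rule comm_group_Mod[OF A' B'])
  interpret group_hom "add_group A" "add_group A' Mod B'" ?h
  proof unfold_locales
    have "f a \<in> A'" if "a \<in> A" for a using maps that by blast
    then show "?h \<in> hom (add_group A) (add_group A' Mod B')"
      using mult_Mod[OF A' B'] by (intro homI) (auto simp: carrier_Mod additive.add[OF f])
  qed
  have "kernel (add_group A) (add_group A' Mod B') ?h = B"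
    using kernel B(2) by (auto simp: kernel_def coset_eq_self_iff[OF B'(1)])
  moreover have "?h ` A = coset B' ` A'"
  proof
    show "?h ` A \<subseteq> coset B' ` A'" using maps by blast
    show "coset B' ` A' \<subseteq> ?h ` A"
    proof (rule image_subsetI)
      fix y assume "y \<in> A'"
      then have "y \<in> f ` A + B'" using onto by blast
      then obtain a where "a \<in> A" "y - f a \<in> B'" unfolding mem_plus_iff by blast
      then have "coset B' y = ?h a" by (simp only: coset_eq_iff[OF B'(1)])
      then show "coset B' y \<in> ?h ` A" using \<open>a \<in> A\<close> by blast
    qed
  qed
  ultimately show ?thesis using FactGroup_iso by (simp add: carrier_Mod)
qed

subsection \<open>Indices\<close>

definition index :: "'a::ab_group_add set \<Rightarrow> 'a set \<Rightarrow> nat" where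
  "index A B = card (carrier (add_group A Mod B))"

lemma index_altdef: "index A B = card (coset B ` A)"
  by (simp add: index_def carrier_Mod)

lemma index_eqI:
  assumes "additive f" "add_subgroup A" "add_subgroup B" "B \<subseteq> A" "add_subgroup A'" "add_subgroup B'"
    "B' \<subseteq> A'"
    "f ` A \<subseteq> A'" "\<And>a. a \<in> A \<Longrightarrow> f a \<in> B' \<longleftrightarrow> a \<in> B" "A' \<subseteq> f ` A + B'"
  shows "index A B = index A' B'"
  unfolding index_def by (rule iso_same_card[OF Mod_iso_Mod[OF assms]])

lemma index_plus_right:
  assumes "add_subgroup A" "add_subgroup B"
  shows "index (A + B) B = index A (A \<inter> B)"
  by (rule sym, rule index_eqI[where f = "\<lambda>x. x"])
    (use assms in \<open>simp_all add: additive_def add_subgroup_plus add_subgroup_Int subset_plus_left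
      subset_plus_right\<close>)

text \<open>As \<open>card\<close> of an infinite set is \<open>0\<close>, this also holds for infinite indices.\<close>

lemma index_mult:
  assumes A: "add_subgroup A" and B: "add_subgroup B" and C: "add_subgroup C"
    and sub: "C \<subseteq> B" "B \<subseteq> A"
  shows "index A C = index A B * index B C"
proof -
  have CA: "C \<subseteq> A" using sub by blast
  let ?G = "add_group A Mod C" and ?H = "add_group A Mod B"
  interpret G: comm_group ?G by (rule comm_group_Mod[OF A C CA])
  interpret H: comm_group ?H by (rule comm_group_Mod[OF A B sub(2)])
  let ?h = "\<lambda>X. B + X"
  have h: "?h (coset C a) = coset B a" for a
    by (simp only: coset_eq_plus add.assoc[symmetric] add_subgroup_plus_absorb[OF B C sub(1)])
  interpret group_hom ?G ?H ?h
  proof unfold_locales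
    show "?h \<in> hom ?G ?H"
      using mult_Mod[OF A C CA] mult_Mod[OF A B sub(2)] add_subgroup_add[OF A]
      by (intro homI) (auto simp: carrier_Mod h)
  qed
  have ker: "kernel ?G ?H ?h = coset C ` B"
  proof -
    have "?h (coset C a) = B \<longleftrightarrow> a \<in> B" for a by (simp only: h coset_eq_self_iff[OF B])
    then show ?thesis using sub(2) unfolding kernel_def carrier_Mod one_FactGroup by blast
  qed
  have "card (rcosets\<^bsub>?G\<^esub> (coset C ` B)) * card (coset C ` B) = index A C"
    using G.lagrange[OF subgroup_kernel] by (simp add: ker Coset.order_def index_def)
  moreover have "?G Mod (coset C ` B) \<cong> ?H"
    using FactGroup_iso by (simp add: ker carrier_Mod h image_image)
  then have "card (rcosets\<^bsub>?G\<^esub> (coset C ` B)) = index A B"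
    unfolding index_def by (auto dest!: iso_same_card simp: FactGroup_def)
  ultimately show ?thesis by (simp add: index_altdef[of B C])
qed

lemma index_self:
  assumes "add_subgroup A" shows "index A A = 1"
proof -
  have "coset A ` A = (\<lambda>_. A) ` A"
    by (rule image_cong) (simp_all only: coset_eq_self_iff[OF assms])
  then show ?thesis
    using add_subgroup_zero[OF assms] by (auto simp: index_altdef image_constant_conv)
qed

lemma index_eq_1_iff:
  assumes A: "add_subgroup A" and B: "add_subgroup B" "B \<subseteq> A"
  shows "index A B = 1 \<longleftrightarrow> A = B"
proof
  assume "index A B = 1"
  then obtain X where X: "coset B ` A = {X}" by (auto simp: index_altdef card_1_singleton_iff)
  have "a \<in> B" if "a \<in> A" for a
  proof -
    have "coset B a = coset B 0" using X that add_subgroup_zero[OF A] by blast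
    then show ?thesis by (simp add: coset_eq_iff[OF B(1)])
  qed
  then show "A = B" using B(2) by blast
qed (simp only: index_self[OF B(1)])

theorem index_image_kernel:
  assumes f: "additive f" and A: "add_subgroup A" and B: "add_subgroup B" "B \<subseteq> A"
  shows "index A B = index (f ` A) (f ` B) * index {a \<in> A. f a = 0} {b \<in> B. f b = 0}"
proof -
  let ?K = "{a \<in> A. f a = 0}"
  have K: "add_subgroup ?K" "?K \<subseteq> A"
    using A
    by (auto intro!: add_subgroupI simp: additive.zero[OF f] additive.diff[OF f]
        add_subgroup_closed)
  have KB: "add_subgroup (?K + B)" "?K + B \<subseteq> A"
    using add_subgroup_plus[OF K(1) B(1)] plus_subset_add_subgroup[OF A K(2) B(2)] by auto
  have "f a \<in> f ` B \<longleftrightarrow> a \<in> ?K + B" if "a \<in> A" for a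
  proof -
    have "f a = f b \<longleftrightarrow> a - b \<in> ?K" if "b \<in> B" for b
      using \<open>a \<in> A\<close> that B(2) add_subgroup_diff[OF A, of a b] by (auto simp: additive.diff[OF f])
    then have "f a \<in> f ` B \<longleftrightarrow> (\<exists>b\<in>B. a - b \<in> ?K)" by blast
    then show ?thesis unfolding add.commute[of ?K] mem_plus_iff .
  qed
  then have "index A (?K + B) = index (f ` A) (f ` B)"
    by (intro index_eqI[where f = f] f A KB add_subgroup_image[OF f] B subset_plus_left
        image_mono order_refl)
  moreover have "?K \<inter> B = {b \<in> B. f b = 0}" using B(2) by auto
  then have "index (?K + B) B = index ?K {b \<in> B. f b = 0}"
    using index_plus_right[OF K(1) B(1)] by simp
  ultimately show ?thesis
    using index_mult[OF A KB(1) B(1) subset_plus_right[OF K(1)] KB(2)] by simp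
qed

corollary index_image:
  assumes f: "additive f" and A: "add_subgroup A" and B: "add_subgroup B" "B \<subseteq> A"
    and kernel: "\<And>a. a \<in> A \<Longrightarrow> f a = 0 \<Longrightarrow> a \<in> B"
  shows "index (f ` A) (f ` B) = index A B"
proof -
  have "add_subgroup {b \<in> B. f b = 0}"
    using B(1)
    by (auto intro!: add_subgroupI simp: additive.zero[OF f] additive.diff[OF f]
        add_subgroup_closed)
  moreover have "{a \<in> A. f a = 0} = {b \<in> B. f b = 0}" using kernel B(2) by auto
  ultimately show ?thesis using index_image_kernel[OF f A B] by (simp add: index_self)
qed

subsection \<open>Integer multiples\<close>

definition zmul :: "int \<Rightarrow> 'a::ab_group_add \<Rightarrow> 'a" where
  "zmul k x = x [^]\<^bsub>add_group UNIV\<^esub> k"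

lemma zmul_add_left: "zmul (k + l) x = zmul k x + zmul l x"
  and zmul_add_right: "zmul k (x + y) = zmul k x + zmul k y"
  and zmul_zmul: "zmul k (zmul l x) = zmul (k * l) x"
  and zmul_0 [simp]: "zmul 0 x = 0"
  and zmul_1 [simp]: "zmul 1 x = x"
  and zmul_minus_left: "zmul (- k) x = - zmul k x"
proof -
  interpret comm_group "add_group (UNIV :: 'a set)"
    by (rule comm_group_add_group[OF add_subgroup_UNIV])
  show "zmul (k + l) x = zmul k x + zmul l x" using int_pow_mult[of x k l] by (simp add: zmul_def)
  show "zmul k (x + y) = zmul k x + zmul k y"
    using int_pow_distrib[of x y k] by (simp add: zmul_def)
  show "zmul k (zmul l x) = zmul (k * l) x"
    using int_pow_pow[of x l k] by (simp add: zmul_def mult.commute)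
  show "zmul 0 x = 0" "zmul 1 x = x" using int_pow_0 int_pow_1[of x] by (auto simp: zmul_def)
  show "zmul (- k) x = - zmul k x"
    using int_pow_neg[of x k] inv_add_group[OF add_subgroup_UNIV] by (simp add: zmul_def)
qed

lemma additive_zmul: "additive (zmul k)"
  by (simp add: additive_def zmul_add_right)

lemma zmul_diff_left: "zmul (k - l) x = zmul k x - zmul l x"
  using zmul_add_left[of k "- l" x] by (simp add: zmul_minus_left)

lemma additive_zmul_left: "additive (\<lambda>k. zmul k x)"
  by (simp add: additive_def zmul_add_left)

lemma additive_zmul_commute: "additive f \<Longrightarrow> f (zmul k x) = zmul k (f x)"
  by (induction k rule: int_induct[where k = 0])
    (simp_all add: zmul_add_left zmul_diff_left additive.zero additive.add additive.diff)

lemma zmul_eq_of_int_mult: "zmul k (x :: 'a::ring_1) = of_int k * x"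
  by (induction k rule: int_induct[where k = 0])
    (simp_all add: zmul_add_left zmul_diff_left algebra_simps)

lemma add_subgroup_zmul:
  assumes "add_subgroup A" "x \<in> A" shows "zmul k x \<in> A"
  by (induction k rule: int_induct[where k = 0])
    (use assms in \<open>simp_all add: zmul_add_left zmul_diff_left add_subgroup_closed\<close>)

lemma hom_zmul:
  assumes "add_subgroup A" "group G" "h \<in> hom (add_group A) G" "x \<in> A"
  shows "h (zmul (int n) x) = h x [^]\<^bsub>G\<^esub> n"
proof -
  have "zmul (int n) x = x [^]\<^bsub>add_group A\<^esub> n"
    by (induction n) (simp_all add: zmul_add_left add.commute)
  then show ?thesis
    using hom_nat_pow[OF assms(3) _ comm_group.axioms(2)[OF comm_group_add_group] assms(2)]
      assms(1,4)
    by simp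
qed

lemma zmul_index_mem:
  assumes "add_subgroup A" "add_subgroup B" "B \<subseteq> A" "x \<in> A"
  shows "zmul (int (index A B)) x \<in> B"
proof -
  interpret comm_group "add_group A Mod B" by (rule comm_group_Mod[OF assms(1-3)])
  have "coset B (zmul (int (index A B)) x) = coset B x [^]\<^bsub>add_group A Mod B\<^esub> index A B"
    using hom_zmul[OF assms(1) is_group _ assms(4)] coset_epi[OF assms(1-3)] by (simp add: epi_def)
  also have "\<dots> = B"
    using pow_order_eq_1[of "coset B x"] assms(4)
    by (simp add: Coset.order_def index_def carrier_Mod)
  finally show ?thesis by (simp add: coset_eq_self_iff[OF assms(2)])
qed

lemma mem_int_subgroup_iff_Gcd_dvd:
  fixes I :: "int set"
  assumes I: "add_subgroup I" shows "k \<in> I \<longleftrightarrow> Gcd I dvd k"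
proof
  assume dvd: "Gcd I dvd k"
  have mult: "j * i \<in> I" if "i \<in> I" for i j
    using add_subgroup_zmul[OF I that, of j] by (simp add: zmul_eq_of_int_mult)
  show "k \<in> I"
  proof (cases "I \<subseteq> {0}")
    case True
    then show ?thesis using add_subgroup_zero[OF I] dvd by (auto simp: subset_singleton_iff)
  next
    case False
    then obtain i where i: "i \<in> I" "i \<noteq> 0" by blast
    define g where "g = (LEAST g :: nat. 0 < g \<and> int g \<in> I)"
    have "0 < nat \<bar>i\<bar> \<and> int (nat \<bar>i\<bar>) \<in> I" using i add_subgroup_uminus[OF I] by (simp add: abs_if)
    then have g: "0 < g" "int g \<in> I" unfolding g_def by (metis (mono_tags, lifting) LeastI)+
    have "int g dvd j" if "j \<in> I" for j
    proof -
      have "j mod int g \<in> I"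
        using add_subgroup_diff[OF I that mult[OF g(2), of "j div int g"]]
        by (simp add: minus_div_mult_eq_mod)
      moreover have "0 \<le> j mod int g" "j mod int g < int g" using g by auto
      ultimately have "j mod int g = 0"
        using not_less_Least[of "nat (j mod int g)" "\<lambda>g. 0 < g \<and> int g \<in> I", folded g_def] by auto
      then show ?thesis by (simp add: dvd_eq_mod_eq_0)
    qed
    then have "int g dvd Gcd I" by (rule Gcd_greatest)
    then have "int g dvd k" using dvd by (rule dvd_trans)
    then show ?thesis using mult[OF g(2)] by (auto simp: mult.commute elim!: dvdE)
  qed
qed simp

text \<open>The order is \<open>0\<close> if no positive multiple of \<open>x\<close> lies in \<open>B\<close>.\<close>

definition order_mod :: "'a::ab_group_add set \<Rightarrow> 'a \<Rightarrow> nat" where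
  "order_mod B x = nat (Gcd {k. zmul k x \<in> B})"

lemma zmul_mem_iff_order_mod_dvd:
  assumes "add_subgroup B" shows "zmul k x \<in> B \<longleftrightarrow> int (order_mod B x) dvd k"
  using mem_int_subgroup_iff_Gcd_dvd[OF add_subgroup_vimage[OF additive_zmul_left assms], of k x]
  by (simp add: order_mod_def)

lemma index_int_multiples:
  assumes "g \<noteq> 0" shows "index (UNIV :: int set) {k. g dvd k} = nat \<bar>g\<bar>"
proof -
  have sub: "add_subgroup {k. g dvd k}" by (auto intro: add_subgroupI)
  have "coset {k. g dvd k} x = coset {k. g dvd k} (x mod \<bar>g\<bar>)" for x
    by (simp add: coset_eq_iff[OF sub] minus_mod_eq_mult_div)
  moreover have "x mod \<bar>g\<bar> \<in> {0..<\<bar>g\<bar>}" for x using assms by simp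
  ultimately have "range (coset {k. g dvd k}) = coset {k. g dvd k} ` {0..<\<bar>g\<bar>}" by blast
  moreover have "inj_on (coset {k. g dvd k}) {0..<\<bar>g\<bar>}"
  proof (rule inj_onI)
    fix x y assume "x \<in> {0..<\<bar>g\<bar>}" "y \<in> {0..<\<bar>g\<bar>}" "coset {k. g dvd k} x = coset {k. g dvd k} y"
    then have "\<bar>g\<bar> dvd x - y" "\<bar>x - y\<bar> < \<bar>g\<bar>" by (auto simp: coset_eq_iff[OF sub])
    then show "x = y" using zdvd_imp_le[of "\<bar>g\<bar>" "\<bar>x - y\<bar>"] by force
  qed
  ultimately show ?thesis by (simp add: index_altdef card_image)
qed

section \<open>Pairings modulo the integers\<close>

lemma Ints_cong: "x - y \<in> \<int> \<Longrightarrow> (x :: rat) \<in> \<int> \<longleftrightarrow> y \<in> \<int>"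
  by (rule add_subgroup_cong[OF add_subgroup_Ints])

lemma of_int_div_of_nat_mem_Ints_iff:
  assumes "n > 0" shows "(of_int k :: rat) / of_nat n \<in> \<int> \<longleftrightarrow> int n dvd k"
proof
  assume "(of_int k :: rat) / of_nat n \<in> \<int>"
  then obtain j where "(of_int k :: rat) / of_nat n = of_int j" by (auto elim: Ints_cases)
  then have "(of_int k :: rat) = of_int (j * int n)" using assms by (simp add: field_simps)
  then show "int n dvd k" unfolding of_int_eq_iff by simp
qed (use assms in \<open>auto elim!: dvdE\<close>)

definition additive_mod_Z :: "'a::ab_group_add set \<Rightarrow> ('a \<Rightarrow> rat) \<Rightarrow> bool" where
  "additive_mod_Z A f \<longleftrightarrow> (\<forall>x\<in>A. \<forall>y\<in>A. f (x + y) - (f x + f y) \<in> \<int>)"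

lemma additive_mod_Z_add:
  "additive_mod_Z A f \<Longrightarrow> x \<in> A \<Longrightarrow> y \<in> A \<Longrightarrow> f (x + y) - (f x + f y) \<in> \<int>"
  by (simp add: additive_mod_Z_def)

lemma additive_mod_Z_mono: "additive_mod_Z A f \<Longrightarrow> B \<subseteq> A \<Longrightarrow> additive_mod_Z B f"
  by (auto simp: additive_mod_Z_def)

lemma additive_mod_Z_diff:
  assumes "add_subgroup A" "additive_mod_Z A f" "x \<in> A" "y \<in> A"
  shows "f (x - y) - (f x - f y) \<in> \<int>"
proof -
  have "f (x - y + y) - (f (x - y) + f y) \<in> \<int>"
    using assms by (intro additive_mod_Z_add add_subgroup_diff)
  from Ints_minus[OF this] show ?thesis by (simp add: algebra_simps)
qed

lemma additive_mod_Z_zero: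
  assumes "add_subgroup A" "additive_mod_Z A f" shows "f 0 \<in> \<int>"
  using additive_mod_Z_diff[OF assms, of 0 0] add_subgroup_zero[OF assms(1)] by simp

lemma add_subgroup_additive_mod_Z_kernel:
  assumes "add_subgroup A" "additive_mod_Z A f" shows "add_subgroup {x \<in> A. f x \<in> \<int>}"
proof (rule add_subgroupI)
  show "0 \<in> {x \<in> A. f x \<in> \<int>}"
    using additive_mod_Z_zero[OF assms] add_subgroup_zero[OF assms(1)] by simp
  fix x y assume "x \<in> {x \<in> A. f x \<in> \<int>}" "y \<in> {x \<in> A. f x \<in> \<int>}"
  then show "x - y \<in> {x \<in> A. f x \<in> \<int>}"
    using Ints_cong[OF additive_mod_Z_diff[OF assms, of x y]] add_subgroup_diff[OF assms(1), of x y]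
    by simp
qed

lemma additive_mod_Z_zmul:
  assumes A: "add_subgroup A" and f: "additive_mod_Z A f" and x: "x \<in> A"
  shows "f (zmul k x) - of_int k * f x \<in> \<int>"
proof (induction k rule: int_induct[where k = 0])
  case base
  then show ?case using additive_mod_Z_zero[OF A f] by simp
next
  case (step1 i)
  have "f (zmul i x + x) - (f (zmul i x) + f x) \<in> \<int>"
    by (rule additive_mod_Z_add[OF f add_subgroup_zmul[OF A x] x])
  from Ints_add[OF this step1(2)] show ?case by (simp add: zmul_add_left algebra_simps)
next
  case (step2 i)
  have "f (zmul i x - x) - (f (zmul i x) - f x) \<in> \<int>"
    by (rule additive_mod_Z_diff[OF A f add_subgroup_zmul[OF A x] x])
  from Ints_add[OF this step2(2)] show ?case by (simp add: zmul_diff_left algebra_simps)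
qed

lemma add_subgroup_numerators:
  assumes A: "add_subgroup A" and f: "additive_mod_Z A f"
  shows "add_subgroup {k :: int. \<exists>a\<in>A. f a - of_int k / of_nat n \<in> \<int>}" (is "add_subgroup ?I")
proof (rule add_subgroupI)
  show "0 \<in> ?I" using additive_mod_Z_zero[OF A f] add_subgroup_zero[OF A] by auto
  fix k l assume "k \<in> ?I" "l \<in> ?I"
  then obtain a c where a: "a \<in> A" "f a - of_int k / of_nat n \<in> \<int>"
    and c: "c \<in> A" "f c - of_int l / of_nat n \<in> \<int>"
    by blast
  from Ints_add[OF additive_mod_Z_diff[OF A f a(1) c(1)] Ints_diff[OF a(2) c(2)]]
  have "f (a - c) - of_int (k - l) / of_nat n \<in> \<int>" by (simp add: algebra_simps diff_divide_distrib)
  then show "k - l \<in> ?I" using add_subgroup_diff[OF A a(1) c(1)] by blast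
qed

lemma add_subgroup_integral_characters:
  "add_subgroup {f. additive_mod_Z A f \<and> (\<forall>b\<in>B. f b \<in> \<int>)}"
proof (rule add_subgroupI)
  show "0 \<in> {f. additive_mod_Z A f \<and> (\<forall>b\<in>B. f b \<in> \<int>)}" by (simp add: additive_mod_Z_def)
  fix f g assume fg: "f \<in> {f. additive_mod_Z A f \<and> (\<forall>b\<in>B. f b \<in> \<int>)}"
    "g \<in> {f. additive_mod_Z A f \<and> (\<forall>b\<in>B. f b \<in> \<int>)}"
  have "(f - g) (x + y) - ((f - g) x + (f - g) y) \<in> \<int>" if "x \<in> A" "y \<in> A" for x y
  proof -
    have "f (x + y) - (f x + f y) - (g (x + y) - (g x + g y)) \<in> \<int>"
      using fg that by (intro Ints_diff additive_mod_Z_add) auto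
    then show ?thesis by (simp add: algebra_simps)
  qed
  then show "f - g \<in> {f. additive_mod_Z A f \<and> (\<forall>b\<in>B. f b \<in> \<int>)}"
    using fg by (simp add: additive_mod_Z_def)
qed

abbreviation (input) flip :: "('a \<Rightarrow> 'b \<Rightarrow> 'c) \<Rightarrow> 'b \<Rightarrow> 'a \<Rightarrow> 'c" where
  "flip f \<equiv> \<lambda>y x. f x y"

definition annihilator :: "'a set \<Rightarrow> 'b set \<Rightarrow> ('a \<Rightarrow> 'b \<Rightarrow> rat) \<Rightarrow> 'a set" where
  "annihilator A C \<phi> = {a \<in> A. \<forall>c\<in>C. \<phi> a c \<in> \<int>}"

lemma annihilator_subset: "annihilator A C \<phi> \<subseteq> A"
  by (auto simp: annihilator_def)

lemma annihilator_mono: "A \<subseteq> B \<Longrightarrow> D \<subseteq> C \<Longrightarrow> annihilator A C \<phi> \<subseteq> annihilator B D \<phi>"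
  by (auto simp: annihilator_def)

lemma subset_annihilator_annihilator:
  "D \<subseteq> A \<Longrightarrow> D \<subseteq> annihilator A (annihilator C D (flip \<phi>)) \<phi>"
  by (auto simp: annihilator_def)

locale pairing_mod_Z =
  fixes A :: "'a::ab_group_add set" and C :: "'b::ab_group_add set" and \<phi> :: "'a \<Rightarrow> 'b \<Rightarrow> rat"
  assumes add_subgroup_left: "add_subgroup A" and add_subgroup_right: "add_subgroup C"
    and additive_left: "c \<in> C \<Longrightarrow> additive_mod_Z A (\<lambda>a. \<phi> a c)"
    and additive_right: "a \<in> A \<Longrightarrow> additive_mod_Z C (\<phi> a)"
begin

lemma pairing_flip: "pairing_mod_Z C A (flip \<phi>)"
  by unfold_locales
    (simp_all add: add_subgroup_left add_subgroup_right additive_left additive_right)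

lemma pairing_restrict:
  "add_subgroup A' \<Longrightarrow> A' \<subseteq> A \<Longrightarrow> add_subgroup C' \<Longrightarrow> C' \<subseteq> C \<Longrightarrow> pairing_mod_Z A' C' \<phi>"
  by unfold_locales
    (auto intro: additive_mod_Z_mono[OF additive_left] additive_mod_Z_mono[OF additive_right])

lemmas zmul_left = additive_mod_Z_zmul[OF add_subgroup_left additive_left]

lemma add_subgroup_annihilator:
  assumes "D \<subseteq> C" shows "add_subgroup (annihilator A D \<phi>)"
proof (rule add_subgroupI)
  have kernel: "add_subgroup {a \<in> A. \<phi> a c \<in> \<int>}" if "c \<in> D" for c
    using add_subgroup_additive_mod_Z_kernel[OF add_subgroup_left additive_left] that assms by blast
  show "0 \<in> annihilator A D \<phi>"
    using add_subgroup_zero[OF kernel] add_subgroup_zero[OF add_subgroup_left]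
    by (auto simp: annihilator_def)
  show "x - y \<in> annihilator A D \<phi>" if "x \<in> annihilator A D \<phi>" "y \<in> annihilator A D \<phi>" for x y
    using add_subgroup_diff[OF kernel, of _ x y] add_subgroup_diff[OF add_subgroup_left, of x y]
      that
    by (auto simp: annihilator_def)
qed

lemma zmul_mem_annihilator_iff:
  assumes "x \<in> A"
  shows "zmul k x \<in> annihilator A C \<phi> \<longleftrightarrow> (\<forall>c\<in>C. of_int k * \<phi> x c \<in> \<int>)"
  using Ints_cong[OF zmul_left[OF _ assms]] add_subgroup_zmul[OF add_subgroup_left assms]
  by (auto simp: annihilator_def)

lemma order_mod_annihilator_pos:
  assumes "index A (annihilator A C \<phi>) > 0" "x \<in> A"
  shows "order_mod (annihilator A C \<phi>) x > 0"
proof (rule gr0I)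
  assume "order_mod (annihilator A C \<phi>) x = 0"
  then show False
    using zmul_index_mem[OF add_subgroup_left add_subgroup_annihilator[OF order_refl]
      annihilator_subset assms(2)]
      assms(1) by (simp add: zmul_mem_iff_order_mod_dvd[OF add_subgroup_annihilator[OF order_refl]])
qed

lemma order_mod_right_annihilator_pos:
  assumes fin: "index A (annihilator A C \<phi>) > 0" and y: "y \<in> C"
  shows "order_mod (annihilator C A (flip \<phi>)) y > 0"
proof -
  interpret flip: pairing_mod_Z C A "flip \<phi>" by (rule pairing_flip)
  let ?N = "index A (annihilator A C \<phi>)"
  have "of_int (int ?N) * \<phi> a y \<in> \<int>" if "a \<in> A" for a
    using zmul_index_mem[OF add_subgroup_left add_subgroup_annihilator[OF order_refl]
      annihilator_subset that]
      y unfolding zmul_mem_annihilator_iff[OF that] by (rule bspec)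
  then have "zmul (int ?N) y \<in> annihilator C A (flip \<phi>)"
    using flip.zmul_mem_annihilator_iff[OF y] by simp
  then show ?thesis
    using zmul_mem_iff_order_mod_dvd[OF flip.add_subgroup_annihilator[OF order_refl]] fin
    by (auto intro: gr0I)
qed

lemma dvd_order_mod_annihilator:
  assumes "x \<in> A" "y \<in> C" "n > 0" "\<phi> x y - 1 / of_nat n \<in> \<int>"
  shows "n dvd order_mod (annihilator A C \<phi>) x"
proof -
  let ?m = "order_mod (annihilator A C \<phi>) x"
  have "of_int (int ?m) * \<phi> x y \<in> \<int>"
    using zmul_mem_annihilator_iff[OF assms(1)] assms(2)
      zmul_mem_iff_order_mod_dvd[OF add_subgroup_annihilator[OF order_refl], of "int ?m" x] by simp
  moreover have "of_int (int ?m) * \<phi> x y - of_int (int ?m) / of_nat n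
      = of_int (int ?m) * (\<phi> x y - 1 / of_nat n)"
    by (simp add: algebra_simps)
  then have "of_int (int ?m) * \<phi> x y - of_int (int ?m) / of_nat n \<in> \<int>"
    by (simp only:) (rule Ints_mult[OF Ints_of_int assms(4)])
  ultimately have "of_int (int ?m) / of_nat n \<in> (\<int> :: rat set)" using Ints_cong by blast
  then show ?thesis unfolding of_int_div_of_nat_mem_Ints_iff[OF assms(3)] by simp
qed

text \<open>With \<open>n\<close> the order of \<open>x\<close>, the values \<open>\<phi> x c\<close> form a subgroup of \<open>(1/n) \<int> / \<int>\<close>. A proper
  subgroup would be killed by a proper divisor \<open>m\<close> of \<open>n\<close>, and then \<open>m x\<close> would annihilate \<open>C\<close>.\<close>

lemma attains_inverse_order:
  assumes x: "x \<in> A" and n: "n = order_mod (annihilator A C \<phi>) x" "n > 0"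
  shows "\<exists>y\<in>C. \<phi> x y - 1 / of_nat n \<in> \<int>"
proof -
  have order: "zmul k x \<in> annihilator A C \<phi> \<longleftrightarrow> int n dvd k" for k
    unfolding n(1) by (rule zmul_mem_iff_order_mod_dvd[OF add_subgroup_annihilator[OF order_refl]])
  define I where "I = {k :: int. \<exists>c\<in>C. \<phi> x c - of_int k / of_nat n \<in> \<int>}"
  have I: "add_subgroup I"
    unfolding I_def by (rule add_subgroup_numerators[OF add_subgroup_right additive_right[OF x]])
  note mem_I_iff = mem_int_subgroup_iff_Gcd_dvd[OF I]
  have "int n \<in> I"
    unfolding I_def
    using additive_mod_Z_zero[OF add_subgroup_right additive_right[OF x]]
      add_subgroup_zero[OF add_subgroup_right] n(2) by auto
  then obtain m where m: "int n = Gcd I * m" unfolding mem_I_iff by (elim dvdE)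
  have "of_int m * \<phi> x c \<in> \<int>" if c: "c \<in> C" for c
  proof -
    have "of_int (int n) * \<phi> x c \<in> \<int>"
      using zmul_mem_annihilator_iff[OF x, of "int n"] order[of "int n"] c by simp
    then obtain k where "of_int (int n) * \<phi> x c = of_int k" by (auto elim: Ints_cases)
    then have k: "\<phi> x c = of_int k / of_nat n" using n(2) by (simp add: field_simps)
    then have "k \<in> I" unfolding I_def using c by (auto intro!: bexI[of _ c])
    then obtain j where "k = Gcd I * j" unfolding mem_I_iff by (elim dvdE)
    moreover have "of_nat n = (of_int (Gcd I) * of_int m :: rat)"
      using m by (metis of_int_mult of_int_of_nat_eq)
    moreover have "(of_int (Gcd I) :: rat) \<noteq> 0" "(of_int m :: rat) \<noteq> 0"
      using calculation(2) n(2) by fastforce+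
    ultimately have "of_int m * \<phi> x c = of_int j" using k by simp
    then show ?thesis by simp
  qed
  then have "int n dvd m" using order zmul_mem_annihilator_iff[OF x] by blast
  then have "Gcd I * m dvd 1 * m" using m by simp
  moreover have "m \<noteq> 0" using m n(2) by auto
  ultimately have "Gcd I dvd 1" unfolding dvd_mult_cancel_right by blast
  then have "1 \<in> I" unfolding mem_I_iff by simp
  then show ?thesis by (simp add: I_def)
qed

end

subsection \<open>Splitting off dual cyclic groups\<close>

definition dual_generators ::
    "'a::ab_group_add set \<Rightarrow> 'b::ab_group_add set \<Rightarrow> ('a \<Rightarrow> 'b \<Rightarrow> rat) \<Rightarrow> nat \<Rightarrow> 'a \<Rightarrow> 'b \<Rightarrow> bool" where
  "dual_generators A C \<phi> n x y \<longleftrightarrow> x \<in> A \<and> y \<in> C \<and> n > 0 \<and> \<phi> x y - 1 / of_nat n \<in> \<int> \<and>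
     zmul (int n) x \<in> annihilator A C \<phi> \<and> zmul (int n) y \<in> annihilator C A (flip \<phi>)"

lemma dual_generators_flip: "dual_generators A C \<phi> n x y \<Longrightarrow> dual_generators C A (flip \<phi>) n y x"
  by (simp add: dual_generators_def)

context pairing_mod_Z
begin

text \<open>Take \<open>x\<close> of maximal order \<open>n\<close> and \<open>y\<close> with \<open>\<phi> x y = 1/n\<close>. The order of \<open>y\<close> is a multiple of
  \<open>n\<close>, and it divides the order of some element of \<open>A\<close>, so it is \<open>n\<close> as well.\<close>

lemma ex_dual_generators:
  assumes fin: "index A (annihilator A C \<phi>) > 0" and "A \<noteq> annihilator A C \<phi>"
  shows "\<exists>n x y. n > 1 \<and> dual_generators A C \<phi> n x y"
proof -
  interpret flip: pairing_mod_Z C A "flip \<phi>" by (rule pairing_flip)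
  let ?A0 = "annihilator A C \<phi>" and ?C0 = "annihilator C A (flip \<phi>)"
  have A0: "add_subgroup ?A0" and C0: "add_subgroup ?C0"
    by (simp_all add: add_subgroup_annihilator flip.add_subgroup_annihilator)
  let ?N = "index A ?A0"
  have "zmul (int ?N) a \<in> ?A0" if "a \<in> A" for a
    by (rule zmul_index_mem[OF add_subgroup_left A0 annihilator_subset that])
  then have "order_mod ?A0 a \<le> ?N" if "a \<in> A" for a
    using that fin by (auto simp: zmul_mem_iff_order_mod_dvd[OF A0] intro: dvd_imp_le)
  then obtain x where x: "x \<in> A" and max: "\<And>a. a \<in> A \<Longrightarrow> order_mod ?A0 a \<le> order_mod ?A0 x"
    using ex_has_greatest_nat[of "\<lambda>a. a \<in> A" 0 "order_mod ?A0" "Suc ?N"]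
      add_subgroup_zero[OF add_subgroup_left] by (auto simp: less_Suc_eq_le)
  define n where "n = order_mod ?A0 x"
  have n: "n > 0" unfolding n_def by (rule order_mod_annihilator_pos[OF fin x])
  obtain a where "a \<in> A" "a \<notin> ?A0" using assms(2) annihilator_subset[of A C \<phi>] by blast
  then have "order_mod ?A0 a \<noteq> 1" using zmul_mem_iff_order_mod_dvd[OF A0, of 1 a] by simp
  then have "n > 1"
    using order_mod_annihilator_pos[OF fin \<open>a \<in> A\<close>] max[OF \<open>a \<in> A\<close>] unfolding n_def by linarith
  obtain y where y: "y \<in> C" "\<phi> x y - 1 / of_nat n \<in> \<int>"
    using attains_inverse_order[OF x n_def n] by blast
  define m where "m = order_mod ?C0 y"
  have m: "m > 0" unfolding m_def by (rule order_mod_right_annihilator_pos[OF fin y(1)])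
  obtain z where z: "z \<in> A" "\<phi> z y - 1 / of_nat m \<in> \<int>"
    using flip.attains_inverse_order[OF y(1) m_def m] by blast
  then have "m \<le> n"
    using dvd_imp_le[OF dvd_order_mod_annihilator[OF z(1) y(1) m z(2)]] max[OF z(1)]
      order_mod_annihilator_pos[OF fin z(1)] by (simp add: n_def)
  moreover have "n dvd m" unfolding m_def by (rule flip.dvd_order_mod_annihilator[OF y(1) x n y(2)])
  ultimately have "m = n" using m by (simp add: dvd_imp_le le_antisym)
  then have "dual_generators A C \<phi> n x y"
    using x y n zmul_mem_iff_order_mod_dvd[OF A0, of "int n" x]
      zmul_mem_iff_order_mod_dvd[OF C0, of "int n" y]
    by (simp add: dual_generators_def n_def m_def)
  then show ?thesis using \<open>n > 1\<close> by blast
qed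

context
  fixes n x y assumes gens: "dual_generators A C \<phi> n x y"
begin

lemma generators_mem: "x \<in> A" "y \<in> C" "zmul (int n) x \<in> annihilator A C \<phi>"
  and n_pos: "n > 0" and value_generators: "\<phi> x y - 1 / of_nat n \<in> \<int>"
  using gens by (auto simp: dual_generators_def)

lemma value_zmul_generator: "\<phi> (zmul k x) y - of_int k / of_nat n \<in> \<int>"
proof -
  have "\<phi> (zmul k x) y - of_int k * \<phi> x y + of_int k * (\<phi> x y - 1 / of_nat n) \<in> \<int>"
    by (intro Ints_add Ints_mult zmul_left generators_mem value_generators Ints_of_int)
  then show ?thesis by (simp add: algebra_simps)
qed

lemma ex_diff_zmul_generator_mem:
  assumes a: "a \<in> A" shows "\<exists>k. a - zmul k x \<in> annihilator A {y} \<phi>"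
proof -
  interpret flip: pairing_mod_Z C A "flip \<phi>" by (rule pairing_flip)
  have "zmul (int n) y \<in> annihilator C A (flip \<phi>)" using gens by (simp add: dual_generators_def)
  then have "of_nat n * \<phi> a y \<in> \<int>"
    unfolding flip.zmul_mem_annihilator_iff[OF generators_mem(2)] using a by simp
  then obtain k where "of_nat n * \<phi> a y = of_int k" by (auto elim: Ints_cases)
  then have k: "\<phi> a y = of_int k / of_nat n" using n_pos by (simp add: field_simps)
  have kx: "zmul k x \<in> A" by (rule add_subgroup_zmul[OF add_subgroup_left generators_mem(1)])
  have "\<phi> (a - zmul k x) y - (\<phi> a y - \<phi> (zmul k x) y) \<in> \<int>"
    by (rule additive_mod_Z_diff[OF add_subgroup_left additive_left[OF generators_mem(2)] a kx])
  from Ints_diff[OF this value_zmul_generator[of k]] have "\<phi> (a - zmul k x) y \<in> \<int>" by (simp add: k)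
  then show ?thesis
    using add_subgroup_diff[OF add_subgroup_left a kx] by (auto simp: annihilator_def)
qed

lemma complement_plus_multiples: "annihilator A {y} \<phi> + range (\<lambda>k. zmul k x) = A"
proof
  show "annihilator A {y} \<phi> + range (\<lambda>k. zmul k x) \<subseteq> A"
    using add_subgroup_zmul[OF add_subgroup_left generators_mem(1)]
    by (intro plus_subset_add_subgroup[OF add_subgroup_left annihilator_subset]) auto
  show "A \<subseteq> annihilator A {y} \<phi> + range (\<lambda>k. zmul k x)"
    using ex_diff_zmul_generator_mem
    unfolding add.commute[of "annihilator A {y} \<phi>"] mem_plus_iff subset_iff by blast
qed

lemma complement_plus_zmul_mem_annihilator_iff:
  assumes b: "b \<in> annihilator A {y} \<phi>"
  shows "b + zmul k x \<in> annihilator A C \<phi> \<longleftrightarrow> b \<in> annihilator A C \<phi> \<and> int n dvd k"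
proof -
  have A0: "add_subgroup (annihilator A C \<phi>)" by (simp add: add_subgroup_annihilator)
  have dvd: "int n dvd k" if "b + zmul k x \<in> annihilator A C \<phi>"
  proof -
    have "add_subgroup (annihilator A {y} \<phi>)"
      by (rule add_subgroup_annihilator) (simp add: generators_mem)
    moreover have "b + zmul k x \<in> annihilator A {y} \<phi>"
      using that generators_mem by (auto simp: annihilator_def)
    ultimately have "zmul k x \<in> annihilator A {y} \<phi>"
      using b by (metis add_subgroup_cancel_right add.commute)
    then show ?thesis
      using Ints_cong[OF value_zmul_generator[of k]] of_int_div_of_nat_mem_Ints_iff[OF n_pos]
      by (simp add: annihilator_def)
  qed
  have "zmul k x \<in> annihilator A C \<phi>" if "int n dvd k"
    using that add_subgroup_zmul[OF A0 generators_mem(3)]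
    by (auto simp: zmul_zmul mult.commute elim!: dvdE)
  then show ?thesis using dvd add_subgroup_cancel_right[OF A0] by blast
qed

end

lemma annihilator_complement:
  assumes gens: "dual_generators A C \<phi> n x y"
  shows "annihilator (annihilator A {y} \<phi>) (annihilator C {x} (flip \<phi>)) \<phi> = annihilator A C \<phi>"
proof
  interpret flip: pairing_mod_Z C A "flip \<phi>" by (rule pairing_flip)
  show "annihilator A C \<phi> \<subseteq> annihilator (annihilator A {y} \<phi>) (annihilator C {x} (flip \<phi>)) \<phi>"
    using generators_mem(2)[OF gens] by (auto simp: annihilator_def)
  show "annihilator (annihilator A {y} \<phi>) (annihilator C {x} (flip \<phi>)) \<phi> \<subseteq> annihilator A C \<phi>"
  proof
    fix a assume "a \<in> annihilator (annihilator A {y} \<phi>) (annihilator C {x} (flip \<phi>)) \<phi>"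
    then have a: "a \<in> A" "\<phi> a y \<in> \<int>" "\<And>c. c \<in> annihilator C {x} (flip \<phi>) \<Longrightarrow> \<phi> a c \<in> \<int>"
      by (auto simp: annihilator_def)
    have kernel: "add_subgroup {c \<in> C. \<phi> a c \<in> \<int>}"
      by (rule add_subgroup_additive_mod_Z_kernel[OF add_subgroup_right additive_right[OF a(1)]])
    have "c \<in> {c \<in> C. \<phi> a c \<in> \<int>}" if c: "c \<in> C" for c
    proof -
      obtain k where "c - zmul k y \<in> annihilator C {x} (flip \<phi>)"
        using flip.ex_diff_zmul_generator_mem[OF dual_generators_flip[OF gens] c] by blast
      then have "c - zmul k y \<in> {c \<in> C. \<phi> a c \<in> \<int>}"
        using a(3) annihilator_subset[of C "{x}" "flip \<phi>"] by blast
      moreover have "zmul k y \<in> {c \<in> C. \<phi> a c \<in> \<int>}"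
        by (rule add_subgroup_zmul[OF kernel]) (simp add: a(2) generators_mem(2)[OF gens])
      ultimately have "c - zmul k y + zmul k y \<in> {c \<in> C. \<phi> a c \<in> \<int>}"
        by (rule add_subgroup_add[OF kernel])
      then show ?thesis by simp
    qed
    then show "a \<in> annihilator A C \<phi>" using a(1) by (simp add: annihilator_def)
  qed
qed

lemma index_complement_less:
  assumes gens: "dual_generators A C \<phi> n x y" and n: "n > 1"
    and fin: "index A (annihilator A C \<phi>) > 0"
  shows "index (annihilator A {y} \<phi>) (annihilator A C \<phi>) < index A (annihilator A C \<phi>)"
    and "index (annihilator A {y} \<phi>) (annihilator A C \<phi>) > 0"
proof -
  let ?A' = "annihilator A {y} \<phi>" and ?A0 = "annihilator A C \<phi>"
  have A': "add_subgroup ?A'" and A0: "add_subgroup ?A0"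
    using generators_mem[OF gens] by (simp_all add: add_subgroup_annihilator)
  have "\<not> int n dvd 1" using n by simp
  then have "\<phi> x y \<notin> \<int>"
    using Ints_cong[OF value_generators[OF gens]] of_int_div_of_nat_mem_Ints_iff[of n 1] n by simp
  then have "?A' \<noteq> A" using generators_mem(1)[OF gens] by (auto simp: annihilator_def)
  then have "index A ?A' \<noteq> 1"
    using index_eq_1_iff[OF add_subgroup_left A' annihilator_subset] by simp
  moreover have "index A ?A0 = index A ?A' * index ?A' ?A0"
    by (rule index_mult[OF add_subgroup_left A' A0 _ annihilator_subset])
      (use generators_mem(2)[OF gens] in \<open>auto simp: annihilator_def\<close>)
  ultimately show "index ?A' ?A0 < index A ?A0" "index ?A' ?A0 > 0"
    using fin by (cases "index A ?A'"; cases "index ?A' ?A0"; simp)+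
qed

end

text \<open>The graph of an isomorphism from \<open>A / A0\<close> to \<open>C / C0\<close>, pulled back to \<open>A \<times> C\<close>.\<close>

definition correspondence ::
    "'a::ab_group_add set \<Rightarrow> 'a set \<Rightarrow> 'b::ab_group_add set \<Rightarrow> 'b set \<Rightarrow> ('a \<times> 'b) set \<Rightarrow> bool" where
  "correspondence A A0 C C0 R \<longleftrightarrow> add_subgroup R \<and> fst ` R = A \<and> snd ` R = C \<and>
     (\<forall>a c. (a, c) \<in> R \<longrightarrow> (a \<in> A0 \<longleftrightarrow> c \<in> C0))"

lemma additive_fst: "additive fst" and additive_snd: "additive snd"
  by (simp_all add: additive_def)

lemma correspondence_iso:
  assumes R: "correspondence A A0 C C0 R"
    and A0: "add_subgroup A0" "A0 \<subseteq> A" and C0: "add_subgroup C0" "C0 \<subseteq> C"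
  shows "add_group A Mod A0 \<cong> add_group C Mod C0"
proof -
  have sub: "add_subgroup R" and A: "fst ` R = A" and C: "snd ` R = C"
    and agree: "\<And>a c. (a, c) \<in> R \<Longrightarrow> a \<in> A0 \<longleftrightarrow> c \<in> C0"
    using R by (auto simp: correspondence_def)
  let ?K = "{r \<in> R. fst r \<in> A0}"
  have K: "add_subgroup ?K" "?K \<subseteq> R"
    using add_subgroup_Int[OF sub add_subgroup_vimage[OF additive_fst A0(1)]]
    by (simp_all add: Int_def)
  have groups: "add_subgroup A" "add_subgroup C"
    using add_subgroup_image[OF additive_fst sub] add_subgroup_image[OF additive_snd sub] A C
    by auto
  have left: "add_group R Mod ?K \<cong> add_group A Mod A0"
    by (rule Mod_iso_Mod[where f = fst])
      (use A subset_plus_left[OF A0(1)] in \<open>auto simp: sub K groups A0 additive_fst\<close>)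
  have right: "add_group R Mod ?K \<cong> add_group C Mod C0"
    by (rule Mod_iso_Mod[where f = snd])
      (use C agree subset_plus_left[OF C0(1)] in \<open>auto simp: sub K groups C0 additive_snd\<close>)
  interpret comm_group "add_group R Mod ?K" by (rule comm_group_Mod[OF sub K])
  show ?thesis using iso_trans[OF iso_sym[OF left] right] .
qed

lemma (in pairing_mod_Z) correspondence_plus_generators:
  assumes gens: "dual_generators A C \<phi> n x y"
    and R: "correspondence (annihilator A {y} \<phi>) (annihilator A C \<phi>)
      (annihilator C {x} (flip \<phi>)) (annihilator C A (flip \<phi>)) R"
  shows "correspondence A (annihilator A C \<phi>) C (annihilator C A (flip \<phi>))
    (R + range (\<lambda>k. zmul k (x, y)))"
proof -
  interpret flip: pairing_mod_Z C A "flip \<phi>" by (rule pairing_flip)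
  let ?A' = "annihilator A {y} \<phi>" and ?C' = "annihilator C {x} (flip \<phi>)"
  let ?Z = "range (\<lambda>k. zmul k (x, y))"
  note gens' = dual_generators_flip[OF gens]
  have sub: "add_subgroup R" and A': "fst ` R = ?A'" and C': "snd ` R = ?C'"
    and agree: "\<And>a c. (a, c) \<in> R \<Longrightarrow> a \<in> annihilator A C \<phi> \<longleftrightarrow> c \<in> annihilator C A (flip \<phi>)"
    using R by (auto simp: correspondence_def)
  have zmul_pair: "zmul k (x, y) = (zmul k x, zmul k y)" for k
    using additive_zmul_commute[OF additive_fst, of k "(x, y)"]
      additive_zmul_commute[OF additive_snd, of k "(x, y)"] by (simp add: prod_eq_iff)
  have "fst ` ?Z = range (\<lambda>k. zmul k x)" "snd ` ?Z = range (\<lambda>k. zmul k y)"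
    by (simp_all add: image_image zmul_pair)
  moreover have "add_subgroup (R + ?Z)"
    by (intro add_subgroup_plus sub add_subgroup_image additive_zmul_left add_subgroup_UNIV)
  moreover have "a \<in> annihilator A C \<phi> \<longleftrightarrow> c \<in> annihilator C A (flip \<phi>)"
    if ac: "(a, c) \<in> R + ?Z" for a c
  proof -
    obtain b e k where "(b, e) \<in> R" "(a, c) = (b, e) + zmul k (x, y)"
      using ac by (auto elim!: set_plus_elim)
    then have be: "(b, e) \<in> R" and a: "a = b + zmul k x" and c: "c = e + zmul k y"
      by (simp_all add: zmul_pair)
    have "b \<in> ?A'" "e \<in> ?C'" using A' C' be by force+
    then show ?thesis
      unfolding a c complement_plus_zmul_mem_annihilator_iff[OF gens \<open>b \<in> ?A'\<close>]
        flip.complement_plus_zmul_mem_annihilator_iff[OF gens' \<open>e \<in> ?C'\<close>]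
      using agree[OF be] by blast
  qed
  ultimately show ?thesis
    by (simp add: correspondence_def image_plus additive_fst additive_snd A' C'
        complement_plus_multiples[OF gens] flip.complement_plus_multiples[OF gens'])
qed

subsection \<open>Duality for finite quotients\<close>

lemma (in pairing_mod_Z) ex_correspondence:
  assumes "index A (annihilator A C \<phi>) > 0"
  shows "\<exists>R. correspondence A (annihilator A C \<phi>) C (annihilator C A (flip \<phi>)) R"
  using pairing_mod_Z_axioms assms
proof (induction "index A (annihilator A C \<phi>)" arbitrary: A C rule: less_induct)
  case less
  interpret pairing_mod_Z A C \<phi> by (rule less.prems)
  interpret flip: pairing_mod_Z C A "flip \<phi>" by (rule pairing_flip)
  let ?A0 = "annihilator A C \<phi>" and ?C0 = "annihilator C A (flip \<phi>)"
  have A0: "add_subgroup ?A0" by (simp add: add_subgroup_annihilator)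
  show ?case
  proof (cases "A = ?A0")
    case True
    then have "C = ?C0" by (auto simp: annihilator_def)
    have "correspondence A ?A0 C ?C0 (A \<times> C)"
      unfolding True[symmetric] \<open>C = ?C0\<close>[symmetric]
      using add_subgroup_left add_subgroup_right
      by (auto simp: correspondence_def fst_image_times snd_image_times zero_prod_def
        add_subgroup_closed
          intro!: add_subgroupI dest: add_subgroup_zero)
    then show ?thesis by blast
  next
    case False
    then obtain n x y where n: "n > 1" and gens: "dual_generators A C \<phi> n x y"
      using ex_dual_generators[OF less.prems(2)] by blast
    let ?A' = "annihilator A {y} \<phi>" and ?C' = "annihilator C {x} (flip \<phi>)"
    have A': "add_subgroup ?A'" and C': "add_subgroup ?C'"
      using generators_mem[OF gens]
      by (simp_all add: add_subgroup_annihilator flip.add_subgroup_annihilator)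
    have p': "pairing_mod_Z ?A' ?C' \<phi>"
      by (rule pairing_restrict[OF A' annihilator_subset C' annihilator_subset])
    note compl = annihilator_complement[OF gens]
      flip.annihilator_complement[OF dual_generators_flip[OF gens]]
    have "\<exists>R. correspondence ?A' ?A0 ?C' ?C0 R"
      using less.hyps[OF _ p'] index_complement_less[OF gens n less.prems(2)] unfolding compl
      by blast
    then show ?thesis using correspondence_plus_generators[OF gens] by blast
  qed
qed

context pairing_mod_Z
begin

theorem Mod_annihilator_iso:
  assumes "index A (annihilator A C \<phi>) > 0"
  shows "add_group A Mod annihilator A C \<phi> \<cong> add_group C Mod annihilator C A (flip \<phi>)"
proof -
  interpret flip: pairing_mod_Z C A "flip \<phi>" by (rule pairing_flip)
  obtain R where "correspondence A (annihilator A C \<phi>) C (annihilator C A (flip \<phi>)) R"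
    using ex_correspondence[OF assms] by blast
  then show ?thesis
    by (rule correspondence_iso)
      (simp_all add: add_subgroup_annihilator flip.add_subgroup_annihilator annihilator_subset)
qed

corollary index_annihilator_flip:
  "index A (annihilator A C \<phi>) > 0 \<Longrightarrow>
     index C (annihilator C A (flip \<phi>)) = index A (annihilator A C \<phi>)"
  unfolding index_def
  by (rule iso_same_card[symmetric], rule Mod_annihilator_iso) (simp add: index_def)

text \<open>Both \<open>D\<close> and its double annihilator are in duality with \<open>C\<close> modulo the annihilator of \<open>D\<close>, so
  they have the same index over the annihilator of \<open>C\<close>.\<close>

theorem annihilator_annihilator:
  assumes fin: "index A (annihilator A C \<phi>) > 0"
    and D: "add_subgroup D" "annihilator A C \<phi> \<subseteq> D" "D \<subseteq> A"
  shows "annihilator A (annihilator C D (flip \<phi>)) \<phi> = D"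
proof -
  let ?E = "annihilator C D (flip \<phi>)" and ?A0 = "annihilator A C \<phi>"
  let ?D' = "annihilator A ?E \<phi>"
  have A0: "add_subgroup ?A0" and D': "add_subgroup ?D'"
    by (simp_all add: add_subgroup_annihilator annihilator_subset)
  have DD': "D \<subseteq> ?D'" by (rule subset_annihilator_annihilator[OF D(3)])
  have dual: "index X ?A0 = index C (annihilator C X (flip \<phi>))"
    if X: "add_subgroup X" "?A0 \<subseteq> X" "X \<subseteq> A" for X
  proof -
    interpret X: pairing_mod_Z X C \<phi>
      by (rule pairing_restrict[OF X(1,3) add_subgroup_right order_refl])
    have "annihilator X C \<phi> = ?A0" using X by (auto simp: annihilator_def)
    moreover have "index X ?A0 > 0"
      using index_mult[OF add_subgroup_left X(1) A0 X(2,3)] fin by (auto intro: gr0I)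
    ultimately show ?thesis using X.index_annihilator_flip by simp
  qed
  have "annihilator C ?D' (flip \<phi>) = ?E" using D(3) by (auto simp: annihilator_def)
  then have "index ?D' ?A0 = index D ?A0"
    using dual[OF D' _ annihilator_subset] dual[OF D] D(2) DD' by simp
  moreover have "index A ?A0 = index A D * index D ?A0"
    by (rule index_mult[OF add_subgroup_left D(1) A0 D(2,3)])
  moreover have "index ?D' ?A0 = index ?D' D * index D ?A0"
    by (rule index_mult[OF D' D(1) A0 D(2) DD'])
  ultimately have "index ?D' D = 1" using fin by simp
  then show ?thesis using index_eq_1_iff[OF D' D(1) DD'] by simp
qed

definition characters :: "('b \<Rightarrow> rat) set" where
  "characters = {g. additive_mod_Z C g \<and> (\<forall>c\<in>annihilator C A (flip \<phi>). g c \<in> \<int>)}"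

definition represented_characters :: "('b \<Rightarrow> rat) set" where
  "represented_characters = {g \<in> characters. \<exists>a\<in>A. \<forall>c\<in>C. g c - \<phi> a c \<in> \<int>}"

lemma add_subgroup_characters: "add_subgroup characters"
  unfolding characters_def by (rule add_subgroup_integral_characters)

lemma value_mem_represented_characters:
  assumes "a \<in> A" shows "\<phi> a \<in> represented_characters"
proof -
  have "\<phi> a \<in> characters" using additive_right assms by (auto simp: characters_def annihilator_def)
  then show ?thesis using assms by (auto simp: represented_characters_def intro!: bexI[of _ a])
qed

lemma integral_mem_represented_characters:
  assumes "g \<in> characters" "\<And>c. c \<in> C \<Longrightarrow> g c \<in> \<int>" shows "g \<in> represented_characters"
proof -
  have "g c - \<phi> 0 c \<in> \<int>" if "c \<in> C" for c
    using assms(2) additive_mod_Z_zero[OF add_subgroup_left additive_left] that by (intro Ints_diff)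
  then show ?thesis
    using assms(1) add_subgroup_zero[OF add_subgroup_left] unfolding represented_characters_def
    by blast
qed

lemma add_subgroup_represented_characters: "add_subgroup represented_characters"
proof (rule add_subgroupI)
  show "0 \<in> represented_characters"
    by (rule integral_mem_represented_characters)
      (simp_all add: add_subgroup_zero[OF add_subgroup_characters])
  fix g h assume "g \<in> represented_characters" "h \<in> represented_characters"
  then obtain a b where gh: "g \<in> characters" "h \<in> characters" and ab: "a \<in> A" "b \<in> A"
    and g: "\<And>c. c \<in> C \<Longrightarrow> g c - \<phi> a c \<in> \<int>" and h: "\<And>c. c \<in> C \<Longrightarrow> h c - \<phi> b c \<in> \<int>"
    by (auto simp: represented_characters_def)
  have "(g - h) c - \<phi> (a - b) c \<in> \<int>" if c: "c \<in> C" for c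
  proof -
    have "(g c - \<phi> a c) - (h c - \<phi> b c) - (\<phi> (a - b) c - (\<phi> a c - \<phi> b c)) \<in> \<int>"
      by (intro Ints_diff g h c additive_mod_Z_diff[OF add_subgroup_left additive_left[OF c] ab])
    then show ?thesis by (simp add: algebra_simps)
  qed
  then show "g - h \<in> represented_characters"
    using add_subgroup_diff[OF add_subgroup_characters gh]
      add_subgroup_diff[OF add_subgroup_left ab]
    unfolding represented_characters_def by blast
qed

text \<open>The represented characters and all characters have the same annihilator in \<open>C\<close>.\<close>

theorem ex_represented_character:
  assumes fin: "index A (annihilator A C \<phi>) > 0"
    and f: "additive_mod_Z C f" "\<And>c. c \<in> annihilator C A (flip \<phi>) \<Longrightarrow> f c \<in> \<int>"
  shows "\<exists>a\<in>A. \<forall>c\<in>C. f c - \<phi> a c \<in> \<int>"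
proof -
  let ?C0 = "annihilator C A (flip \<phi>)" and ?eval = "\<lambda>c g. g c"
  interpret eval: pairing_mod_Z C characters ?eval
    by unfold_locales
      (simp_all add: add_subgroup_right add_subgroup_characters,
        simp_all add: characters_def additive_mod_Z_def)
  interpret flip_eval: pairing_mod_Z characters C "flip ?eval" by (rule eval.pairing_flip)
  have integral: "g c \<in> \<int>" if "g \<in> characters" "c \<in> ?C0" for g c
    using that by (simp add: characters_def)
  have sub: "represented_characters \<subseteq> characters" by (auto simp: represented_characters_def)
  have annihilator: "annihilator C E ?eval = ?C0"
    if "represented_characters \<subseteq> E" "E \<subseteq> characters" for E
    using that integral value_mem_represented_characters unfolding annihilator_def by blast
  have "index characters (annihilator characters C (flip ?eval)) > 0"
    using eval.index_annihilator_flip index_annihilator_flip[OF fin] fin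
    by (simp add: annihilator[OF sub order_refl])
  moreover have "annihilator characters C (flip ?eval) \<subseteq> represented_characters"
    by (auto simp: annihilator_def intro: integral_mem_represented_characters)
  ultimately have "annihilator characters (annihilator C represented_characters ?eval) (flip ?eval)
      = represented_characters"
    using flip_eval.annihilator_annihilator add_subgroup_represented_characters sub by blast
  moreover have "annihilator characters ?C0 (flip ?eval) = characters"
    using integral unfolding annihilator_def by blast
  ultimately have "characters = represented_characters" using annihilator[OF order_refl sub] by simp
  moreover have "f \<in> characters" using f by (simp add: characters_def)
  ultimately show ?thesis by (auto simp: represented_characters_def)
qed

end

section \<open>Antisymmetric pairings\<close>

lemma square_or_twice_square_iff: "square_or_twice_square n \<longleftrightarrow> is_square n \<or> is_square (2 * n)"
proof -
  have "is_square (2 * n) \<longleftrightarrow> (\<exists>k. n = 2 * k\<^sup>2)"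
  proof
    assume "is_square (2 * n)"
    then obtain j where j: "2 * n = j\<^sup>2" by (elim is_nth_powerE)
    then have "even (j\<^sup>2)" by (metis dvd_triv_left)
    then obtain k where "j = 2 * k" by auto
    then have "n = 2 * k\<^sup>2" using j by (simp add: power2_eq_square)
    then show "\<exists>k. n = 2 * k\<^sup>2" by blast
  next
    assume "\<exists>k. n = 2 * k\<^sup>2"
    then obtain k where "n = 2 * k\<^sup>2" by blast
    then have "2 * n = (2 * k)\<^sup>2" by (simp add: power_mult_distrib)
    then show "is_square (2 * n)" by (rule is_nth_powerI)
  qed
  then show ?thesis by (auto simp: square_or_twice_square_def is_nth_power_def)
qed

lemma square_or_twice_square_mult_square:
  "square_or_twice_square n \<Longrightarrow> square_or_twice_square (n * k\<^sup>2)"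
  unfolding square_or_twice_square_iff
  by (auto simp: mult.assoc[symmetric] intro: is_nth_power_mult)

lemma square_or_twice_square_cancel:
  assumes "square_or_twice_square a" "square_or_twice_square (a * b)" "a > 0"
  shows "square_or_twice_square b"
proof -
  have four: "is_square (4 * n)" if "is_square n" for n :: nat
    using is_nth_power_mult[OF is_nth_power_nth_power[of 2 2] that] by simp
  from assms(1) consider "is_square a" | "is_square (2 * a)"
    unfolding square_or_twice_square_iff by blast
  then show ?thesis
  proof cases
    case 1
    have "is_square b \<or> is_square (2 * b)"
      using assms(2) is_nth_power_mult_cancel_left[OF 1, of b]
        is_nth_power_mult_cancel_left[OF 1, of "2 * b"] assms(3)
      by (simp add: square_or_twice_square_iff mult.left_commute)
    then show ?thesis unfolding square_or_twice_square_iff .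
  next
    case 2
    have "is_square (2 * a * b) \<or> is_square (2 * a * (2 * b))"
      using assms(2) four[of "a * b"] by (auto simp: square_or_twice_square_iff mult_ac)
    then show ?thesis
      using is_nth_power_mult_cancel_left[OF 2, of b]
        is_nth_power_mult_cancel_left[OF 2, of "2 * b"] assms(3)
      unfolding square_or_twice_square_iff by auto
  qed
qed

lemma Ints_add_half_integers:
  fixes u v :: rat
  assumes "u \<notin> \<int>" "v \<notin> \<int>" "u + u \<in> \<int>" "v + v \<in> \<int>" shows "u + v \<in> \<int>"
proof -
  have "\<exists>j. w = of_int j + 1/2" if "w \<notin> \<int>" "w + w \<in> \<int>" for w :: rat
  proof -
    obtain k where k: "w + w = of_int k" using \<open>w + w \<in> \<int>\<close> by (auto elim: Ints_cases)
    show ?thesis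
    proof (cases "even k")
      case True
      then obtain j where "k = 2 * j" by blast
      then have "w = of_int j" using k by simp
      then show ?thesis using \<open>w \<notin> \<int>\<close> by simp
    next
      case False
      then obtain j where "k = 2 * j + 1" by (elim oddE)
      then have "w = of_int j + 1/2" using k by (simp add: field_simps)
      then show ?thesis by blast
    qed
  qed
  then obtain i j where "u = of_int i + 1/2" "v = of_int j + 1/2" using assms by metis
  then have "u + v = of_int (i + j + 1)" by simp
  then show ?thesis by (simp only: Ints_of_int)
qed

locale antisymmetric_pairing_mod_Z = pairing_mod_Z T T \<phi>
  for T :: "'a::ab_group_add set" and \<phi> +
  assumes antisymmetric: "x \<in> T \<Longrightarrow> y \<in> T \<Longrightarrow> \<phi> x y + \<phi> y x \<in> \<int>"
begin

lemma mem_Ints_swap: "x \<in> T \<Longrightarrow> y \<in> T \<Longrightarrow> \<phi> x y \<in> \<int> \<longleftrightarrow> \<phi> y x \<in> \<int>"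
  using antisymmetric by (metis Ints_diff add_diff_cancel_left' add_diff_cancel_right')

lemma annihilator_flip: "D \<subseteq> T \<Longrightarrow> A \<subseteq> T \<Longrightarrow> annihilator A D (flip \<phi>) = annihilator A D \<phi>"
  using mem_Ints_swap unfolding annihilator_def by blast

lemma antisymmetric_restrict:
  "add_subgroup U \<Longrightarrow> U \<subseteq> T \<Longrightarrow> antisymmetric_pairing_mod_Z U \<phi>"
  by (intro antisymmetric_pairing_mod_Z.intro pairing_restrict
    antisymmetric_pairing_mod_Z_axioms.intro
      antisymmetric) auto

lemma
  assumes fin: "index T (annihilator T T \<phi>) > 0"
    and I: "add_subgroup I" "annihilator T T \<phi> \<subseteq> I" "I \<subseteq> annihilator T I \<phi>"
  shows annihilator_isotropic: "annihilator (annihilator T I \<phi>) (annihilator T I \<phi>) \<phi> = I"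
    and index_isotropic: "index T (annihilator T T \<phi>) =
      index (annihilator T I \<phi>) I * (index I (annihilator T T \<phi>))\<^sup>2"
proof -
  let ?S = "annihilator T T \<phi>" and ?J = "annihilator T I \<phi>"
  have IT: "I \<subseteq> T" using I(3) annihilator_subset[of T I \<phi>] by blast
  have S: "add_subgroup ?S" and J: "add_subgroup ?J"
    by (simp_all add: add_subgroup_annihilator IT)
  have "annihilator T ?J \<phi> = I"
    using annihilator_annihilator[OF fin I(1,2) IT] by (simp add: annihilator_flip IT)
  then show "annihilator ?J ?J \<phi> = I"
    using I(3) annihilator_subset[of T I \<phi>] by (auto simp: annihilator_def)
  interpret I: pairing_mod_Z I T \<phi>
    by (rule pairing_restrict[OF I(1) IT add_subgroup_left order_refl])
  have "annihilator I T \<phi> = ?S" using I(2) IT by (auto simp: annihilator_def)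
  moreover have mult: "index T ?S = index T ?J * (index ?J I * index I ?S)"
    using index_mult[OF add_subgroup_left J S _ annihilator_subset] index_mult[OF J I(1) S I(2,3)]
      I(2,3)
    by (metis order_trans)
  then have "index I ?S > 0" using fin by (auto intro: gr0I)
  ultimately have "index T ?J = index I ?S"
    using I.index_annihilator_flip by (simp add: annihilator_flip IT)
  then show "index T ?S = index ?J I * (index I ?S)\<^sup>2" using mult by (simp add: power2_eq_square)
qed

lemma isotropic_plus_zmul:
  assumes "x \<in> T" "\<phi> x x \<in> \<int>"
  defines "I \<equiv> annihilator T T \<phi> + range (\<lambda>k. zmul k x)"
  shows "I \<subseteq> annihilator T I \<phi>"
proof -
  have I_least: "I \<subseteq> K" if "add_subgroup K" "annihilator T T \<phi> \<subseteq> K" "x \<in> K" for K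
    unfolding I_def using that by (intro plus_subset_add_subgroup) (auto intro: add_subgroup_zmul)
  have kernel: "I \<subseteq> {t \<in> T. \<phi> u t \<in> \<int>}" if "u \<in> T" "\<phi> u x \<in> \<int>" for u
  proof (rule I_least)
    show "add_subgroup {t \<in> T. \<phi> u t \<in> \<int>}"
      by (rule add_subgroup_additive_mod_Z_kernel[OF add_subgroup_right additive_right[OF \<open>u \<in> T\<close>]])
    show "annihilator T T \<phi> \<subseteq> {t \<in> T. \<phi> u t \<in> \<int>}"
      using that mem_Ints_swap by (auto simp: annihilator_def)
  qed (use assms that in simp)
  have "\<phi> u x \<in> \<int>" if "u \<in> I" for u
    using kernel[OF assms(1,2)] that assms(1) mem_Ints_swap by blast
  then show ?thesis using kernel kernel[OF assms(1,2)] unfolding annihilator_def by blast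
qed

lemma isotropic_reduction:
  assumes fin: "index T (annihilator T T \<phi>) > 0"
    and x: "x \<in> T" "\<phi> x x \<in> \<int>" "x \<notin> annihilator T T \<phi>"
  obtains J k where "add_subgroup J" "J \<subseteq> T"
    "index T (annihilator T T \<phi>) = index J (annihilator J J \<phi>) * k\<^sup>2"
    "index J (annihilator J J \<phi>) < index T (annihilator T T \<phi>)"
proof -
  let ?S = "annihilator T T \<phi>" and ?Z = "range (\<lambda>k. zmul k x)"
  define I where "I = ?S + ?Z"
  define J where "J = annihilator T I \<phi>"
  have S: "add_subgroup ?S" by (simp add: add_subgroup_annihilator)
  have Z: "add_subgroup ?Z" by (rule add_subgroup_image[OF additive_zmul_left add_subgroup_UNIV])
  have I: "add_subgroup I" "?S \<subseteq> I" "I \<subseteq> J"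
    unfolding J_def I_def
    by (intro add_subgroup_plus S Z subset_plus_left isotropic_plus_zmul x)+
  have "I \<subseteq> T" using I(3) annihilator_subset[of T I \<phi>] unfolding J_def by blast
  then have J: "add_subgroup J" "J \<subseteq> T"
    unfolding J_def by (simp_all add: add_subgroup_annihilator annihilator_subset)
  have J_annihilator: "annihilator J J \<phi> = I" and ix: "index T ?S = index J I * (index I ?S)\<^sup>2"
    using annihilator_isotropic[OF fin I(1,2)] index_isotropic[OF fin I(1,2)] I(3)
    by (simp_all add: J_def)
  have "x \<in> ?Z" using rangeI[of "\<lambda>k. zmul k x" 1] by (simp only: zmul_1)
  then have "x \<in> I" unfolding I_def by (rule subsetD[OF subset_plus_right[OF S]])
  then have "index I ?S \<noteq> 1" using index_eq_1_iff[OF I(1) S I(2)] x(3) by auto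
  moreover have pos: "index I ?S > 0" "index J I > 0" using ix fin by (auto intro: gr0I)
  ultimately have "1 < (index I ?S)\<^sup>2" by (intro one_less_power) auto
  then have "index J I < index T ?S" using ix pos(2) by simp
  then show thesis using that[OF J] ix by (simp add: J_annihilator)
qed

lemma index_le_2_if_anisotropic:
  assumes anisotropic: "\<And>x. x \<in> T \<Longrightarrow> \<phi> x x \<in> \<int> \<Longrightarrow> x \<in> annihilator T T \<phi>"
  shows "index T (annihilator T T \<phi>) \<le> 2"
proof -
  let ?S = "annihilator T T \<phi>"
  have S: "add_subgroup ?S" by (simp add: add_subgroup_annihilator)
  have coset: "x - y \<in> ?S" if xy: "x \<in> T" "y \<in> T" "x \<notin> ?S" "y \<notin> ?S" for x y
  proof (rule anisotropic)
    show T: "x - y \<in> T" by (rule add_subgroup_diff[OF add_subgroup_left xy(1,2)])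
    have "\<phi> x x \<notin> \<int>" "\<phi> y y \<notin> \<int>"
      using anisotropic[OF xy(1)] anisotropic[OF xy(2)] xy(3,4) by auto
    then have "\<phi> x x + \<phi> y y \<in> \<int>"
      by (rule Ints_add_half_integers[OF _ _ antisymmetric[OF xy(1,1)] antisymmetric[OF xy(2,2)]])
    moreover have
      "\<phi> (x - y) (x - y) - (\<phi> x x + \<phi> y y) = (\<phi> (x - y) (x - y) - (\<phi> x (x - y) - \<phi> y (x - y)))
        + (\<phi> x (x - y) - (\<phi> x x - \<phi> x y)) - (\<phi> y (x - y) - (\<phi> y x - \<phi> y y)) - (\<phi> x y + \<phi> y x)"
      by simp
    moreover have "\<dots> \<in> \<int>"
      by (intro Ints_add Ints_diff antisymmetric xy T
          additive_mod_Z_diff[OF add_subgroup_left additive_left]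
          additive_mod_Z_diff[OF add_subgroup_right additive_right])
    ultimately show "\<phi> (x - y) (x - y) \<in> \<int>" using Ints_cong by metis
  qed
  obtain x where x: "x \<in> T" "T = ?S \<or> x \<notin> ?S"
    using add_subgroup_zero[OF add_subgroup_left] annihilator_subset[of T T \<phi>] by blast
  have "coset ?S t \<in> {?S, coset ?S x}" if "t \<in> T" for t
    using coset[OF that x(1)] x(2) that by (auto simp: coset_eq_self_iff[OF S] coset_eq_iff[OF S])
  then have "index T ?S \<le> card {?S, coset ?S x}" unfolding index_altdef by (intro card_mono) auto
  also have "\<dots> \<le> 2" by (simp add: card_insert_if)
  finally show ?thesis .
qed

end

text \<open>Passing from \<open>T / S\<close> to \<open>x\<^sup>\<bottom> / x\<close> for an isotropic \<open>x\<close> divides the order by a square. If no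
  nonzero element is isotropic, then \<open>x \<mapsto> \<phi> x x\<close> is an injection into \<open>(1/2) \<int> / \<int>\<close>.\<close>

theorem square_or_twice_square_index:
  assumes "antisymmetric_pairing_mod_Z T \<phi>" "index T (annihilator T T \<phi>) > 0"
  shows "square_or_twice_square (index T (annihilator T T \<phi>))"
  using assms
proof (induction "index T (annihilator T T \<phi>)" arbitrary: T rule: less_induct)
  case less
  interpret antisymmetric_pairing_mod_Z T \<phi> by (rule less.prems(1))
  let ?S = "annihilator T T \<phi>"
  show ?case
  proof (cases "\<exists>x\<in>T. \<phi> x x \<in> \<int> \<and> x \<notin> ?S")
    case True
    then obtain x where "x \<in> T" "\<phi> x x \<in> \<int>" "x \<notin> ?S" by blast
    then obtain J k where J: "add_subgroup J" "J \<subseteq> T"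
      and ix: "index T ?S = index J (annihilator J J \<phi>) * k\<^sup>2"
      and decrease: "index J (annihilator J J \<phi>) < index T ?S"
      using isotropic_reduction[OF less.prems(2)] by metis
    have "square_or_twice_square (index J (annihilator J J \<phi>))"
      using less.hyps[OF decrease antisymmetric_restrict[OF J]] ix less.prems(2)
      by (auto intro: gr0I)
    then show ?thesis unfolding ix by (rule square_or_twice_square_mult_square)
  next
    case False
    then have "index T ?S \<le> 2" by (intro index_le_2_if_anisotropic) blast
    then have "index T ?S = 1\<^sup>2 \<or> index T ?S = 2 * 1\<^sup>2" using less.prems(2) by auto
    then show ?thesis unfolding square_or_twice_square_def by blast
  qed
qed

lemma (in antisymmetric_pairing_mod_Z) square_or_twice_square_index_torsion:
  assumes fin: "index T (annihilator T T \<phi>) > 0"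
  shows "square_or_twice_square
    (index {t \<in> T. zmul (int e) t \<in> annihilator T T \<phi>} (annihilator T T \<phi>))"
proof -
  let ?S = "annihilator T T \<phi>"
  define Te where "Te = {t \<in> T. zmul (int e) t \<in> ?S}"
  have multiple: "additive_mod_Z T (\<lambda>t. of_nat e * f t)" if f: "additive_mod_Z T f" for f
    unfolding additive_mod_Z_def
  proof (intro ballI)
    fix x y assume "x \<in> T" "y \<in> T"
    then have "of_nat e * (f (x + y) - (f x + f y)) \<in> \<int>"
      by (intro Ints_mult additive_mod_Z_add[OF f]) auto
    then show "of_nat e * f (x + y) - (of_nat e * f x + of_nat e * f y) \<in> \<int>"
      by (simp add: algebra_simps)
  qed
  interpret multiple: antisymmetric_pairing_mod_Z T "\<lambda>x y. of_nat e * \<phi> x y"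
  proof unfold_locales
    show "of_nat e * \<phi> x y + of_nat e * \<phi> y x \<in> \<int>" if "x \<in> T" "y \<in> T" for x y
      using Ints_mult[OF _ antisymmetric[OF that], of "of_nat e"] by (simp add: algebra_simps)
  qed (simp_all add: add_subgroup_left multiple additive_left additive_right)
  have S: "add_subgroup ?S" by (simp add: add_subgroup_annihilator)
  have annihilator: "annihilator T T (\<lambda>x y. of_nat e * \<phi> x y) = Te"
    unfolding Te_def annihilator_def[of T T "\<lambda>x y. of_nat e * \<phi> x y"]
    using zmul_mem_annihilator_iff[of _ "int e"] by auto
  then have Te: "add_subgroup Te" using multiple.add_subgroup_annihilator[OF order_refl] by simp
  have "?S \<subseteq> Te" "Te \<subseteq> T"
    using add_subgroup_zmul[OF S] annihilator_subset[of T T \<phi>] by (auto simp: Te_def)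
  then have ix: "index T ?S = index T Te * index Te ?S" by (intro index_mult add_subgroup_left Te S)
  then have pos: "index T Te > 0" using fin by (auto intro: gr0I)
  have "square_or_twice_square (index T Te)"
    using square_or_twice_square_index[OF multiple.antisymmetric_pairing_mod_Z_axioms] pos
    unfolding annihilator by blast
  moreover have "square_or_twice_square (index T Te * index Te ?S)"
    using square_or_twice_square_index[OF antisymmetric_pairing_mod_Z_axioms fin] unfolding ix .
  ultimately show ?thesis
    unfolding Te_def[symmetric] using pos by (rule square_or_twice_square_cancel)
qed

section \<open>Pairings of quotient groups\<close>

lemma card_image_eq_if_same_fibres:
  assumes "\<And>x y. x \<in> D \<Longrightarrow> y \<in> D \<Longrightarrow> f x = f y \<longleftrightarrow> g x = g y" shows "card (f ` D) = card (g ` D)"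
proof -
  let ?k = "\<lambda>Y. f (inv_into D g Y)"
  have k: "?k (g x) = f x" if "x \<in> D" for x
    using that assms[of "inv_into D g (g x)" x] by (simp add: inv_into_into f_inv_into_f)
  have "f ` D = ?k ` g ` D" by (simp add: image_image k)
  moreover have "inj_on ?k (g ` D)" using assms by (auto simp: inj_on_def k)
  ultimately show ?thesis by (simp add: card_image)
qed

lemma (in group) hom_add_group_eq_iff:
  assumes "add_subgroup A" "h \<in> hom (add_group A) G" "x \<in> A" "y \<in> A"
  shows "h x = h y \<longleftrightarrow> h (x - y) = \<one>"
proof -
  have "x - y \<in> A" by (rule add_subgroup_diff[OF assms(1,3,4)])
  then have "h x = h (x - y) \<otimes> h y" "h (x - y) \<in> carrier G" "h y \<in> carrier G"
    using hom_mult[OF assms(2), of "x - y" y] hom_in_carrier[OF assms(2)] assms(4) by auto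
  then show ?thesis by (simp add: r_cancel_one)
qed

locale quotient_presentation = group G
  for G :: "('g, 'm) monoid_scheme" (structure) +
  fixes A S :: "'a::ab_group_add set" and h :: "'a \<Rightarrow> 'g"
  assumes add_subgroup_domain: "add_subgroup A" and add_subgroup_kernel: "add_subgroup S"
    and kernel_subset: "S \<subseteq> A" and epi: "h \<in> epi (add_group A) G"
    and kernel_iff: "a \<in> A \<Longrightarrow> h a = \<one> \<longleftrightarrow> a \<in> S"
begin

lemma hom_presentation: "h \<in> hom (add_group A) G" and image_presentation: "h ` A = carrier G"
  using epi by (auto simp: epi_def)

lemma presentation_eq_iff: "x \<in> A \<Longrightarrow> y \<in> A \<Longrightarrow> h x = h y \<longleftrightarrow> x - y \<in> S"
  using hom_add_group_eq_iff[OF add_subgroup_domain hom_presentation] kernel_iff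
    add_subgroup_diff[OF add_subgroup_domain] by simp

lemma presentation_add: "x \<in> A \<Longrightarrow> y \<in> A \<Longrightarrow> h (x + y) = h x \<otimes> h y"
  using hom_mult[OF hom_presentation, of x y] by simp

lemma card_image_presentation: "D \<subseteq> A \<Longrightarrow> card (h ` D) = index D S"
  unfolding index_altdef
  by (rule card_image_eq_if_same_fibres)
    (simp only: coset_eq_iff[OF add_subgroup_kernel] presentation_eq_iff[OF subsetD subsetD])

lemma card_carrier_presentation: "card (carrier G) = index A S"
  using card_image_presentation[OF order_refl] by (simp add: image_presentation)

lemma card_torsion_presentation: "card (torsion G e) = index {a \<in> A. zmul (int e) a \<in> S} S"
proof -
  have pow: "h a [^] e = \<one> \<longleftrightarrow> zmul (int e) a \<in> S" if "a \<in> A" for a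
    using hom_zmul[OF add_subgroup_domain is_group hom_presentation that] that
    by (metis kernel_iff add_subgroup_zmul[OF add_subgroup_domain])
  then have "torsion G e = h ` {a \<in> A. zmul (int e) a \<in> S}"
    unfolding torsion_def image_presentation[symmetric] by blast
  then show ?thesis using card_image_presentation[of "{a \<in> A. zmul (int e) a \<in> S}"] by simp
qed

end

lemma comm_group_rat_mod_int: "comm_group rat_mod_int"
  unfolding rat_mod_int_def by (rule comm_group_Mod[OF add_subgroup_UNIV add_subgroup_Ints]) simp

lemma mult_rat_mod_int: "coset \<int> x \<otimes>\<^bsub>rat_mod_int\<^esub> coset \<int> y = coset \<int> (x + y)"
  unfolding rat_mod_int_def by (rule mult_Mod[OF add_subgroup_UNIV add_subgroup_Ints]) auto

lemma carrier_rat_mod_int: "carrier rat_mod_int = range (coset \<int>)"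
  unfolding rat_mod_int_def carrier_Mod ..

lemma inv_rat_mod_int: "inv\<^bsub>rat_mod_int\<^esub> (coset \<int> x) = coset \<int> (- x)"
proof -
  interpret comm_group rat_mod_int by (rule comm_group_rat_mod_int)
  have "\<one>\<^bsub>rat_mod_int\<^esub> = coset \<int> 0" by (simp add: rat_mod_int_def coset_altdef)
  then show ?thesis by (intro inv_equality) (auto simp: mult_rat_mod_int carrier_rat_mod_int)
qed

lemmas coset_Ints_eq_iff = coset_eq_iff[OF add_subgroup_Ints]

definition induced_pairing :: "'a set \<Rightarrow> ('a \<Rightarrow> 'g) \<Rightarrow> ('a \<Rightarrow> 'a \<Rightarrow> rat) \<Rightarrow> 'g \<Rightarrow> 'g \<Rightarrow> rat set" where
  "induced_pairing A h \<phi> X Y = coset \<int> (\<phi> (inv_into A h X) (inv_into A h Y))"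

locale paired_presentation = quotient_presentation G A S h + pairing_mod_Z A A \<phi>
  for G :: "('g, 'm) monoid_scheme" (structure) and A S :: "'a::ab_group_add set" and h \<phi> +
  assumes annihilator_left: "annihilator A A \<phi> = S"
    and annihilator_right: "annihilator A A (flip \<phi>) = S"
    and finite_index: "index A S > 0"
begin

lemma presentation_flip: "paired_presentation G A S h (flip \<phi>)"
  by (intro paired_presentation.intro paired_presentation_axioms.intro quotient_presentation_axioms
      pairing_flip annihilator_left annihilator_right finite_index)

lemma induced_pairing_eq:
  assumes xy: "x \<in> A" "y \<in> A" shows "induced_pairing A h \<phi> (h x) (h y) = coset \<int> (\<phi> x y)"
proof -
  have rep: "inv_into A h (h a) \<in> A" "a - inv_into A h (h a) \<in> S" if "a \<in> A" for a
    using that inv_into_into[of "h a" h A] f_inv_into_f[of "h a" h A]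
    by (auto simp: presentation_eq_iff[symmetric])
  let ?x = "inv_into A h (h x)" and ?y = "inv_into A h (h y)"
  have left: "\<phi> (x - ?x) y \<in> \<int>"
    using rep(2)[OF xy(1)] xy(2) unfolding annihilator_left[symmetric]
    by (simp add: annihilator_def)
  have right: "\<phi> ?x (y - ?y) \<in> \<int>"
    using rep(2)[OF xy(2)] rep(1)[OF xy(1)] unfolding annihilator_right[symmetric]
    by (simp add: annihilator_def)
  have "\<phi> ?x ?y - \<phi> x y = (\<phi> (x - ?x) y - (\<phi> x y - \<phi> ?x y)) - \<phi> (x - ?x) y
      + (\<phi> ?x (y - ?y) - (\<phi> ?x y - \<phi> ?x ?y)) - \<phi> ?x (y - ?y)" by simp
  also have "\<dots> \<in> \<int>"
    by (intro Ints_add Ints_diff left right rep xy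
      additive_mod_Z_diff[OF add_subgroup_left additive_left]
        additive_mod_Z_diff[OF add_subgroup_right additive_right])
  finally show ?thesis by (simp add: induced_pairing_def coset_Ints_eq_iff)
qed

lemma induced_pairing_hom:
  assumes "X \<in> carrier G" shows "induced_pairing A h \<phi> X \<in> hom G rat_mod_int"
proof (rule homI)
  show "induced_pairing A h \<phi> X Y \<in> carrier rat_mod_int" for Y
    by (simp add: induced_pairing_def carrier_rat_mod_int)
  fix Y Z assume "Y \<in> carrier G" "Z \<in> carrier G"
  then obtain x y z where x: "x \<in> A" "X = h x" and y: "y \<in> A" "Y = h y" and z: "z \<in> A" "Z = h z"
    using assms unfolding image_presentation[symmetric] by blast
  have yz: "y + z \<in> A" by (rule add_subgroup_add[OF add_subgroup_domain y(1) z(1)])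
  have "induced_pairing A h \<phi> X (Y \<otimes> Z) = coset \<int> (\<phi> x (y + z))"
    unfolding x(2) y(2) z(2) presentation_add[OF y(1) z(1), symmetric]
    by (rule induced_pairing_eq[OF x(1) yz])
  also have "\<dots> = coset \<int> (\<phi> x y + \<phi> x z)"
    unfolding coset_Ints_eq_iff by (rule additive_mod_Z_add[OF additive_right[OF x(1)] y(1) z(1)])
  finally show "induced_pairing A h \<phi> X (Y \<otimes> Z) =
      induced_pairing A h \<phi> X Y \<otimes>\<^bsub>rat_mod_int\<^esub> induced_pairing A h \<phi> X Z"
    using x y z by (simp only: induced_pairing_eq mult_rat_mod_int)
qed

lemma ex_lift_character:
  assumes c: "c \<in> hom G rat_mod_int"
  shows "\<exists>x\<in>A. \<forall>t\<in>A. c (h t) = coset \<int> (\<phi> x t)"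
proof -
  have carrier: "h t \<in> carrier G" if "t \<in> A" for t using that image_presentation by blast
  have "\<exists>q. c (h t) = coset \<int> q" if "t \<in> A" for t
    using hom_in_carrier[OF c carrier[OF that]] by (auto simp: carrier_rat_mod_int)
  then obtain f where f: "\<And>t. t \<in> A \<Longrightarrow> c (h t) = coset \<int> (f t)" by metis
  have "additive_mod_Z A f"
    unfolding additive_mod_Z_def
  proof (intro ballI)
    fix t u assume tu: "t \<in> A" "u \<in> A"
    then have "c (h (t + u)) = c (h t) \<otimes>\<^bsub>rat_mod_int\<^esub> c (h u)"
      by (simp only: presentation_add hom_mult[OF c carrier carrier])
    then show "f (t + u) - (f t + f u) \<in> \<int>"
      using tu
      by (simp only: f add_subgroup_add[OF add_subgroup_domain] mult_rat_mod_int
          coset_Ints_eq_iff)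
  qed
  moreover have "f s \<in> \<int>" if "s \<in> annihilator A A (flip \<phi>)" for s
  proof -
    have s: "s \<in> A" "h s = \<one>" using that kernel_subset by (auto simp: annihilator_right kernel_iff)
    interpret rat_mod_int: comm_group rat_mod_int by (rule comm_group_rat_mod_int)
    have "coset \<int> (f s) = \<int>"
      using f[OF s(1)] hom_one[OF c is_group rat_mod_int.is_group] s(2)
      by (simp add: rat_mod_int_def)
    then show ?thesis by (simp add: coset_eq_self_iff[OF add_subgroup_Ints])
  qed
  ultimately obtain x where "x \<in> A" "\<forall>t\<in>A. f t - \<phi> x t \<in> \<int>"
    using ex_represented_character finite_index annihilator_left by blast
  then show ?thesis using f by (auto simp: coset_Ints_eq_iff)
qed

lemma induced_pairing_bij:
  "bij_betw (\<lambda>X. restrict (induced_pairing A h \<phi> X) (carrier G)) (carrier G)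
     (hom G rat_mod_int \<inter> extensional (carrier G))"
proof (rule bij_betwI')
  fix X Y assume "X \<in> carrier G" "Y \<in> carrier G"
  then obtain x y where x: "x \<in> A" "X = h x" and y: "y \<in> A" "Y = h y"
    unfolding image_presentation[symmetric] by blast
  show "restrict (induced_pairing A h \<phi> X) (carrier G)
    = restrict (induced_pairing A h \<phi> Y) (carrier G)
    \<longleftrightarrow> X = Y"
  proof
    assume eq: "restrict (induced_pairing A h \<phi> X) (carrier G)
      = restrict (induced_pairing A h \<phi> Y) (carrier G)"
    have "\<phi> (x - y) t \<in> \<int>" if t: "t \<in> A" for t
    proof -
      have "h t \<in> carrier G" using t image_presentation by blast
      then have "induced_pairing A h \<phi> X (h t) = induced_pairing A h \<phi> Y (h t)"
        using fun_cong[OF eq, of "h t"] by simp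
      then have "\<phi> x t - \<phi> y t \<in> \<int>" using x y t by (simp only: induced_pairing_eq coset_Ints_eq_iff)
      then show ?thesis
        using Ints_cong[OF additive_mod_Z_diff[OF add_subgroup_left additive_left[OF t] x(1) y(1)]]
        by blast
    qed
    then have "x - y \<in> S"
      unfolding annihilator_left[symmetric] using add_subgroup_diff[OF add_subgroup_left x(1) y(1)]
      by (simp add: annihilator_def)
    then show "X = Y" using x y by (simp only: presentation_eq_iff)
  qed simp
next
  fix X assume X: "X \<in> carrier G"
  show "restrict (induced_pairing A h \<phi> X) (carrier G)
    \<in> hom G rat_mod_int \<inter> extensional (carrier G)"
    using hom_restrict[OF induced_pairing_hom[OF X],
      of "restrict (induced_pairing A h \<phi> X) (carrier G)"] by simp
next
  fix c assume c: "c \<in> hom G rat_mod_int \<inter> extensional (carrier G)"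
  then obtain x where x: "x \<in> A" "\<forall>t\<in>A. c (h t) = coset \<int> (\<phi> x t)" using ex_lift_character by blast
  have "c Y = induced_pairing A h \<phi> (h x) Y" if "Y \<in> carrier G" for Y
    using that x induced_pairing_eq[OF x(1)] unfolding image_presentation[symmetric] by auto
  then have "c = restrict (induced_pairing A h \<phi> (h x)) (carrier G)"
    using c by (intro extensionalityI[of _ "carrier G"]) auto
  moreover have "h x \<in> carrier G" using x(1) image_presentation by blast
  ultimately show "\<exists>X\<in>carrier G. c = restrict (induced_pairing A h \<phi> X) (carrier G)" by blast
qed

theorem perfect_induced_pairing: "perfect_pairing G (induced_pairing A h \<phi>)"
proof -
  interpret flip: paired_presentation G A S h "flip \<phi>" by (rule presentation_flip)
  have "induced_pairing A h (flip \<phi>) = flip (induced_pairing A h \<phi>)"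
    by (simp add: fun_eq_iff induced_pairing_def)
  then show ?thesis
    using induced_pairing_hom flip.induced_pairing_hom induced_pairing_bij flip.induced_pairing_bij
    by (simp add: perfect_pairing_def)
qed

lemma antisymmetric_induced_pairing:
  assumes "\<And>x y. x \<in> A \<Longrightarrow> y \<in> A \<Longrightarrow> \<phi> x y + \<phi> y x \<in> \<int>"
  shows "antisymmetric_pairing G (induced_pairing A h \<phi>)"
  unfolding antisymmetric_pairing_def
proof (intro ballI)
  fix X Y assume "X \<in> carrier G" "Y \<in> carrier G"
  then obtain x y where xy: "x \<in> A" "X = h x" "y \<in> A" "Y = h y"
    unfolding image_presentation[symmetric] by blast
  then show "induced_pairing A h \<phi> X Y = inv\<^bsub>rat_mod_int\<^esub> (induced_pairing A h \<phi> Y X)"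
    using assms by (simp add: induced_pairing_eq inv_rat_mod_int coset_Ints_eq_iff)
qed

end

section \<open>Lattices and determinants\<close>

lemma additive_linear: "Vector_Spaces.linear s1 s2 f \<Longrightarrow> additive f"
  by (simp add: additive_def Vector_Spaces.linear_iff)

lemma finite_common_denominator:
  fixes S :: "rat set"
  assumes "finite S" shows "\<exists>k :: nat. k > 0 \<and> (\<forall>q\<in>S. of_nat k * q \<in> \<int>)"
proof (intro exI conjI ballI)
  define D where "D q = nat (snd (quotient_of q))" for q
  have D: "D q > 0" "of_nat (D q) * q \<in> \<int>" for q
  proof -
    obtain m n where mn: "quotient_of q = (m, n)" by fastforce
    then have n: "n > 0" and q: "q = of_int m / of_int n"
      using quotient_of_denom_pos quotient_of_div by auto
    have Dq: "D q = nat n" by (simp add: D_def mn)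
    then show "D q > 0" using n by simp
    have "of_int n * q = of_int m" using n q by simp
    then show "of_nat (D q) * q \<in> \<int>" using n by (simp add: Dq)
  qed
  show "prod D S > 0" using D(1) by (simp add: prod_pos)
  fix q assume "q \<in> S"
  then have "of_nat (prod D S) * q = of_nat (prod D (S - {q})) * (of_nat (D q) * q)"
    by (simp add: prod.remove[OF assms] mult_ac)
  then show "of_nat (prod D S) * q \<in> \<int>" using D(2)[of q] by (metis Ints_mult Ints_of_nat)
qed

locale rat_lattice = vector_space scale
  for scale :: "rat \<Rightarrow> 'v::ab_group_add \<Rightarrow> 'v" (infixr \<open>*s\<close> 75) +
  fixes d :: nat and b :: "nat \<Rightarrow> 'v" and L :: "'v set"
  assumes lattice: "lattice_basis scale d b L"
begin

lemma basis: "inj_on b {..<d}" "independent (b ` {..<d})" "span (b ` {..<d}) = UNIV"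
  and L_def: "L = range (\<lambda>c :: nat \<Rightarrow> int. \<Sum>i<d. of_int (c i) *s b i)"
  using lattice by (auto simp: lattice_basis_def)

sublocale finite_dimensional_vector_space scale "b ` {..<d}"
  by unfold_locales (use basis in auto)

sublocale endo: finite_dimensional_vector_space_pair scale "b ` {..<d}" scale "b ` {..<d}" ..

abbreviation lin :: "('v \<Rightarrow> 'v) \<Rightarrow> bool" where
  "lin \<equiv> Vector_Spaces.linear scale scale"

lemma lin_iff: "lin G \<longleftrightarrow> (\<forall>u v. G (u + v) = G u + G v) \<and> (\<forall>q v. G (q *s v) = q *s G v)"
  unfolding Vector_Spaces.linear_iff using vector_space_axioms by blast

lemma zmul_scale: "zmul k v = of_int k *s v"
  by (induction k rule: int_induct[where k = 0])
    (auto simp: zmul_add_left zmul_diff_left scale_left_distrib scale_left_diff_distrib)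

lemma scale_int_mem: "add_subgroup M \<Longrightarrow> v \<in> M \<Longrightarrow> of_int k *s v \<in> M"
  using add_subgroup_zmul[of M v k] by (simp add: zmul_scale)

lemma scale_nat_mem: "add_subgroup M \<Longrightarrow> v \<in> M \<Longrightarrow> of_nat k *s v \<in> M"
  using scale_int_mem[of M v "int k"] by simp

lemma additive_scale: "additive ((*s) q)"
  by (simp add: additive_def scale_right_distrib)

lemma lin_scale: "lin ((*s) q)"
  by (simp add: lin_iff scale_right_distrib mult.commute)

lemma inj_scale: "q \<noteq> 0 \<Longrightarrow> inj ((*s) q)"
  by (auto intro!: injI)

subsection \<open>Coordinates\<close>

definition coord :: "nat \<Rightarrow> 'v \<Rightarrow> rat" where
  "coord i v = representation (b ` {..<d}) v (b i)"

lemma coord_add: "coord i (u + v) = coord i u + coord i v"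
  and coord_diff: "coord i (u - v) = coord i u - coord i v"
  and coord_scale: "coord i (q *s v) = q * coord i v"
  and coord_sum: "coord i (sum f I) = (\<Sum>j\<in>I. coord i (f j))"
  using basis
  by (simp_all add: coord_def representation_add representation_diff representation_scale
      representation_sum)

lemma additive_coord: "additive (coord i)"
  by (simp add: additive_def coord_add)

lemma coord_basis: "i < d \<Longrightarrow> j < d \<Longrightarrow> coord i (b j) = (if i = j then 1 else 0)"
  using basis by (auto simp: coord_def representation_basis inj_on_eq_iff)

lemma coord_combination:
  assumes "i < d" shows "coord i (\<Sum>j<d. c j *s b j) = c i"
proof -
  have "coord i (\<Sum>j<d. c j *s b j) = (\<Sum>j<d. if i = j then c j else 0)"
    unfolding coord_sum coord_scale by (rule sum.cong) (use assms in \<open>auto simp: coord_basis\<close>)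
  then show ?thesis using assms by simp
qed

lemma expansion: "v = (\<Sum>i<d. coord i v *s b i)"
proof -
  have "(\<Sum>x\<in>b ` {..<d}. representation (b ` {..<d}) v x *s x) = v"
    by (rule sum_representation_eq) (use basis in auto)
  then show ?thesis by (simp add: sum.reindex[OF basis(1)] coord_def)
qed

lemma lin_expansion: "lin G \<Longrightarrow> G v = (\<Sum>j<d. coord j v *s G (b j))"
  by (subst expansion[of v]) (simp only: endo.linear_sum endo.linear_scale)

lemma mem_L_iff: "v \<in> L \<longleftrightarrow> (\<forall>i<d. coord i v \<in> \<int>)"
proof
  assume "v \<in> L"
  then show "\<forall>i<d. coord i v \<in> \<int>" by (auto simp: L_def coord_combination)
next
  assume "\<forall>i<d. coord i v \<in> \<int>"
  then have "\<forall>i\<in>{..<d}. \<exists>k. coord i v = of_int k" by (auto elim: Ints_cases)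
  then obtain c where c: "\<forall>i\<in>{..<d}. coord i v = of_int (c i)" by metis
  have "v = (\<Sum>i<d. of_int (c i) *s b i)" by (subst expansion[of v]) (use c in auto)
  then show "v \<in> L" by (auto simp: L_def)
qed

subsection \<open>Integral spans\<close>

definition zspan :: "nat \<Rightarrow> (nat \<Rightarrow> 'v) \<Rightarrow> 'v set" where
  "zspan n a = range (\<lambda>c :: nat \<Rightarrow> int. \<Sum>i<n. of_int (c i) *s a i)"

lemma L_zspan: "L = zspan d b"
  by (simp add: L_def zspan_def)

lemma add_subgroup_zspan: "add_subgroup (zspan n a)"
  unfolding zspan_def
  by (rule add_subgroup_image[OF _ add_subgroup_UNIV])
    (simp add: additive_def scale_left_distrib sum.distrib)

lemma add_subgroup_L: "add_subgroup L"
  by (simp add: L_zspan add_subgroup_zspan)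

lemma zspan_Suc: "zspan (Suc n) a = zspan n a + range (\<lambda>k. of_int k *s a n)"
proof
  show "zspan (Suc n) a \<subseteq> zspan n a + range (\<lambda>k. of_int k *s a n)"
    unfolding zspan_def by (auto intro!: set_plus_intro)
  show "zspan n a + range (\<lambda>k. of_int k *s a n) \<subseteq> zspan (Suc n) a"
  proof
    fix x assume "x \<in> zspan n a + range (\<lambda>k. of_int k *s a n)"
    then obtain c :: "nat \<Rightarrow> int" and k where "x = (\<Sum>i<n. of_int (c i) *s a i) + of_int k *s a n"
      by (auto simp: zspan_def elim!: set_plus_elim)
    then have "x = (\<Sum>i<Suc n. of_int ((c(n := k)) i) *s a i)" by simp
    then show "x \<in> zspan (Suc n) a" unfolding zspan_def by (rule range_eqI[of _ _ "c(n := k)"])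
  qed
qed

lemma zspan_subset_iff:
  assumes "add_subgroup M" shows "zspan n a \<subseteq> M \<longleftrightarrow> a ` {..<n} \<subseteq> M"
proof (induction n)
  case 0
  then show ?case using add_subgroup_zero[OF assms] by (simp add: zspan_def)
next
  case (Suc n)
  have "zspan (Suc n) a \<subseteq> M \<longleftrightarrow> zspan n a \<subseteq> M \<and> range (\<lambda>k. of_int k *s a n) \<subseteq> M"
    unfolding zspan_Suc
  proof
    assume "zspan n a + range (\<lambda>k. of_int k *s a n) \<subseteq> M"
    moreover have "add_subgroup (range (\<lambda>k. of_int k *s a n))"
      using add_subgroup_image[OF additive_zmul_left add_subgroup_UNIV, of "a n"]
      by (simp add: zmul_scale)
    ultimately show "zspan n a \<subseteq> M \<and> range (\<lambda>k. of_int k *s a n) \<subseteq> M"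
      using subset_plus_left subset_plus_right add_subgroup_zspan by (meson order_trans)
  qed (use plus_subset_add_subgroup[OF assms] in blast)
  moreover have "range (\<lambda>k. of_int k *s a n) \<subseteq> M \<longleftrightarrow> a n \<in> M"
  proof
    assume "range (\<lambda>k. of_int k *s a n) \<subseteq> M"
    then have "of_int 1 *s a n \<in> M" by blast
    then show "a n \<in> M" by simp
  qed (use scale_int_mem[OF assms] in blast)
  ultimately show ?case using Suc by (auto simp: lessThan_Suc)
qed

lemma zspan_base: "i < n \<Longrightarrow> a i \<in> zspan n a"
  using zspan_subset_iff[OF add_subgroup_zspan, of n a n a] by auto

lemma zspan_eqI: "a ` {..<n} \<subseteq> zspan n c \<Longrightarrow> c ` {..<n} \<subseteq> zspan n a \<Longrightarrow> zspan n a = zspan n c"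
  by (simp add: zspan_subset_iff add_subgroup_zspan subset_antisym)

lemma image_zspan: "lin G \<Longrightarrow> G ` zspan n a = zspan n (\<lambda>i. G (a i))"
  by (simp add: zspan_def image_image endo.linear_sum endo.linear_scale)

lemma coord_image_zspan_Suc:
  assumes "\<And>i. i < m \<Longrightarrow> coord m (a i) = 0"
  shows "coord m ` zspan (Suc m) a = range (\<lambda>k. of_int k * coord m (a m))"
    and "coord m (a m) \<noteq> 0 \<Longrightarrow> {v \<in> zspan (Suc m) a. coord m v = 0} = zspan m a"
proof -
  have zero: "coord m v = 0" if "v \<in> zspan m a" for v
    using that assms by (auto simp: zspan_def coord_sum coord_scale)
  have mem: "v \<in> zspan (Suc m) a \<longleftrightarrow> (\<exists>u k. u \<in> zspan m a \<and> v = u + of_int k *s a m)" for v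
    by (auto simp: zspan_Suc elim!: set_plus_elim)
  have coord: "coord m (u + of_int k *s a m) = of_int k * coord m (a m)" if "u \<in> zspan m a" for u k
    using zero[OF that] by (simp add: coord_add coord_scale)
  have "coord m ` zspan m a = {0}"
    using zero add_subgroup_zero[OF add_subgroup_zspan] by (auto intro!: image_eqI[of 0 _ 0])
  moreover have
    "coord m ` zspan (Suc m) a = coord m ` zspan m a + coord m ` range (\<lambda>k. of_int k *s a m)"
    unfolding zspan_Suc by (rule image_plus[OF additive_coord])
  ultimately show "coord m ` zspan (Suc m) a = range (\<lambda>k. of_int k * coord m (a m))"
    by (simp add: image_image coord_scale set_plus_def)
  show "{v \<in> zspan (Suc m) a. coord m v = 0} = zspan m a" if "coord m (a m) \<noteq> 0"
  proof (intro equalityI subsetI)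
    fix v assume "v \<in> zspan m a"
    then have "v = v + of_int 0 *s a m" "v \<in> zspan m a" by simp_all
    then have "v \<in> zspan (Suc m) a" unfolding mem by blast
    then show "v \<in> {v \<in> zspan (Suc m) a. coord m v = 0}" using zero[OF \<open>v \<in> zspan m a\<close>] by simp
  qed (use that coord in \<open>auto simp: mem\<close>)
qed

subsection \<open>The index of a lattice spanned by the columns of a matrix\<close>

definition column :: "nat \<Rightarrow> int mat \<Rightarrow> nat \<Rightarrow> 'v" where
  "column n A j = (\<Sum>i<n. of_int (A $$ (i, j)) *s b i)"

lemma coord_column:
  assumes "m < d" shows "coord m (column (Suc m) A j) = of_int (A $$ (m, j))"
proof -
  have "coord m (column (Suc m) A j) = (\<Sum>i<Suc m. of_int (A $$ (i, j)) * (if m = i then 1 else 0))"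
    unfolding column_def coord_sum coord_scale using assms
    by (intro sum.cong) (auto simp: coord_basis)
  then show ?thesis by simp
qed

definition column_equivalent :: "nat \<Rightarrow> int mat \<Rightarrow> int mat \<Rightarrow> bool" where
  "column_equivalent n A B \<longleftrightarrow> A \<in> carrier_mat n n \<and> B \<in> carrier_mat n n \<and>
     \<bar>det A\<bar> = \<bar>det B\<bar> \<and> zspan n (column n A) = zspan n (column n B)"

lemma column_equivalent_trans:
  "column_equivalent n A B \<Longrightarrow> column_equivalent n B C \<Longrightarrow> column_equivalent n A C"
  by (simp add: column_equivalent_def)

lemma column_equivalent_addcol:
  assumes A: "A \<in> carrier_mat n n" and jk: "j < n" "k < n" "j \<noteq> k"
  shows "column_equivalent n A (addcol s k j A)"
proof -
  let ?B = "addcol s k j A"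
  have col: "column n ?B i
    = (if i = k then column n A k + of_int s *s column n A j else column n A i)"
    if "i < n" for i
    using A jk that by (auto simp: column_def scale_sum_right sum.distrib[symmetric]
        scale_left_distrib algebra_simps intro!: sum.cong)
  have "column n ?B ` {..<n} \<subseteq> zspan n (column n A)"
    using jk(1)
    by (auto simp: col intro!: zspan_base scale_int_mem add_subgroup_add add_subgroup_zspan)
  moreover have "column n A ` {..<n} \<subseteq> zspan n (column n ?B)"
  proof (rule image_subsetI)
    fix i assume i: "i \<in> {..<n}"
    have "column n A k = column n ?B k - of_int s *s column n ?B j" using jk by (simp add: col)
    moreover have "\<dots> \<in> zspan n (column n ?B)"
      using jk by (intro add_subgroup_diff scale_int_mem zspan_base add_subgroup_zspan)
    ultimately show "column n A i \<in> zspan n (column n ?B)"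
      using i col[of i] zspan_base[of i n "column n ?B"] by (cases "i = k") auto
  qed
  moreover have "det ?B = det A" by (rule det_addcol[OF jk(1) jk(3)[symmetric] A])
  ultimately show ?thesis
    using A by (auto simp: column_equivalent_def mat_addcol_def intro!: zspan_eqI)
qed

lemma column_equivalent_swapcols:
  assumes A: "A \<in> carrier_mat n n" and jk: "j < n" "k < n" "j \<noteq> k"
  shows "column_equivalent n A (swapcols j k A)"
proof -
  let ?B = "swapcols j k A" and ?\<pi> = "\<lambda>i. if i = j then k else if i = k then j else i"
  have B: "column n ?B i = column n A (?\<pi> i)" if "i < n" for i
    using A jk that by (auto simp: column_def intro!: sum.cong)
  have A': "column n A i = column n ?B (?\<pi> i)" if "i < n" for i
    using B[of "?\<pi> i"] jk that by auto
  have \<pi>: "?\<pi> i < n" if "i < n" for i using jk that by simp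
  have "zspan n (column n A) = zspan n (column n ?B)"
  proof (intro zspan_eqI image_subsetI)
    fix i assume "i \<in> {..<n}"
    then have i: "i < n" by simp
    show "column n A i \<in> zspan n (column n ?B)" unfolding A'[OF i] by (rule zspan_base[OF \<pi>[OF i]])
    show "column n ?B i \<in> zspan n (column n A)" unfolding B[OF i] by (rule zspan_base[OF \<pi>[OF i]])
  qed
  then show ?thesis using A det_swapcols[OF jk A] by (simp add: column_equivalent_def)
qed

lemma ex_column_equivalent_smaller_last_row:
  assumes A: "A \<in> carrier_mat (Suc m) (Suc m)" and jk: "j < Suc m" "k < Suc m" "j \<noteq> k"
    and nonzero: "A $$ (m, j) \<noteq> 0" and le: "\<bar>A $$ (m, j)\<bar> \<le> \<bar>A $$ (m, k)\<bar>"
  shows "\<exists>B. column_equivalent (Suc m) A B \<and>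
    (\<Sum>i<Suc m. nat \<bar>B $$ (m, i)\<bar>) < (\<Sum>i<Suc m. nat \<bar>A $$ (m, i)\<bar>)"
proof -
  define s :: int where "s = (if sgn (A $$ (m, j)) = sgn (A $$ (m, k)) then -1 else 1)"
  let ?B = "addcol s k j A"
  have less: "\<bar>A $$ (m, k) + s * A $$ (m, j)\<bar> < \<bar>A $$ (m, k)\<bar>"
    using nonzero le by (auto simp: s_def sgn_if split: if_splits)
  have "(\<Sum>i<Suc m. nat \<bar>?B $$ (m, i)\<bar>) < (\<Sum>i<Suc m. nat \<bar>A $$ (m, i)\<bar>)"
  proof (rule sum_strict_mono_ex1)
    show "\<forall>i\<in>{..<Suc m}. nat \<bar>?B $$ (m, i)\<bar> \<le> nat \<bar>A $$ (m, i)\<bar>"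
      using A jk(1,2) less by (auto simp: add.commute)
    show "\<exists>i\<in>{..<Suc m}. nat \<bar>?B $$ (m, i)\<bar> < nat \<bar>A $$ (m, i)\<bar>"
      using A jk(1,2) less by (intro bexI[of _ k]) (auto simp: add.commute)
  qed simp
  then show ?thesis using column_equivalent_addcol[OF A jk] by blast
qed

lemma ex_column_equivalent_block:
  assumes "A \<in> carrier_mat (Suc m) (Suc m)"
  shows "\<exists>B. column_equivalent (Suc m) A B \<and> (\<forall>j<m. B $$ (m, j) = 0)"
  using assms
proof (induction "\<Sum>i<Suc m. nat \<bar>A $$ (m, i)\<bar>" arbitrary: A rule: less_induct)
  case less
  note A = less.prems
  show ?case
  proof (cases "\<exists>j<Suc m. \<exists>k<Suc m. j \<noteq> k \<and> A $$ (m, j) \<noteq> 0 \<and> A $$ (m, k) \<noteq> 0")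
    case True
    then obtain j k where "j < Suc m" "k < Suc m" "j \<noteq> k" "A $$ (m, j) \<noteq> 0"
      "\<bar>A $$ (m, j)\<bar> \<le> \<bar>A $$ (m, k)\<bar>" by (metis linear)
    then obtain B where AB: "column_equivalent (Suc m) A B"
      and "(\<Sum>i<Suc m. nat \<bar>B $$ (m, i)\<bar>) < (\<Sum>i<Suc m. nat \<bar>A $$ (m, i)\<bar>)"
      using ex_column_equivalent_smaller_last_row[OF A] by blast
    then have "\<exists>C. column_equivalent (Suc m) B C \<and> (\<forall>j<m. C $$ (m, j) = 0)"
      using less.hyps by (simp add: column_equivalent_def)
    then show ?thesis using column_equivalent_trans[OF AB] by blast
  next
    case False
    show ?thesis
    proof (cases "\<forall>j<m. A $$ (m, j) = 0")
      case True
      moreover have "column_equivalent (Suc m) A A" using A by (simp add: column_equivalent_def)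
      ultimately show ?thesis by blast
    next
      case not_block: False
      then obtain j where j: "j < m" "A $$ (m, j) \<noteq> 0" by blast
      then have zero: "A $$ (m, k) = 0" if "k < Suc m" "k \<noteq> j" for k
        using False that less_SucI by blast
      have "swapcols j m A $$ (m, i) = 0" if "i < m" for i
        using A that j zero[of m] zero[of i] by auto
      then show ?thesis using column_equivalent_swapcols[OF A, of j m] j by auto
    qed
  qed
qed

lemma index_of_int_multiples:
  assumes "g \<noteq> 0"
  shows "index (range of_int :: rat set) (range (\<lambda>k. of_int k * of_int g)) = nat \<bar>g\<bar>"
proof -
  have "range (\<lambda>k. of_int k * of_int g) = (of_int ` {k. g dvd k} :: rat set)"
    by (auto simp: dvd_def mult.commute image_iff simp flip: of_int_mult)
  moreover have "index (range of_int) (of_int ` {k. g dvd k} :: rat set) = index UNIV {k. g dvd k}"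
    by (rule index_image) (auto simp: additive_def add_subgroup_UNIV intro: add_subgroupI)
  ultimately show ?thesis by (simp only: index_int_multiples[OF assms])
qed

lemma index_zspan_block:
  assumes m: "m < d" and A: "A \<in> carrier_mat (Suc m) (Suc m)"
    and zero: "\<And>j. j < m \<Longrightarrow> A $$ (m, j) = 0"
    and det: "det A \<noteq> 0"
  obtains A' where "A' \<in> carrier_mat m m" "det A' \<noteq> 0" "\<bar>det A\<bar> = \<bar>A $$ (m, m)\<bar> * \<bar>det A'\<bar>"
    "index (zspan (Suc m) b) (zspan (Suc m) (column (Suc m) A)) =
      nat \<bar>A $$ (m, m)\<bar> * index (zspan m b) (zspan m (column m A'))"
proof -
  define g where "g = A $$ (m, m)"
  define A' where "A' = mat_delete A m m"
  have A': "A' \<in> carrier_mat m m" using A by (auto simp: A'_def mat_delete_def)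
  have "det A = (\<Sum>j<Suc m. A $$ (m, j) * cofactor A m j)" by (rule laplace_expansion_row[OF A]) simp
  also have "\<dots> = g * det A'" using zero by (simp add: g_def A'_def cofactor_def)
  finally have detA: "det A = g * det A'" .
  then have g: "g \<noteq> 0" using det by auto
  let ?M = "zspan (Suc m) b" and ?H = "zspan (Suc m) (column (Suc m) A)"
  have column_zero: "coord m (column (Suc m) A j) = 0" if "j < m" for j
    using coord_column[OF m] zero[OF that] by simp
  have H: "coord m ` ?H = range (\<lambda>k. of_int k * of_int g)"
    "{v \<in> ?H. coord m v = 0} = zspan m (column (Suc m) A)"
    using coord_image_zspan_Suc[of m "column (Suc m) A", OF column_zero] g
    by (simp_all add: coord_column[OF m] g_def)
  have M: "coord m ` ?M = range of_int" "{v \<in> ?M. coord m v = 0} = zspan m b"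
    using coord_image_zspan_Suc[of m b] m by (simp_all add: coord_basis)
  have "column (Suc m) A j = column m A' j" if "j < m" for j
    using that A zero[OF that] by (simp add: column_def A'_def mat_delete_def)
  then have H': "zspan m (column (Suc m) A) = zspan m (column m A')" by (simp add: zspan_def)
  have "?H \<subseteq> ?M"
  proof -
    have "column (Suc m) A j \<in> ?M" for j
      unfolding column_def zspan_def by (rule range_eqI) (rule refl)
    then show ?thesis by (auto simp: zspan_subset_iff add_subgroup_zspan)
  qed
  then have "index ?M ?H = nat \<bar>g\<bar> * index (zspan m b) (zspan m (column m A'))"
    using index_image_kernel[OF additive_coord[of m] add_subgroup_zspan add_subgroup_zspan]
    by (simp only: H M H' index_of_int_multiples[OF g])
  then show thesis
    using that[of A'] A' detA det by (simp add: abs_mult g_def)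
qed

lemma index_zspan_column:
  assumes "n \<le> d" "A \<in> carrier_mat n n" "det A \<noteq> 0"
  shows "index (zspan n b) (zspan n (column n A)) = nat \<bar>det A\<bar>"
  using assms
proof (induction n arbitrary: A)
  case 0
  have "zspan 0 (column 0 A) = zspan 0 b" by (simp add: zspan_def)
  then show ?case using 0 by (simp add: index_self add_subgroup_zspan)
next
  case (Suc m)
  obtain B where AB: "column_equivalent (Suc m) A B" and zero: "\<And>j. j < m \<Longrightarrow> B $$ (m, j) = 0"
    using ex_column_equivalent_block[OF Suc.prems(2)] by blast
  then have B: "B \<in> carrier_mat (Suc m) (Suc m)" "\<bar>det A\<bar> = \<bar>det B\<bar>" and detB: "det B \<noteq> 0"
    using Suc.prems(3) by (auto simp: column_equivalent_def)
  have "m < d" using Suc.prems(1) by simp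
  then obtain B' where B': "B' \<in> carrier_mat m m" "det B' \<noteq> 0" "\<bar>det B\<bar> = \<bar>B $$ (m, m)\<bar> * \<bar>det B'\<bar>"
    "index (zspan (Suc m) b) (zspan (Suc m) (column (Suc m) B)) =
      nat \<bar>B $$ (m, m)\<bar> * index (zspan m b) (zspan m (column m B'))"
    using index_zspan_block[OF _ B(1) zero detB] by blast
  then show ?case
    using Suc.IH[of B'] Suc.prems(1) AB B(2) by (simp add: column_equivalent_def nat_mult_distrib)
qed

subsection \<open>Determinants of linear maps\<close>

definition lmat :: "('v \<Rightarrow> 'v) \<Rightarrow> rat mat" where
  "lmat G = mat d d (\<lambda>(i, j). coord i (G (b j)))"

lemma lmat_carrier [simp]: "lmat G \<in> carrier_mat d d"
  by (simp add: lmat_def)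

lemma lmat_compose:
  assumes "lin G" shows "lmat (\<lambda>v. G (H v)) = lmat G * lmat H"
proof (rule eq_matI)
  fix i j assume ij: "i < dim_row (lmat G * lmat H)" "j < dim_col (lmat G * lmat H)"
  then have "coord i (G (H (b j))) = (\<Sum>k<d. coord i (G (b k)) * coord k (H (b j)))"
    by (subst lin_expansion[OF assms]) (simp add: coord_sum coord_scale mult.commute)
  then show "lmat (\<lambda>v. G (H v)) $$ (i, j) = (lmat G * lmat H) $$ (i, j)"
    using ij by (simp add: lmat_def scalar_prod_def atLeast0LessThan)
qed (auto simp: lmat_def)

lemma lmat_add: "lmat (\<lambda>v. G v + H v) = lmat G + lmat H"
  and lmat_scale: "lmat (\<lambda>v. q *s G v) = q \<cdot>\<^sub>m lmat G"
  and lmat_id: "lmat (\<lambda>v. v) = 1\<^sub>m d"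
  by (auto simp: lmat_def coord_add coord_scale coord_basis intro!: eq_matI)

definition ldet :: "('v \<Rightarrow> 'v) \<Rightarrow> rat" where
  "ldet G = det (lmat G)"

lemma ldet_compose: "lin G \<Longrightarrow> ldet (\<lambda>v. G (H v)) = ldet G * ldet H"
  unfolding ldet_def by (simp add: lmat_compose det_mult[OF lmat_carrier lmat_carrier])

lemma ldet_id: "ldet (\<lambda>v. v) = 1"
  by (simp add: ldet_def lmat_id)

lemma ldet_nonzero:
  assumes "lin G" "inj G" shows "ldet G \<noteq> 0"
proof -
  obtain H where H: "lin H" "H \<circ> G = id" using endo.linear_injective_left_inverse[OF assms] by blast
  have "(\<lambda>v. H (G v)) = (\<lambda>v. v)" using H(2) by (auto simp: fun_eq_iff)
  then have "ldet H * ldet G = 1" using ldet_compose[OF H(1), of G] ldet_id by simp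
  then show ?thesis by auto
qed

lemma ex_int_mat:
  assumes "G ` L \<subseteq> L"
  obtains A where "A \<in> carrier_mat d d" "lmat G = map_mat of_int A"
    "\<And>j. j < d \<Longrightarrow> G (b j) = column d A j"
proof
  define A where "A = mat d d (\<lambda>(i, j). \<lfloor>coord i (G (b j))\<rfloor>)"
  have "G (b j) \<in> L" if "j < d" for j using that assms by (auto simp: L_zspan zspan_base)
  then have entry: "of_int (A $$ (i, j)) = coord i (G (b j))" if "i < d" "j < d" for i j
    using that by (auto simp: A_def mem_L_iff elim!: Ints_cases)
  show A: "A \<in> carrier_mat d d" by (simp add: A_def)
  show "lmat G = map_mat of_int A" by (rule eq_matI) (use A entry in \<open>auto simp: lmat_def\<close>)
  show "G (b j) = column d A j" if "j < d" for j
    unfolding column_def using entry[OF _ that] expansion[of "G (b j)"] by simp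
qed

lemma index_lin_image_L:
  assumes G: "lin G" "inj G" and stable: "G ` L \<subseteq> L"
  shows "of_nat (index L (G ` L)) = \<bar>ldet G\<bar>"
proof -
  obtain A where A: "A \<in> carrier_mat d d" "lmat G = map_mat of_int A"
    "\<And>j. j < d \<Longrightarrow> G (b j) = column d A j"
    using ex_int_mat[OF stable] by blast
  have det: "ldet G = of_int (det A)" by (simp add: ldet_def A(2))
  then have "det A \<noteq> 0" using ldet_nonzero[OF G] by auto
  moreover have "G ` L = zspan d (column d A)"
    unfolding L_zspan image_zspan[OF G(1)] using A(3) by (simp add: zspan_def)
  ultimately show ?thesis using index_zspan_column[OF order_refl A(1)] det by (simp add: L_zspan)
qed

lemma index_L_pos:
  assumes M: "add_subgroup M" "M \<subseteq> L" and k: "k > 0" and kL: "(*s) (of_nat k) ` L \<subseteq> M"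
  shows "index L M > 0"
proof -
  let ?k = "(*s) (of_nat k :: rat)"
  have "of_nat (index L (?k ` L)) = \<bar>ldet ?k\<bar>"
    using index_lin_image_L[OF lin_scale inj_scale] k kL M(2) by simp
  moreover have "ldet ?k \<noteq> 0" using ldet_nonzero[OF lin_scale inj_scale] k by simp
  ultimately have "index L (?k ` L) > 0" by (cases "index L (?k ` L)") auto
  moreover have "index L (?k ` L) = index L M * index M (?k ` L)"
    by (intro index_mult add_subgroup_L M kL add_subgroup_image additive_scale)
  ultimately show ?thesis by (auto intro: gr0I)
qed

lemma ex_denominator:
  assumes "finite S" shows "\<exists>k :: nat. k > 0 \<and> (\<forall>v\<in>S. of_nat k *s v \<in> L)"
proof -
  have "finite ((\<lambda>(i, v). coord i v) ` ({..<d} \<times> S))" using assms by simp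
  then obtain k :: nat where "k > 0" "\<forall>q\<in>(\<lambda>(i, v). coord i v) ` ({..<d} \<times> S). of_nat k * q \<in> \<int>"
    using finite_common_denominator by blast
  then show ?thesis by (auto simp: mem_L_iff coord_scale)
qed

lemma ex_denominator_zspan: "\<exists>k :: nat. k > 0 \<and> (*s) (of_nat k) ` zspan n a \<subseteq> L"
proof -
  obtain k :: nat where "k > 0" "\<forall>v\<in>a ` {..<n}. of_nat k *s v \<in> L"
    using ex_denominator[of "a ` {..<n}"] by auto
  then show ?thesis
    by (auto simp: image_zspan[OF lin_scale] zspan_subset_iff[OF add_subgroup_L]
      intro!: exI[of _ k])
qed

lemma ex_denominator_lin:
  assumes "lin G" shows "\<exists>k :: nat. k > 0 \<and> (\<lambda>v. of_nat k *s G v) ` L \<subseteq> L"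
  using ex_denominator_zspan[of d "\<lambda>i. G (b i)"]
  unfolding image_zspan[OF assms, symmetric] L_zspan[symmetric] image_image .

lemma index_full_rank_lattice_pos:
  assumes "full_rank_lattice scale d M" "M \<subseteq> L" shows "add_subgroup M" "index L M > 0"
proof -
  obtain c where "lattice_basis scale d c M" using assms(1) by (auto simp: full_rank_lattice_def)
  then interpret M: rat_lattice scale d c M by unfold_locales
  show "add_subgroup M" by (rule M.add_subgroup_L)
  obtain k :: nat where "k > 0" "(*s) (of_nat k) ` L \<subseteq> M"
    using M.ex_denominator_zspan[of d b] by (auto simp: L_zspan)
  then show "index L M > 0" by (rule index_L_pos[OF M.add_subgroup_L assms(2)])
qed

lemma index_lin_image_integral:
  assumes G: "lin G" "inj G" and M: "add_subgroup M" "M \<subseteq> L" "index L M > 0"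
    and stable: "G ` L \<subseteq> L" "G ` M \<subseteq> M"
  shows "of_nat (index M (G ` M)) = \<bar>ldet G\<bar>"
proof -
  have sub: "add_subgroup (G ` L)" "add_subgroup (G ` M)"
    by (intro add_subgroup_image additive_linear[OF G(1)] add_subgroup_L M(1))+
  have "index L (G ` M) = index L (G ` L) * index (G ` L) (G ` M)"
    by (rule index_mult[OF add_subgroup_L sub image_mono[OF M(2)] stable(1)])
  moreover have "index (G ` L) (G ` M) = index L M"
    by (rule index_image[OF additive_linear[OF G(1)] add_subgroup_L M(1,2)])
      (use G in \<open>auto simp: endo.linear_inj_iff_eq_0 add_subgroup_zero[OF M(1)]\<close>)
  moreover have "index L (G ` M) = index L M * index M (G ` M)"
    by (rule index_mult[OF add_subgroup_L M(1) sub(2) stable(2) M(2)])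
  ultimately have "index M (G ` M) = index L (G ` L)" using M(3) by simp
  then show ?thesis using index_lin_image_L[OF G stable(1)] by simp
qed

theorem index_lin_image:
  assumes G: "lin G" "inj G" and M: "add_subgroup M" "M \<subseteq> L" "index L M > 0"
    and stable: "G ` M \<subseteq> M"
  shows "of_nat (index M (G ` M)) = \<bar>ldet G\<bar>"
proof -
  obtain k :: nat where k: "k > 0" "(\<lambda>v. of_nat k *s G v) ` L \<subseteq> L"
    using ex_denominator_lin[OF G(1)] by blast
  let ?k = "(*s) (of_nat k :: rat)" and ?H = "\<lambda>v. of_nat k *s G v"
  have H: "lin ?H" "inj ?H" "?H ` M \<subseteq> M" and k_inj: "inj ?k"
    using G k(1) stable scale_nat_mem[OF M(1)] by (auto simp: lin_iff scale_right_distrib inj_def)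
  have kM: "?k ` M \<subseteq> M" "?k ` L \<subseteq> L"
    using scale_nat_mem[OF M(1)] scale_nat_mem[OF add_subgroup_L] by auto
  have GM: "add_subgroup (G ` M)" by (rule add_subgroup_image[OF additive_linear[OF G(1)] M(1)])
  have HM: "?H ` M = ?k ` (G ` M)" by (simp add: image_image)
  have "index M (?H ` M) = index M (?k ` M) * index (?k ` M) (?H ` M)"
    unfolding HM
    by (intro index_mult M add_subgroup_image additive_scale GM image_mono stable kM)
  moreover have "index (?k ` M) (?H ` M) = index M (G ` M)"
    unfolding HM by (rule index_image[OF additive_scale M(1) GM stable])
      (use k(1) add_subgroup_zero[OF GM] in auto)
  moreover have "of_nat (index M (?H ` M)) = \<bar>ldet ?k\<bar> * \<bar>ldet G\<bar>"
    using index_lin_image_integral[OF H(1,2) M k(2) H(3)]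
      ldet_compose[OF lin_scale, of "of_nat k" G]
    by (simp add: abs_mult)
  moreover have "of_nat (index M (?k ` M)) = \<bar>ldet ?k\<bar>"
    by (rule index_lin_image_integral[OF lin_scale k_inj M kM(2,1)])
  ultimately have "\<bar>ldet ?k\<bar> * of_nat (index M (G ` M)) = \<bar>ldet ?k\<bar> * \<bar>ldet G\<bar>"
    by (metis of_nat_mult)
  moreover have "\<bar>ldet ?k\<bar> \<noteq> 0" using ldet_nonzero[OF lin_scale k_inj] by simp
  ultimately show ?thesis by simp
qed

end

section \<open>Polynomial identities\<close>

lemma det_pencil_poly:
  fixes A B :: "'a::comm_ring_1 mat"
  assumes "A \<in> carrier_mat n n" "B \<in> carrier_mat n n"
  shows "\<exists>q. \<forall>c. poly q c = det (A + c \<cdot>\<^sub>m B)"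
proof (intro exI allI)
  fix c
  show "poly (det (mat n n (\<lambda>ij. [:A $$ ij, B $$ ij:]))) c = det (A + c \<cdot>\<^sub>m B)"
    by (rule poly_det_cong[of _ n]) (use assms in auto)
qed

lemma poly_eqI_nonzero:
  fixes u v :: "'a::field_char_0 poly"
  assumes "\<And>c. c \<noteq> 0 \<Longrightarrow> poly u c = poly v c" shows "u = v"
proof -
  have "poly ([:0, 1:] * u) = poly ([:0, 1:] * v)"
  proof
    show "poly ([:0, 1:] * u) c = poly ([:0, 1:] * v) c" for c
      using assms[of c] by (cases "c = 0") auto
  qed
  then show ?thesis unfolding poly_eq_poly_eq_iff by simp
qed

lemma multiplicative_poly_eq_power:
  fixes f :: "'a::field_char_0 poly"
  assumes "\<And>x y. poly f (x * y) = poly f x * poly f y" and "poly f 1 = 1"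
  shows "\<exists>s. \<forall>c. poly f c = c ^ s"
proof -
  have "f \<noteq> 0" using assms(2) by auto
  then obtain g where f: "f = [:0, 1:] ^ order 0 f * g" and g: "\<not> [:0, 1:] dvd g"
    using order_decomp[of f 0] by auto
  have g0: "poly g 0 \<noteq> 0" using g by (simp add: poly_eq_0_iff_dvd)
  define s where "s = order 0 f"
  have fg: "poly f c = c ^ s * poly g c" for c by (subst f) (simp add: s_def)
  have "poly g x = 1" if x: "x \<noteq> 0" for x
  proof -
    have "g \<circ>\<^sub>p [:0, x:] = [:poly g x:] * g"
    proof (rule poly_eqI_nonzero)
      fix c :: 'a assume c: "c \<noteq> 0"
      have "(x * c) ^ s * poly g (x * c) = (x ^ s * poly g x) * (c ^ s * poly g c)"
        using assms(1)[of x c] by (simp add: fg)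
      then show "poly (g \<circ>\<^sub>p [:0, x:]) c = poly ([:poly g x:] * g) c"
        using x c by (simp add: poly_pcompose power_mult_distrib mult.commute)
    qed
    then have "poly (g \<circ>\<^sub>p [:0, x:]) 0 = poly ([:poly g x:] * g) 0" by simp
    then show ?thesis using g0 by (simp add: poly_pcompose)
  qed
  then have "g = 1" by (intro poly_eqI_nonzero) simp
  then show ?thesis using fg by auto
qed

lemma power_X_mult_eqD:
  fixes p q :: "'a::field_char_0 poly"
  assumes eq: "\<And>c. c ^ r * poly p c = c ^ s * poly q c" and nonzero: "poly p 0 \<noteq> 0" "poly q 0 \<noteq> 0"
  shows "r = s" "p = q"
proof -
  have order: "order 0 ([:0, 1:] ^ k * u) = k" if "poly u 0 \<noteq> 0" for k and u :: "'a poly"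
  proof -
    have "[:0, 1:] ^ k * u \<noteq> 0" using that by auto
    then show ?thesis using order_power_n_n[of 0 k] order_0I[OF that] by (simp add: order_mult)
  qed
  have "poly ([:0, 1:] ^ r * p) = poly ([:0, 1:] ^ s * q)" by (rule ext) (simp add: eq)
  then have "[:0, 1:] ^ r * p = [:0, 1:] ^ s * q" unfolding poly_eq_poly_eq_iff .
  moreover from this show "r = s" using order[OF nonzero(1)] order[OF nonzero(2)] by metis
  ultimately show "p = q" by simp
qed

section \<open>The fixed and the moved space\<close>

locale lattice_endomorphism = rat_lattice scale d b L
  for scale :: "rat \<Rightarrow> 'v::ab_group_add \<Rightarrow> 'v" (infixr \<open>*s\<close> 75) and d b L +
  fixes F :: "'v \<Rightarrow> 'v"
  assumes lin_F: "lin F" and F_stable: "F ` L \<subseteq> L"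
    and semisimple_L: "{v \<in> L. F v - v = 0} = {v \<in> L. F (F v - v) - (F v - v) = 0}"
begin

definition \<Delta> :: "'v \<Rightarrow> 'v" where
  "\<Delta> v = F v - v"

abbreviation VF :: "'v set" where "VF \<equiv> fixed_space F"
abbreviation W :: "'v set" where "W \<equiv> moved_space F"

lemma VF_iff: "v \<in> VF \<longleftrightarrow> \<Delta> v = 0"
  by (simp add: fixed_space_def \<Delta>_def)

lemma W_eq: "W = range \<Delta>"
  by (simp add: moved_space_def \<Delta>_def[abs_def])

lemma \<Delta>_moved [simp]: "\<Delta> v \<in> W"
  by (simp add: W_eq)

lemma lin_\<Delta>: "lin \<Delta>"
  using lin_F by (simp add: lin_iff \<Delta>_def scale_right_diff_distrib)

lemmas additive_\<Delta> = additive_linear[OF lin_\<Delta>]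
lemmas \<Delta>_diff = additive.diff[OF additive_\<Delta>]

lemma subspace_VF: "subspace VF"
proof -
  have "VF = {v. \<Delta> v = 0}" by (auto simp: VF_iff)
  then show ?thesis using endo.linear_subspace_kernel[OF lin_\<Delta>] by simp
qed

lemma subspace_W: "subspace W"
  unfolding W_eq by (rule endo.linear_subspace_image[OF lin_\<Delta> subspace_UNIV])

lemma add_subgroup_subspace: "subspace S \<Longrightarrow> add_subgroup S"
  by (simp add: add_subgroup_def subspace_0 subspace_diff)

lemmas add_subgroup_VF = add_subgroup_subspace[OF subspace_VF]
lemmas add_subgroup_W = add_subgroup_subspace[OF subspace_W]

lemma \<Delta>_\<Delta>_eq_0D:
  assumes "\<Delta> (\<Delta> v) = 0" shows "\<Delta> v = 0"
proof -
  obtain k :: nat where k: "k > 0" "of_nat k *s v \<in> L" using ex_denominator[of "{v}"] by auto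
  have "\<Delta> (\<Delta> (of_nat k *s v)) = 0" using assms by (simp add: endo.linear_scale[OF lin_\<Delta>])
  then have "\<Delta> (of_nat k *s v) = 0" using semisimple_L k(2) unfolding \<Delta>_def by blast
  then show ?thesis using k(1) by (simp add: endo.linear_scale[OF lin_\<Delta>])
qed

lemma fixed_moved_eq_0: "v \<in> VF \<Longrightarrow> v \<in> W \<Longrightarrow> v = 0"
  unfolding W_eq VF_iff using \<Delta>_\<Delta>_eq_0D by auto

lemma \<Delta>_image_W: "\<Delta> ` W = W"
proof -
  have "inj_on \<Delta> W"
  proof (rule inj_onI)
    fix x y assume xy: "x \<in> W" "y \<in> W" "\<Delta> x = \<Delta> y"
    then have "x - y \<in> W" "x - y \<in> VF" by (auto simp: VF_iff \<Delta>_diff subspace_diff[OF subspace_W])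
    then show "x = y" using fixed_moved_eq_0 by fastforce
  qed
  then have "dim (\<Delta> ` W) = dim W"
    using endo.dim_image_eq[OF lin_\<Delta>, of W] subspace_W by (simp add: span_eq_iff[THEN iffD2])
  then show ?thesis
    using subspace_dim_equal[of "\<Delta> ` W" W] endo.linear_subspace_image[OF lin_\<Delta> subspace_W]
      subspace_W
    by (auto simp: W_eq)
qed

lemma ex1_fixed_part: "\<exists>!u. u \<in> VF \<and> v - u \<in> W"
proof (rule ex_ex1I)
  have "\<Delta> v \<in> \<Delta> ` W" by (simp add: \<Delta>_image_W)
  then obtain w where "w \<in> W" "\<Delta> v = \<Delta> w" by blast
  then have "v - w \<in> VF \<and> v - (v - w) \<in> W" by (simp add: VF_iff \<Delta>_diff)
  then show "\<exists>u. u \<in> VF \<and> v - u \<in> W" by blast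
next
  fix u u' assume u: "u \<in> VF \<and> v - u \<in> W" and u': "u' \<in> VF \<and> v - u' \<in> W"
  have "u - u' \<in> W" using subspace_diff[OF subspace_W, of "v - u'" "v - u"] u u' by simp
  moreover have "u - u' \<in> VF" using subspace_diff[OF subspace_VF, of u u'] u u' by simp
  ultimately show "u = u'" using fixed_moved_eq_0[of "u - u'"] by simp
qed

definition fixed_part :: "'v \<Rightarrow> 'v" where
  "fixed_part v = (THE u. u \<in> VF \<and> v - u \<in> W)"

definition moved_part :: "'v \<Rightarrow> 'v" where
  "moved_part v = v - fixed_part v"

lemma fixed_part_VF: "fixed_part v \<in> VF" and moved_part_W: "moved_part v \<in> W"
  using theI'[OF ex1_fixed_part[of v]] by (auto simp: fixed_part_def moved_part_def)

lemma fixed_part_eqI: "u \<in> VF \<Longrightarrow> v - u \<in> W \<Longrightarrow> fixed_part v = u"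
  using ex1_fixed_part[of v] fixed_part_VF[of v] moved_part_W[of v] unfolding moved_part_def
  by blast

lemma fixed_plus_moved_part: "fixed_part v + moved_part v = v"
  by (simp add: moved_part_def)

lemma lin_fixed_part: "lin fixed_part"
  unfolding lin_iff
proof (intro conjI allI; rule fixed_part_eqI)
  fix u v :: 'v and q :: rat
  show "fixed_part u + fixed_part v \<in> VF" "q *s fixed_part v \<in> VF"
    by (intro subspace_add subspace_scale subspace_VF fixed_part_VF)+
  have "moved_part u + moved_part v \<in> W" "q *s moved_part v \<in> W"
    by (intro subspace_add subspace_scale subspace_W moved_part_W)+
  then show "u + v - (fixed_part u + fixed_part v) \<in> W" "q *s v - q *s fixed_part v \<in> W"
    by (simp_all add: moved_part_def scale_right_diff_distrib algebra_simps)
qed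

lemma lin_moved_part: "lin moved_part"
  using lin_fixed_part by (simp add: lin_iff moved_part_def scale_right_diff_distrib)

lemmas additive_moved_part = additive_linear[OF lin_moved_part]

lemma fixed_part_fixed: "v \<in> VF \<Longrightarrow> fixed_part v = v"
  by (rule fixed_part_eqI) (simp_all add: subspace_0[OF subspace_W])

lemma fixed_part_moved: "v \<in> W \<Longrightarrow> fixed_part v = 0"
  by (rule fixed_part_eqI) (simp_all add: subspace_0[OF subspace_VF])

lemma moved_part_fixed: "v \<in> VF \<Longrightarrow> moved_part v = 0"
  and moved_part_moved: "v \<in> W \<Longrightarrow> moved_part v = v"
  by (simp_all add: moved_part_def fixed_part_fixed fixed_part_moved)

lemma moved_part_eq_0_iff: "moved_part v = 0 \<longleftrightarrow> v \<in> VF"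
  using fixed_part_VF[of v] moved_part_fixed[of v] by (auto simp: moved_part_def)

lemma scale_mem_VF_iff: "q \<noteq> 0 \<Longrightarrow> q *s v \<in> VF \<longleftrightarrow> v \<in> VF"
  by (simp add: VF_iff endo.linear_scale[OF lin_\<Delta>])

lemmas part_simps = endo.linear_add[OF lin_fixed_part] endo.linear_diff[OF lin_fixed_part]
  endo.linear_scale[OF lin_fixed_part] endo.linear_add[OF lin_moved_part]
  endo.linear_diff[OF lin_moved_part] endo.linear_scale[OF lin_moved_part]
  fixed_part_fixed[OF fixed_part_VF] fixed_part_moved[OF moved_part_W] fixed_part_moved[OF \<Delta>_moved]
  moved_part_fixed[OF fixed_part_VF] moved_part_moved[OF moved_part_W] moved_part_moved[OF \<Delta>_moved]

subsection \<open>Factoring the characteristic polynomial\<close>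

definition stretch :: "rat \<Rightarrow> 'v \<Rightarrow> 'v" where
  "stretch c v = moved_part v + c *s fixed_part v"

definition shear :: "rat \<Rightarrow> 'v \<Rightarrow> 'v" where
  "shear c v = (fixed_part v - \<Delta> v) + c *s moved_part v"

lemma lin_stretch: "lin (stretch c)"
  using lin_fixed_part lin_moved_part
  by (simp add: lin_iff stretch_def scale_right_distrib mult.commute algebra_simps)

lemma lin_shear: "lin (shear c)"
  using lin_fixed_part lin_moved_part lin_\<Delta>
  by (simp add: lin_iff shear_def scale_right_distrib scale_right_diff_distrib mult.commute
    algebra_simps)

lemma stretch_stretch: "stretch x (stretch y v) = stretch (x * y) v"
  by (simp add: stretch_def part_simps)

lemma stretch_1: "stretch 1 = (\<lambda>v. v)"
  by (rule ext) (simp add: stretch_def moved_part_def)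

lemma stretch_shear: "stretch c (shear c v) = c *s v - \<Delta> v"
proof -
  have "stretch c (shear c v) = c *s (fixed_part v + moved_part v) - \<Delta> v"
    by (simp add: stretch_def shear_def part_simps scale_right_distrib)
  then show ?thesis by (simp only: fixed_plus_moved_part)
qed

lemma inj_stretch:
  assumes "c \<noteq> 0" shows "inj (stretch c)"
  by (rule inj_on_inverseI[where g = "stretch (inverse c)"])
    (simp add: stretch_stretch stretch_1 assms)

lemma inj_shear_0: "inj (shear 0)"
  unfolding endo.linear_inj_iff_eq_0[OF lin_shear]
proof (intro allI impI)
  fix v assume "shear 0 v = 0"
  then have eq: "fixed_part v = \<Delta> v" by (simp add: shear_def)
  then have "\<Delta> v = 0" using fixed_moved_eq_0[of "\<Delta> v"] fixed_part_VF[of v] by simp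
  then show "v = 0" using eq fixed_part_fixed[of v] by (simp add: VF_iff)
qed

lemma ex_poly_ldet_pencil: "\<exists>q. \<forall>c. poly q c = ldet (\<lambda>v. G v + c *s H v)"
  using det_pencil_poly[OF lmat_carrier lmat_carrier, of G H]
  unfolding ldet_def lmat_add lmat_scale .

lemma ex_ldet_stretch_eq_power: "\<exists>s. \<forall>c. ldet (stretch c) = c ^ s"
proof -
  obtain f where f: "\<And>c. poly f c = ldet (stretch c)"
    using ex_poly_ldet_pencil[of moved_part fixed_part] unfolding stretch_def[abs_def] by blast
  have "poly f (x * y) = poly f x * poly f y" for x y
    using ldet_compose[OF lin_stretch, of x "stretch y"] by (simp add: f stretch_stretch)
  moreover have "poly f 1 = 1" by (simp add: f stretch_1 ldet_id)
  ultimately show ?thesis using multiplicative_poly_eq_power[of f] by (simp add: f)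
qed

lemma ldet_char_poly: "ldet (\<lambda>v. c *s v - \<Delta> v) = poly (char_poly (lmat F)) (1 + c)"
proof -
  have "lmat (\<lambda>v. c *s v - \<Delta> v) = - char_matrix (lmat F) (1 + c)"
    by (rule eq_matI)
      (auto simp: lmat_def char_matrix_def \<Delta>_def coord_add coord_diff coord_scale coord_basis
        algebra_simps)
  then show ?thesis by (simp add: ldet_def char_poly_matrix[OF lmat_carrier])
qed

lemma lattice_mat: "lattice_mat scale d b F \<in> carrier_mat d d"
  "map_mat of_int (lattice_mat scale d b F) = lmat F"
proof -
  obtain A where A: "A \<in> carrier_mat d d" "lmat F = map_mat of_int A"
    "\<And>j. j < d \<Longrightarrow> F (b j) = column d A j"
    using ex_int_mat[OF F_stable] by blast
  have "lattice_mat scale d b F = A"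
    unfolding lattice_mat_def
  proof (rule the_equality)
    show "A \<in> carrier_mat d d \<and> (\<forall>j<d. F (b j) = (\<Sum>i<d. of_int (A $$ (i, j)) *s b i))"
      using A by (simp add: column_def)
    fix B assume B: "B \<in> carrier_mat d d \<and> (\<forall>j<d. F (b j) = (\<Sum>i<d. of_int (B $$ (i, j)) *s b i))"
    have "of_int (A $$ (i, j)) = (of_int (B $$ (i, j)) :: rat)" if "i < d" "j < d" for i j
      using that A(3)[of j] B coord_combination[OF that(1), of "\<lambda>i. of_int (A $$ (i, j))"]
        coord_combination[OF that(1), of "\<lambda>i. of_int (B $$ (i, j))"] by (simp add: column_def)
    then show "B = A" using A(1) B by (intro eq_matI) auto
  qed
  then show "lattice_mat scale d b F \<in> carrier_mat d d"
    "map_mat of_int (lattice_mat scale d b F) = lmat F" using A by simp_all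
qed

text \<open>Since \<open>c - \<Delta> = stretch c \<circ> shear c\<close>, the determinant of \<open>stretch c\<close> is a power of \<open>c\<close>, and
  \<open>shear 0\<close> is invertible, the characteristic polynomial determines both determinants.\<close>

lemma ldet_stretch_shear:
  assumes char: "char_poly (lattice_mat scale d b F) = [:-1, 1:] ^ r * p \<or>
         char_poly (lattice_mat scale d b F) = - ([:-1, 1:] ^ r * p)"
    and pos: "poly p 1 > 0"
  shows "ldet (stretch c) = c ^ r" "\<bar>ldet (shear 0)\<bar> = of_int (poly p 1)"
proof -
  define p' :: "rat poly" where "p' = map_poly of_int p"
  define q where "q = p' \<circ>\<^sub>p [:1, 1:]"
  have q0: "poly q 0 = of_int (poly p 1)"
    using of_int_hom.poly_map_poly[of p 1] by (simp add: q_def p'_def poly_pcompose)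
  have "char_poly (lmat F) = map_poly of_int (char_poly (lattice_mat scale d b F))"
    unfolding lattice_mat(2)[symmetric] by (rule of_int_hom.char_poly_hom[OF lattice_mat(1)])
  moreover have "map_poly of_int ([:-1, 1:] ^ r * p) = [:-1, 1:] ^ r * p'"
    by (simp add: p'_def of_int_poly_hom.hom_mult of_int_poly_hom.hom_power)
  ultimately have
    "char_poly (lmat F) = [:-1, 1:] ^ r * p' \<or> char_poly (lmat F) = - ([:-1, 1:] ^ r * p')"
    using char by (auto simp: of_int_poly_hom.hom_uminus)
  then obtain \<sigma> :: rat
    where \<sigma>: "\<sigma> \<noteq> 0" "\<bar>\<sigma>\<bar> = 1" "char_poly (lmat F) = [:\<sigma>:] * ([:-1, 1:] ^ r * p')"
    using that[of 1] that[of "-1"] by auto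
  obtain s where s: "\<And>c. ldet (stretch c) = c ^ s" using ex_ldet_stretch_eq_power by blast
  obtain h where h: "\<And>c. poly h c = ldet (shear c)"
    using ex_poly_ldet_pencil[of "\<lambda>v. fixed_part v - \<Delta> v" moved_part] unfolding shear_def[abs_def]
    by blast
  have "c ^ r * poly ([:\<sigma>:] * q) c = c ^ s * poly h c" for c
  proof -
    have "c ^ s * poly h c = ldet (\<lambda>v. stretch c (shear c v))"
      using ldet_compose[OF lin_stretch, of c "shear c"] by (simp add: s h)
    also have "\<dots> = poly (char_poly (lmat F)) (1 + c)"
      unfolding stretch_shear by (rule ldet_char_poly)
    also have "\<dots> = c ^ r * poly ([:\<sigma>:] * q) c" by (simp add: \<sigma>(3) q_def poly_pcompose add.commute)
    finally show ?thesis by simp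
  qed
  moreover have "poly ([:\<sigma>:] * q) 0 \<noteq> 0" using q0 pos \<sigma>(1) by simp
  moreover have "poly h 0 \<noteq> 0" using ldet_nonzero[OF lin_shear inj_shear_0] by (simp add: h)
  ultimately have rs: "r = s" "[:\<sigma>:] * q = h" by (rule power_X_mult_eqD)+
  then show "ldet (stretch c) = c ^ r" using s by simp
  have "ldet (shear 0) = \<sigma> * of_int (poly p 1)" using h[of 0] q0 unfolding rs(2)[symmetric] by simp
  then show "\<bar>ldet (shear 0)\<bar> = of_int (poly p 1)" using \<sigma>(2) pos by (simp add: abs_mult)
qed

subsection \<open>Indices of fixed and moved parts\<close>

definition sublattice :: "'v set \<Rightarrow> bool" where
  "sublattice M \<longleftrightarrow> add_subgroup M \<and> M \<subseteq> L \<and> F ` M \<subseteq> M \<and> index L M > 0"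

lemma
  assumes "sublattice M"
  shows sublattice_add_subgroup: "add_subgroup M" and sublattice_subset: "M \<subseteq> L"
    and sublattice_stable: "F ` M \<subseteq> M" and sublattice_index_pos: "index L M > 0"
  using assms by (auto simp: sublattice_def)

lemma sublattice_\<Delta>: "sublattice M \<Longrightarrow> \<Delta> ` M \<subseteq> M"
  using add_subgroup_diff unfolding sublattice_def \<Delta>_def by fast

lemma sublattice_L: "sublattice L"
  using add_subgroup_L F_stable by (simp add: sublattice_def index_self)

definition split_part :: "'v set \<Rightarrow> 'v set" where
  "split_part M = (M \<inter> VF) + (M \<inter> W)"

lemma mem_split_part_iff:
  assumes "add_subgroup M" shows "v \<in> split_part M \<longleftrightarrow> v \<in> M \<and> fixed_part v \<in> M"
proof
  assume "v \<in> split_part M"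
  then obtain u w where uw: "u \<in> M \<inter> VF" "w \<in> M \<inter> W" "v = u + w"
    unfolding split_part_def by (rule set_plus_elim)
  then have "fixed_part v = u" by (simp add: part_simps fixed_part_fixed fixed_part_moved)
  then show "v \<in> M \<and> fixed_part v \<in> M" using uw assms by (simp add: add_subgroup_add)
next
  assume v: "v \<in> M \<and> fixed_part v \<in> M"
  then have "fixed_part v \<in> M \<inter> VF" "moved_part v \<in> M \<inter> W"
    using fixed_part_VF[of v] moved_part_W[of v] add_subgroup_diff[OF assms, of v "fixed_part v"]
    by (simp_all add: moved_part_def)
  then have "fixed_part v + moved_part v \<in> split_part M"
    unfolding split_part_def by (rule set_plus_intro)
  then show "v \<in> split_part M" by (simp only: fixed_plus_moved_part)
qed

lemma add_subgroup_split_part: "add_subgroup M \<Longrightarrow> add_subgroup (split_part M)"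
  unfolding split_part_def
  by (intro add_subgroup_plus add_subgroup_Int add_subgroup_VF add_subgroup_W)

lemma split_part_subset: "add_subgroup M \<Longrightarrow> split_part M \<subseteq> M"
  using mem_split_part_iff by blast

lemma index_split_part_pos:
  assumes M: "sublattice M" shows "index L (split_part M) > 0"
proof -
  note subgroup = sublattice_add_subgroup[OF M]
  obtain k :: nat where k: "k > 0" "(\<lambda>v. of_nat k *s fixed_part v) ` L \<subseteq> L"
    using ex_denominator_lin[OF lin_fixed_part] by blast
  define m where "m = index L M"
  have m: "of_nat m *s v \<in> M" if "v \<in> L" for v
    using zmul_index_mem[OF add_subgroup_L subgroup sublattice_subset[OF M] that]
    by (simp add: zmul_scale m_def)
  show ?thesis
  proof (rule index_L_pos)
    show "add_subgroup (split_part M)" "split_part M \<subseteq> L"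
      using add_subgroup_split_part[OF subgroup] split_part_subset[OF subgroup]
        sublattice_subset[OF M] by auto
    show "m * k > 0" using sublattice_index_pos[OF M] k(1) by (simp add: m_def)
    show "(*s) (of_nat (m * k)) ` L \<subseteq> split_part M"
    proof (rule image_subsetI)
      fix v assume v: "v \<in> L"
      then have "of_nat m *s of_nat k *s v \<in> M" "of_nat m *s of_nat k *s fixed_part v \<in> M"
        using k(2) by (blast intro: m scale_nat_mem[OF add_subgroup_L])+
      then show "of_nat (m * k) *s v \<in> split_part M"
        by (simp add: mem_split_part_iff[OF subgroup] part_simps)
    qed
  qed
qed

lemma index_plus_fixed_moved:
  assumes U: "add_subgroup U" "add_subgroup U'" "U' \<subseteq> U" "U \<subseteq> VF"
    and X: "add_subgroup X" "add_subgroup X'" "X' \<subseteq> X" "X \<subseteq> W"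
  shows "index (U + X) (U' + X') = index U U' * index X X'"
proof -
  have moved: "moved_part ` (A + B) = B" and kernel: "{v \<in> A + B. moved_part v = 0} = A"
    if A: "add_subgroup A" "A \<subseteq> VF" and B: "add_subgroup B" "B \<subseteq> W" for A B
  proof -
    have part: "moved_part (a + c) = c" if "a \<in> A" "c \<in> B" for a c
    proof -
      have "a \<in> VF" "c \<in> W" using that A(2) B(2) by auto
      then show ?thesis by (simp add: part_simps moved_part_fixed moved_part_moved)
    qed
    show "moved_part ` (A + B) = B"
    proof
      show "moved_part ` (A + B) \<subseteq> B" using part by (auto elim!: set_plus_elim)
      show "B \<subseteq> moved_part ` (A + B)"
        using subset_plus_right[OF A(1), of B] moved_part_moved B(2)
        by (metis image_eqI subsetD subsetI)
    qed
    show "{v \<in> A + B. moved_part v = 0} = A"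
    proof
      show "{v \<in> A + B. moved_part v = 0} \<subseteq> A" using part by (auto elim!: set_plus_elim)
      show "A \<subseteq> {v \<in> A + B. moved_part v = 0}"
        using subset_plus_left[OF B(1), of A] moved_part_fixed A(2) by blast
    qed
  qed
  have "index (U + X) (U' + X') = index (moved_part ` (U + X)) (moved_part ` (U' + X')) *
      index {v \<in> U + X. moved_part v = 0} {v \<in> U' + X'. moved_part v = 0}"
    using U X by (intro index_image_kernel additive_moved_part add_subgroup_plus set_plus_mono2)
  then show ?thesis using U X by (simp add: moved kernel mult.commute)
qed

lemma index_lin_image_split:
  assumes M: "sublattice M" and G: "lin G" "inj G"
    and images: "G ` (M \<inter> VF) = U'" "G ` (M \<inter> W) = X'" and sub: "U' \<subseteq> M \<inter> VF" "X' \<subseteq> M \<inter> W"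
  shows "of_nat (index (M \<inter> VF) U' * index (M \<inter> W) X') = \<bar>ldet G\<bar>"
proof -
  note subgroup = sublattice_add_subgroup[OF M] and additive_G = additive_linear[OF G(1)]
  have U: "add_subgroup (M \<inter> VF)" and X: "add_subgroup (M \<inter> W)"
    using subgroup by (auto intro: add_subgroup_Int add_subgroup_VF add_subgroup_W)
  have subgroups: "add_subgroup U'" "add_subgroup X'"
    using add_subgroup_image[OF additive_G] U X images by auto
  have split: "add_subgroup (split_part M)" "split_part M \<subseteq> L" "index L (split_part M) > 0"
    using add_subgroup_split_part[OF subgroup] split_part_subset[OF subgroup]
      sublattice_subset[OF M]
      index_split_part_pos[OF M] by auto
  have "G ` split_part M = U' + X'" unfolding split_part_def image_plus[OF additive_G] images ..
  moreover have "U' + X' \<subseteq> split_part M" unfolding split_part_def by (rule set_plus_mono2[OF sub])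
  ultimately have "of_nat (index (split_part M) (U' + X')) = \<bar>ldet G\<bar>"
    using index_lin_image[OF G split] by simp
  then show ?thesis using sub U X subgroups by (simp add: split_part_def index_plus_fixed_moved)
qed

lemma
  assumes M: "sublattice M"
  shows index_moved: "of_nat (index (M \<inter> W) (\<Delta> ` (M \<inter> W))) = \<bar>ldet (shear 0)\<bar>"
    and index_fixed: "e > 0 \<Longrightarrow>
      of_nat (index (M \<inter> VF) ((*s) (of_nat e) ` (M \<inter> VF))) = \<bar>ldet (stretch (of_nat e))\<bar>"
proof -
  note subgroup = sublattice_add_subgroup[OF M]
  let ?U = "M \<inter> VF" and ?X = "M \<inter> W"
  have U: "add_subgroup ?U" and X: "add_subgroup ?X"
    using subgroup by (auto intro: add_subgroup_Int add_subgroup_VF add_subgroup_W)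
  have "shear 0 ` ?U = id ` ?U" by (rule image_cong) (auto simp: shear_def fixed_part_fixed VF_iff)
  then have shear_U: "shear 0 ` ?U = ?U" by simp
  have "shear 0 ` ?X = \<Delta> ` uminus ` ?X"
    unfolding image_image
    by (rule image_cong) (auto simp: shear_def fixed_part_moved additive.minus[OF additive_\<Delta>])
  then have shear_X: "shear 0 ` ?X = \<Delta> ` ?X" by (simp only: uminus_image_add_subgroup[OF X])
  have "\<Delta> ` ?X \<subseteq> ?X" using sublattice_\<Delta>[OF M] by auto
  from index_lin_image_split[OF M lin_shear inj_shear_0 shear_U shear_X order_refl this]
  show "of_nat (index ?X (\<Delta> ` ?X)) = \<bar>ldet (shear 0)\<bar>" by (simp add: index_self U)
  assume "e > 0"
  have stretch_U: "stretch (of_nat e) ` ?U = (*s) (of_nat e) ` ?U"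
    by (rule image_cong) (auto simp: stretch_def fixed_part_fixed moved_part_fixed)
  have "stretch (of_nat e) ` ?X = id ` ?X"
    by (rule image_cong) (auto simp: stretch_def fixed_part_moved moved_part_moved)
  then have stretch_X: "stretch (of_nat e) ` ?X = ?X" by simp
  have "(*s) (of_nat e) ` ?U \<subseteq> ?U" using scale_nat_mem[OF U] by blast
  from index_lin_image_split[OF M lin_stretch inj_stretch stretch_U stretch_X this order_refl]
    \<open>e > 0\<close>
  show "of_nat (index ?U ((*s) (of_nat e) ` ?U)) = \<bar>ldet (stretch (of_nat e))\<bar>"
    by (simp add: index_self X)
qed

section \<open>Counting fixed points\<close>

definition fixed_mod :: "'v set \<Rightarrow> 'v set" where
  "fixed_mod M = {v. \<Delta> v \<in> M}"

lemma add_subgroup_fixed_mod: "add_subgroup M \<Longrightarrow> add_subgroup (fixed_mod M)"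
  unfolding fixed_mod_def by (rule add_subgroup_vimage[OF additive_\<Delta>])

lemma \<Delta>_image_fixed_mod: "\<Delta> ` fixed_mod M = M \<inter> W"
  by (auto simp: fixed_mod_def W_eq)

lemma VF_subset_fixed_mod: "add_subgroup M \<Longrightarrow> VF \<subseteq> fixed_mod M"
  by (auto simp: fixed_mod_def VF_iff add_subgroup_zero)

lemma \<Delta>_image_VF: "\<Delta> ` VF = {0}"
  using subspace_0[OF subspace_VF] by (auto simp: VF_iff image_iff)

lemma card_quotient_fixed_index:
  assumes M: "add_subgroup M" and stable: "F ` M \<subseteq> M"
  shows "card (quotient_fixed F A M) = index (A \<inter> fixed_mod M) M"
proof -
  note additive_F = additive_linear[OF lin_F]
  have image: "M + F ` coset M x = coset M (F x)" for x
    using add_subgroup_plus_absorb[OF M add_subgroup_image[OF additive_F M] stable]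
    by (simp add: coset_eq_plus image_plus[OF additive_F] flip: add.assoc)
  have "coset M (F x) = coset M x \<longleftrightarrow> x \<in> fixed_mod M" for x
    by (simp add: coset_eq_iff[OF M] fixed_mod_def \<Delta>_def)
  then have "quotient_fixed F A M = coset M ` (A \<inter> fixed_mod M)"
    unfolding quotient_fixed_def carrier_Mod using image by (auto simp: image_iff)
  then show ?thesis by (simp add: index_altdef)
qed

text \<open>The number of fixed points of \<open>L / M\<close> modulo those induced by fixed points of \<open>L\<close>.\<close>

definition fixed_point_defect :: "'v set \<Rightarrow> nat" where
  "fixed_point_defect M = index (M \<inter> \<Delta> ` L) (\<Delta> ` M)"

lemma card_quotient_fixed:
  assumes M: "sublattice M"
  shows "card (quotient_fixed F L M) = index (L \<inter> VF) (M \<inter> VF) * fixed_point_defect M"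
proof -
  note subgroup = sublattice_add_subgroup[OF M]
  let ?T = "L \<inter> fixed_mod M"
  have "add_subgroup ?T" by (intro add_subgroup_Int add_subgroup_L add_subgroup_fixed_mod subgroup)
  moreover have "M \<subseteq> ?T"
    using sublattice_subset[OF M] sublattice_\<Delta>[OF M] by (auto simp: fixed_mod_def)
  ultimately have "index ?T M = index (\<Delta> ` ?T) (\<Delta> ` M) * index {v \<in> ?T. \<Delta> v = 0} {v \<in> M. \<Delta> v = 0}"
    by (intro index_image_kernel additive_\<Delta> subgroup)
  moreover have "\<Delta> ` ?T = M \<inter> \<Delta> ` L" by (auto simp: fixed_mod_def)
  moreover have "{v \<in> ?T. \<Delta> v = 0} = L \<inter> VF" "{v \<in> M. \<Delta> v = 0} = M \<inter> VF"
    using VF_subset_fixed_mod[OF subgroup] by (auto simp: VF_iff)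
  ultimately show ?thesis
    using card_quotient_fixed_index[OF subgroup sublattice_stable[OF M], of L]
    by (simp add: fixed_point_defect_def)
qed

lemma comm_group_separation_group: "add_subgroup M \<Longrightarrow> comm_group (separation_group F M)"
  unfolding separation_group_def split_part_def[symmetric]
  by (intro comm_group_Mod add_subgroup_split_part split_part_subset)

lemma card_separation_group:
  assumes M: "add_subgroup M"
  shows "card (carrier (separation_group F M)) = index (\<Delta> ` M) (\<Delta> ` (M \<inter> W))"
proof -
  have "\<Delta> ` split_part M = \<Delta> ` (M \<inter> W)"
  proof -
    have "\<Delta> ` (M \<inter> VF) = {0}"
      using add_subgroup_zero[OF add_subgroup_Int[OF M add_subgroup_VF]]
      by (auto simp: VF_iff image_iff)
    then show ?thesis by (simp add: split_part_def image_plus[OF additive_\<Delta>])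
  qed
  moreover have "index (\<Delta> ` M) (\<Delta> ` split_part M) = index M (split_part M)"
    by (rule index_image[OF additive_\<Delta> M add_subgroup_split_part[OF M] split_part_subset[OF M]])
      (simp add: mem_split_part_iff[OF M] fixed_part_fixed VF_iff)
  ultimately show ?thesis by (simp add: separation_group_def split_part_def index_def)
qed

lemma card_separation_group_index: "card (carrier (separation_group F M)) = index M (split_part M)"
  by (simp add: separation_group_def split_part_def index_def)

lemma B_group_eq: "B_group F L M = add_group (L + fixed_mod M) Mod (L + VF)"
  by (simp add: B_group_def fixed_mod_def \<Delta>_def)

lemma comm_group_B_group: "add_subgroup M \<Longrightarrow> comm_group (B_group F L M)"
  unfolding B_group_eq
  by (intro comm_group_Mod add_subgroup_plus add_subgroup_L add_subgroup_VF add_subgroup_fixed_mod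
      set_plus_mono2 VF_subset_fixed_mod order_refl)

lemma B_group_presentation:
  assumes M: "add_subgroup M"
  shows "quotient_presentation (B_group F L M) (fixed_mod M) (fixed_mod M \<inter> (L + VF))
    (coset (L + VF))"
proof -
  let ?T = "L + fixed_mod M" and ?S = "L + VF"
  have C: "add_subgroup (fixed_mod M)" by (rule add_subgroup_fixed_mod[OF M])
  have T: "add_subgroup ?T" and S: "add_subgroup ?S" and ST: "?S \<subseteq> ?T"
    by (intro add_subgroup_plus add_subgroup_L add_subgroup_VF C set_plus_mono2 VF_subset_fixed_mod
      M order_refl)+
  interpret comm_group "B_group F L M" by (rule comm_group_B_group[OF M])
  have CT: "fixed_mod M \<subseteq> ?T" by (rule subset_plus_right[OF add_subgroup_L])
  have "coset ?S ` ?T \<subseteq> coset ?S ` fixed_mod M"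
  proof (rule image_subsetI)
    fix t assume "t \<in> ?T"
    then obtain l c where "l \<in> L" "c \<in> fixed_mod M" "t = l + c" by (rule set_plus_elim)
    moreover have "l \<in> ?S" using subset_plus_left[OF add_subgroup_VF] \<open>l \<in> L\<close> by (rule subsetD)
    ultimately have "coset ?S t = coset ?S c" by (simp add: coset_eq_iff[OF S])
    then show "coset ?S t \<in> coset ?S ` fixed_mod M" using \<open>c \<in> fixed_mod M\<close> by blast
  qed
  moreover have "coset ?S ` fixed_mod M \<subseteq> coset ?S ` ?T" using CT by (rule image_mono)
  moreover have "coset ?S \<in> hom (add_group (fixed_mod M)) (B_group F L M)"
    using coset_epi[OF T S ST] CT add_subgroup_add[OF C]
    by (auto simp: epi_def hom_def B_group_eq subset_iff)
  ultimately have "coset ?S \<in> epi (add_group (fixed_mod M)) (B_group F L M)"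
    by (simp add: epi_def B_group_eq carrier_Mod)
  then show ?thesis
    by unfold_locales
      (simp_all add: C S add_subgroup_Int B_group_eq coset_eq_self_iff)
qed

lemma card_B_group:
  assumes M: "add_subgroup M"
  shows "card (carrier (B_group F L M)) = index (M \<inter> W) (M \<inter> \<Delta> ` L)"
proof -
  interpret quotient_presentation "B_group F L M" "fixed_mod M" "fixed_mod M \<inter> (L + VF)"
    "coset (L + VF)"
    by (rule B_group_presentation[OF M])
  have "\<Delta> ` (fixed_mod M \<inter> (L + VF)) = M \<inter> \<Delta> ` (L + VF)" by (auto simp: fixed_mod_def)
  then have "\<Delta> ` (fixed_mod M \<inter> (L + VF)) = M \<inter> \<Delta> ` L"
    by (simp add: image_plus[OF additive_\<Delta>] \<Delta>_image_VF)
  moreover have "index (\<Delta> ` fixed_mod M) (\<Delta> ` (fixed_mod M \<inter> (L + VF))) =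
      index (fixed_mod M) (fixed_mod M \<inter> (L + VF))"
    by (rule index_image[OF additive_\<Delta> add_subgroup_domain add_subgroup_kernel kernel_subset])
      (use subset_plus_right[OF add_subgroup_L, of VF] in \<open>auto simp: VF_iff\<close>)
  ultimately show ?thesis by (simp add: card_carrier_presentation \<Delta>_image_fixed_mod)
qed

lemma index_moved_eq_prod:
  assumes M: "sublattice M"
  shows "index (M \<inter> W) (\<Delta> ` (M \<inter> W)) = card (carrier (B_group F L M)) *
    (fixed_point_defect M * card (carrier (separation_group F M)))"
proof -
  note subgroup = sublattice_add_subgroup[OF M]
  have X: "add_subgroup (M \<inter> W)" by (rule add_subgroup_Int[OF subgroup add_subgroup_W])
  have \<Delta>: "add_subgroup (\<Delta> ` A)" if "add_subgroup A" for A
    by (rule add_subgroup_image[OF additive_\<Delta> that])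
  have M_image: "add_subgroup (M \<inter> \<Delta> ` L)"
    by (rule add_subgroup_Int[OF subgroup \<Delta>[OF add_subgroup_L]])
  have sub: "\<Delta> ` M \<subseteq> M \<inter> \<Delta> ` L" "M \<inter> \<Delta> ` L \<subseteq> M \<inter> W"
    using sublattice_\<Delta>[OF M] sublattice_subset[OF M] by auto
  have "index (M \<inter> W) (\<Delta> ` (M \<inter> W)) =
      index (M \<inter> W) (M \<inter> \<Delta> ` L) * index (M \<inter> \<Delta> ` L) (\<Delta> ` (M \<inter> W))"
    using sub by (intro index_mult X M_image \<Delta>) auto
  also have "index (M \<inter> \<Delta> ` L) (\<Delta> ` (M \<inter> W)) = fixed_point_defect M * index (\<Delta> ` M) (\<Delta> ` (M \<inter> W))"
    unfolding fixed_point_defect_def using sub(1) by (intro index_mult M_image \<Delta> subgroup X) auto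
  finally show ?thesis by (simp only: card_B_group[OF subgroup] card_separation_group[OF subgroup])
qed

lemma
  assumes M: "sublattice M"
  shows card_B_group_pos: "card (carrier (B_group F L M)) > 0"
    and card_separation_group_pos: "card (carrier (separation_group F M)) > 0"
proof -
  have "ldet (shear 0) \<noteq> 0" by (rule ldet_nonzero[OF lin_shear inj_shear_0])
  then have "index (M \<inter> W) (\<Delta> ` (M \<inter> W)) > 0"
    using index_moved[OF M] by (cases "index (M \<inter> W) (\<Delta> ` (M \<inter> W))") auto
  then show "card (carrier (B_group F L M)) > 0" "card (carrier (separation_group F M)) > 0"
    unfolding index_moved_eq_prod[OF M] by (auto intro: gr0I)
qed

subsection \<open>Multiples of a sublattice\<close>

lemma sublattice_scale:
  assumes M: "sublattice M" and e: "e > 0"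
  shows "sublattice ((*s) (of_nat e) ` M)"
proof -
  let ?e = "(*s) (of_nat e :: rat)"
  note subgroup = sublattice_add_subgroup[OF M]
  have eM: "add_subgroup (?e ` M)" "?e ` M \<subseteq> M"
    using add_subgroup_image[OF additive_scale subgroup] scale_nat_mem[OF subgroup] by auto
  have "F ` ?e ` M \<subseteq> ?e ` M"
    using image_mono[OF sublattice_stable[OF M], of ?e]
    by (simp add: image_image endo.linear_scale[OF lin_F])
  moreover have "index L (?e ` M) > 0"
  proof (rule index_L_pos[OF eM(1)])
    show "?e ` M \<subseteq> L" using eM(2) sublattice_subset[OF M] by blast
    show "e * index L M > 0" using e sublattice_index_pos[OF M] by simp
    show "(*s) (of_nat (e * index L M)) ` L \<subseteq> ?e ` M"
    proof (rule image_subsetI)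
      fix v assume "v \<in> L"
      then have "of_nat (index L M) *s v \<in> M"
        using zmul_index_mem[OF add_subgroup_L subgroup sublattice_subset[OF M]]
        by (simp add: zmul_scale)
      then show "of_nat (e * index L M) *s v \<in> ?e ` M" by (metis imageI of_nat_mult scale_scale)
    qed
  qed
  ultimately show ?thesis using eM sublattice_subset[OF M] by (auto simp: sublattice_def)
qed

lemma index_scale:
  "q \<noteq> 0 \<Longrightarrow> add_subgroup A \<Longrightarrow> add_subgroup B \<Longrightarrow> B \<subseteq> A \<Longrightarrow> index ((*s) q ` A) ((*s) q ` B) = index A B"
  by (rule index_image[OF additive_scale]) (auto simp: add_subgroup_zero)

lemma card_B_group_scale:
  assumes M: "add_subgroup M" and e: "e > 0"
  shows "card (carrier (B_group F L M)) =
    card (carrier (B_group F L ((*s) (of_nat e) ` M))) * card (torsion (B_group F L M) e)"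
proof -
  let ?e = "(*s) (of_nat e :: rat)" and ?C = "fixed_mod M" and ?S = "L + VF"
  let ?Ce = "{c \<in> ?C. zmul (int e) c \<in> ?C \<inter> ?S}"
  have eM: "add_subgroup (?e ` M)" by (rule add_subgroup_image[OF additive_scale M])
  interpret quotient_presentation "B_group F L M" ?C "?C \<inter> ?S" "coset ?S"
    by (rule B_group_presentation[OF M])
  interpret scaled: quotient_presentation "B_group F L (?e ` M)" "fixed_mod (?e ` M)"
    "fixed_mod (?e ` M) \<inter> ?S" "coset ?S" by (rule B_group_presentation[OF eM])
  have Ce: "add_subgroup ?Ce"
    using add_subgroup_Int[OF add_subgroup_domain
      add_subgroup_vimage[OF additive_zmul add_subgroup_kernel]]
    by (simp add: Int_def)
  have CeS: "?C \<inter> ?S \<subseteq> ?Ce" using add_subgroup_zmul[OF add_subgroup_kernel] by auto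
  have "fixed_mod (?e ` M) = ?e ` ?C"
  proof (intro equalityI subsetI)
    fix v assume "v \<in> fixed_mod (?e ` M)"
    then obtain m where "m \<in> M" "\<Delta> v = of_nat e *s m" by (auto simp: fixed_mod_def)
    then have "inverse (of_nat e) *s v \<in> ?C"
      using e by (simp add: fixed_mod_def endo.linear_scale[OF lin_\<Delta>])
    moreover have "v = of_nat e *s inverse (of_nat e) *s v" using e by simp
    ultimately show "v \<in> ?e ` ?C" by blast
  qed (auto simp: fixed_mod_def endo.linear_scale[OF lin_\<Delta>])
  moreover have "?e ` ?C \<inter> ?S = ?e ` ?Ce"
    using scale_nat_mem[OF add_subgroup_domain] by (auto simp: zmul_scale)
  ultimately have "card (carrier (B_group F L (?e ` M))) = index ?C ?Ce"
    using index_scale[OF _ add_subgroup_domain Ce, of "of_nat e"] e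
    by (simp only: scaled.card_carrier_presentation) auto
  then show ?thesis
    using index_mult[OF add_subgroup_domain Ce add_subgroup_kernel CeS]
    by (simp add: card_carrier_presentation card_torsion_presentation)
qed

lemma card_separation_group_scale:
  assumes M: "add_subgroup M" and e: "e > 0"
  shows "card (carrier (separation_group F ((*s) (of_nat e) ` M)))
    = card (carrier (separation_group F M))"
proof -
  let ?e = "(*s) (of_nat e :: rat)"
  have eM: "add_subgroup (?e ` M)" by (rule add_subgroup_image[OF additive_scale M])
  have "split_part (?e ` M) = ?e ` split_part M"
    using e by (auto simp: mem_split_part_iff[OF M] mem_split_part_iff[OF eM] part_simps image_iff)
  then show ?thesis
    using index_scale[of "of_nat e" M "split_part M"] e
    by (simp add: card_separation_group_index M add_subgroup_split_part split_part_subset)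
qed

lemma fixed_point_defect_scale:
  assumes M: "sublattice M" and e: "e > 0"
  shows "fixed_point_defect ((*s) (of_nat e) ` M)
    = fixed_point_defect M * card (torsion (B_group F L M) e)"
proof -
  let ?e = "(*s) (of_nat e :: rat)"
  note subgroup = sublattice_add_subgroup[OF M]
  have eM: "sublattice (?e ` M)" by (rule sublattice_scale[OF M e])
  have "index (?e ` M \<inter> W) (\<Delta> ` (?e ` M \<inter> W)) = index (M \<inter> W) (\<Delta> ` (M \<inter> W))"
    using index_moved[OF M] index_moved[OF eM] by (metis of_nat_eq_iff)
  then have "card (carrier (B_group F L (?e ` M))) *
      (fixed_point_defect (?e ` M) * card (carrier (separation_group F M))) =
      card (carrier (B_group F L M)) *
        (fixed_point_defect M * card (carrier (separation_group F M)))"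
    unfolding index_moved_eq_prod[OF M] index_moved_eq_prod[OF eM]
      card_separation_group_scale[OF subgroup e] .
  then show ?thesis
    using card_B_group_pos[OF eM] card_separation_group_pos[OF M]
    by (simp add: card_B_group_scale[OF subgroup e])
qed

lemma card_quotient_fixed_scale:
  assumes M: "sublattice M" and e: "e > 0"
  shows "card (quotient_fixed F L ((*s) (of_nat e) ` M)) =
    card (quotient_fixed F L M) * card (torsion (B_group F L M) e) *
      index (M \<inter> VF) ((*s) (of_nat e) ` (M \<inter> VF))"
proof -
  let ?e = "(*s) (of_nat e :: rat)"
  have U: "add_subgroup (L \<inter> VF)" "add_subgroup (M \<inter> VF)"
    using add_subgroup_Int add_subgroup_VF add_subgroup_L sublattice_add_subgroup[OF M] by auto
  have "?e ` M \<inter> VF = ?e ` (M \<inter> VF)" using e scale_mem_VF_iff[of "of_nat e"] by auto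
  moreover have "index (L \<inter> VF) (?e ` (M \<inter> VF)) =
      index (L \<inter> VF) (M \<inter> VF) * index (M \<inter> VF) (?e ` (M \<inter> VF))"
    using sublattice_subset[OF M] scale_nat_mem[OF U(2)]
    by (intro index_mult U add_subgroup_image[OF additive_scale]) auto
  ultimately show ?thesis
    using card_quotient_fixed[OF M] card_quotient_fixed[OF sublattice_scale[OF M e]]
      fixed_point_defect_scale[OF M e] by simp
qed

end

locale lattice_endomorphism_char_poly = lattice_endomorphism scale d b L F
  for scale :: "rat \<Rightarrow> 'v::ab_group_add \<Rightarrow> 'v" (infixr \<open>*s\<close> 75) and d b L F +
  fixes r :: nat and p :: "int poly"
  assumes char_poly: "char_poly (lattice_mat scale d b F) = [:-1, 1:] ^ r * p \<or>
      char_poly (lattice_mat scale d b F) = - ([:-1, 1:] ^ r * p)"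
    and poly_1_pos: "poly p 1 > 0"
begin

lemma poly_1_eq_prod:
  assumes M: "sublattice M"
  shows "poly p 1 = int (card (carrier (B_group F L M)) *
    (fixed_point_defect M * card (carrier (separation_group F M))))"
proof -
  have "rat_of_int (poly p 1) = of_nat (index (M \<inter> W) (\<Delta> ` (M \<inter> W)))"
    using index_moved[OF M] ldet_stretch_shear(2)[OF char_poly poly_1_pos] by simp
  then show ?thesis unfolding index_moved_eq_prod[OF M] by (metis of_int_eq_iff of_int_of_nat_eq)
qed

theorem card_quotient_fixed_eq:
  assumes M: "sublattice M"
  shows "rat_of_nat (card (quotient_fixed F L M)) =
    rat_of_nat (card (carrier (add_group (L \<inter> VF) Mod (M \<inter> VF)))) *
    (rat_of_int (poly p 1) / (rat_of_nat (card (carrier (B_group F L M))) *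
      rat_of_nat (card (carrier (separation_group F M)))))"
  using card_B_group_pos[OF M] card_separation_group_pos[OF M]
  by (simp add: card_quotient_fixed[OF M] poly_1_eq_prod[OF M] flip: index_def)

theorem card_quotient_fixed_scale_eq:
  assumes M: "sublattice M" and e: "e > 0"
  shows "card (quotient_fixed F L ((*s) (of_nat e) ` M)) =
    card (quotient_fixed F L M) * card (torsion (B_group F L M) e) * e ^ r"
proof -
  have "rat_of_nat (index (M \<inter> VF) ((*s) (of_nat e) ` (M \<inter> VF))) = of_nat (e ^ r)"
    using index_fixed[OF M e] ldet_stretch_shear(1)[OF char_poly poly_1_pos] by simp
  then show ?thesis unfolding card_quotient_fixed_scale[OF M e] of_nat_eq_iff by simp
qed

theorem card_separation_group_B_group_dvd:
  "sublattice M \<Longrightarrow>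
    int (card (carrier (separation_group F M)) * card (carrier (B_group F L M))) dvd poly p 1"
  unfolding poly_1_eq_prod by (intro dvdI[of _ _ "int (fixed_point_defect M)"]) simp

end

section \<open>Dual lattices\<close>

locale dual_lattice_endomorphism = lattice_endomorphism scale d b L F
  for scale :: "rat \<Rightarrow> 'v::ab_group_add \<Rightarrow> 'v" (infixr \<open>*s\<close> 75) and d b L F +
  fixes \<beta> :: "'v \<Rightarrow> 'v \<Rightarrow> rat" and L' :: "'v set"
  assumes form: "nondegenerate_symmetric_form scale \<beta>"
    and invariant: "\<beta> (F v) (F w) = \<beta> v w"
    and dual: "L' = dual_lattice \<beta> L"
    and sublattice_L': "sublattice L'"
begin

lemma \<beta>_sym: "\<beta> v w = \<beta> w v"
  using form by (simp add: nondegenerate_symmetric_form_def)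

lemma \<beta>_add_right: "\<beta> v (x + y) = \<beta> v x + \<beta> v y"
  and \<beta>_scale_right: "\<beta> v (q *s x) = q * \<beta> v x"
  using form by (auto simp: nondegenerate_symmetric_form_def Vector_Spaces.linear_iff)

lemma \<beta>_add_left: "\<beta> (x + y) v = \<beta> x v + \<beta> y v"
  and \<beta>_scale_left: "\<beta> (q *s x) v = q * \<beta> x v"
  by (simp_all add: \<beta>_sym[of _ v] \<beta>_add_right \<beta>_scale_right)

lemma additive_\<beta>: "additive (\<beta> v)"
  by (simp add: additive_def \<beta>_add_right)

lemma \<beta>_diff_right: "\<beta> v (x - y) = \<beta> v x - \<beta> v y"
  and \<beta>_diff_left: "\<beta> (x - y) v = \<beta> x v - \<beta> y v"
  by (simp_all add: \<beta>_sym[of _ v] additive.diff[OF additive_\<beta>])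

lemmas \<beta>_simps = \<beta>_add_left \<beta>_add_right \<beta>_diff_left \<beta>_diff_right \<beta>_scale_left \<beta>_scale_right

lemma \<beta>_nondegenerate: "(\<And>w. \<beta> v w = 0) \<Longrightarrow> v = 0"
  using form by (simp add: nondegenerate_symmetric_form_def)

lemma pairing_\<beta>: "add_subgroup A \<Longrightarrow> add_subgroup C \<Longrightarrow> pairing_mod_Z A C \<beta>"
  by unfold_locales (simp_all add: additive_mod_Z_def \<beta>_simps)

lemma \<beta>_fixed_moved:
  assumes "u \<in> VF" "w \<in> W" shows "\<beta> u w = 0"
proof -
  obtain x where "w = \<Delta> x" using assms(2) by (auto simp: W_eq)
  then show ?thesis
    using invariant[of u x] assms(1) by (simp add: fixed_space_def \<Delta>_def \<beta>_diff_right)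
qed

lemma \<beta>_fixed_part_left: "\<beta> (fixed_part v) w = \<beta> (fixed_part v) (fixed_part w)"
  using \<beta>_fixed_moved[OF fixed_part_VF moved_part_W, of v w]
  by (simp add: moved_part_def \<beta>_diff_right)

lemma \<beta>_fixed_part: "\<beta> (fixed_part v) w = \<beta> v (fixed_part w)"
  using \<beta>_fixed_part_left[of v w] \<beta>_fixed_part_left[of w v] by (simp add: \<beta>_sym)

lemma \<beta>_moved_part: "\<beta> (moved_part v) w = \<beta> v (moved_part w)"
  using \<beta>_fixed_part[of v w] by (simp add: moved_part_def \<beta>_diff_left \<beta>_diff_right)

lemma \<beta>_\<Delta>: "\<beta> v (\<Delta> w) + \<beta> w (\<Delta> v) = - \<beta> (\<Delta> v) (\<Delta> w)"
proof -
  have "F v = v + \<Delta> v" "F w = w + \<Delta> w" by (simp_all add: \<Delta>_def)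
  then show ?thesis using invariant[of v w] \<beta>_sym[of w "\<Delta> v"] by (simp add: \<beta>_simps)
qed

lemma mem_L'_iff: "v \<in> L' \<longleftrightarrow> (\<forall>l\<in>L. \<beta> v l \<in> \<int>)"
  by (simp add: dual dual_lattice_def)

lemmas add_subgroup_L' = sublattice_add_subgroup[OF sublattice_L']

lemma ex_dual_basis_vector:
  assumes i: "i < d" shows "\<exists>w. \<forall>v. \<beta> w v = coord i v"
proof -
  define T where "T u = (\<Sum>j<d. \<beta> u (b j) *s b j)" for u
  have T: "lin T"
    by (simp add: lin_iff T_def \<beta>_simps scale_left_distrib sum.distrib scale_sum_right)
  have coord_T: "coord j (T u) = \<beta> u (b j)" if "j < d" for j u
    unfolding T_def by (rule coord_combination[OF that])
  have expand: "\<beta> u w = (\<Sum>j<d. coord j w * \<beta> u (b j))" for u w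
    by (subst expansion[of w]) (simp only: additive.sum[OF additive_\<beta>] \<beta>_scale_right)
  have "inj T"
    unfolding endo.linear_inj_iff_eq_0[OF T]
  proof (intro allI impI)
    fix x assume "T x = 0"
    then have "\<beta> x (b j) = 0" if "j < d" for j
      using coord_T[OF that, of x] by (simp add: additive.zero[OF additive_coord])
    then have "\<beta> x w = 0" for w by (subst expand) simp
    then show "x = 0" by (rule \<beta>_nondegenerate)
  qed
  then have "surj T" using endo.linear_injective_imp_surjective[OF T] by simp
  then obtain w where "T w = b i" by (metis surjD)
  then have w: "\<beta> w (b j) = (if j = i then 1 else 0)" if "j < d" for j
    using coord_T[OF that, of w] i that by (simp add: coord_basis)
  have "\<beta> w v = coord i v" for v
  proof -
    have "\<beta> w v = (\<Sum>j<d. if j = i then coord j v else 0)"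
      unfolding expand[of w v] by (rule sum.cong) (auto simp: w)
    then show ?thesis using i by simp
  qed
  then show ?thesis by blast
qed

lemma mem_L_iff_dual: "v \<in> L \<longleftrightarrow> (\<forall>l\<in>L'. \<beta> v l \<in> \<int>)"
proof
  assume "v \<in> L"
  then show "\<forall>l\<in>L'. \<beta> v l \<in> \<int>" using mem_L'_iff \<beta>_sym by metis
next
  assume v: "\<forall>l\<in>L'. \<beta> v l \<in> \<int>"
  show "v \<in> L"
    unfolding mem_L_iff
  proof (intro allI impI)
    fix i assume "i < d"
    then obtain w where w: "\<And>u. \<beta> w u = coord i u" using ex_dual_basis_vector by blast
    then have "w \<in> L'" using \<open>i < d\<close> by (simp add: mem_L'_iff mem_L_iff)
    then show "coord i v \<in> \<int>" using v w[of v] \<beta>_sym[of v w] by auto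
  qed
qed

theorem separation_groups_iso: "separation_group F L \<cong> separation_group F L'"
proof -
  let ?\<phi> = "\<lambda>u v. \<beta> (fixed_part u) v"
  interpret pairing_mod_Z L L' ?\<phi>
    by unfold_locales
      (simp_all add: add_subgroup_L add_subgroup_L' additive_mod_Z_def \<beta>_simps part_simps)
  have "annihilator L L' ?\<phi> = split_part L"
    using mem_L_iff_dual by (auto simp: annihilator_def mem_split_part_iff[OF add_subgroup_L])
  moreover have "annihilator L' L (flip ?\<phi>) = split_part L'"
  proof -
    have "flip ?\<phi> = ?\<phi>" by (intro ext) (metis \<beta>_fixed_part \<beta>_sym)
    then show ?thesis
      using mem_L'_iff by (auto simp: annihilator_def mem_split_part_iff[OF add_subgroup_L'])
  qed
  ultimately show ?thesis
    using Mod_annihilator_iso index_split_part_pos[OF sublattice_L]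
    by (simp add: separation_group_def split_part_def)
qed

lemma annihilator_W_L: "annihilator W L \<beta> = L' \<inter> W"
  by (auto simp: annihilator_def mem_L'_iff)

definition dual_moved_lattice :: "'v set" where
  "dual_moved_lattice = annihilator W (L \<inter> W) \<beta>"

lemma annihilator_dual_moved_lattice:
  "annihilator UNIV dual_moved_lattice \<beta> = (L \<inter> W) + VF"
proof
  show "annihilator UNIV dual_moved_lattice \<beta> \<subseteq> (L \<inter> W) + VF"
  proof
    fix v assume v: "v \<in> annihilator UNIV dual_moved_lattice \<beta>"
    have "\<beta> (moved_part v) l \<in> \<int>" if "l \<in> L'" for l
    proof -
      have "\<beta> (moved_part l) x \<in> \<int>" if "x \<in> L \<inter> W" for x
        using that \<open>l \<in> L'\<close> mem_L'_iff by (simp add: \<beta>_moved_part moved_part_moved)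
      then have "moved_part l \<in> dual_moved_lattice"
        by (simp add: dual_moved_lattice_def annihilator_def moved_part_W)
      then show ?thesis using v by (auto simp: annihilator_def[of UNIV] \<beta>_moved_part)
    qed
    then have "moved_part v \<in> L \<inter> W" using mem_L_iff_dual moved_part_W by blast
    then have "moved_part v + fixed_part v \<in> (L \<inter> W) + VF"
      using fixed_part_VF by (rule set_plus_intro)
    then show "v \<in> (L \<inter> W) + VF" by (simp add: moved_part_def)
  qed
  show "(L \<inter> W) + VF \<subseteq> annihilator UNIV dual_moved_lattice \<beta>"
  proof
    fix v assume "v \<in> (L \<inter> W) + VF"
    then obtain x u where x: "x \<in> L \<inter> W" and u: "u \<in> VF" and v: "v = x + u" by (rule set_plus_elim)
    have "\<beta> v y \<in> \<int>" if "y \<in> dual_moved_lattice" for y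
      using that x \<beta>_fixed_moved[OF u] \<beta>_sym[of x y]
      by (simp add: v dual_moved_lattice_def annihilator_def \<beta>_add_left)
    then show "v \<in> annihilator UNIV dual_moved_lattice \<beta>" by (simp add: annihilator_def[of UNIV])
  qed
qed

lemma \<beta>_plus_fixed: "w \<in> W \<Longrightarrow> u \<in> VF \<Longrightarrow> \<beta> w (l + u) = \<beta> w l"
  using \<beta>_fixed_moved[of u w] \<beta>_sym[of w u] by (simp add: \<beta>_add_right)

lemma plus_VF_subset_annihilator: "L + VF \<subseteq> annihilator UNIV (L' \<inter> W) \<beta>"
proof
  fix v assume "v \<in> L + VF"
  then obtain l u where "l \<in> L" "u \<in> VF" "v = l + u" by (rule set_plus_elim)
  then show "v \<in> annihilator UNIV (L' \<inter> W) \<beta>"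
    using \<beta>_plus_fixed mem_L'_iff \<beta>_sym[of v] by (simp add: annihilator_def)
qed

lemma annihilator_plus_VF: "annihilator dual_moved_lattice (L + VF) \<beta> = L' \<inter> W"
proof
  show "annihilator dual_moved_lattice (L + VF) \<beta> \<subseteq> L' \<inter> W"
    using subset_plus_left[OF add_subgroup_VF, of L]
    unfolding annihilator_W_L[symmetric] dual_moved_lattice_def annihilator_def by blast
  show "L' \<inter> W \<subseteq> annihilator dual_moved_lattice (L + VF) \<beta>"
    using \<beta>_plus_fixed mem_L'_iff
    by (auto simp: dual_moved_lattice_def annihilator_def elim!: set_plus_elim)
qed

lemma index_plus_VF: "index (L + VF) ((L \<inter> W) + VF) = index L (split_part L)"
proof -
  have LW: "add_subgroup (L \<inter> W)" by (rule add_subgroup_Int[OF add_subgroup_L add_subgroup_W])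
  have zero: "moved_part ` VF = {0}" "moved_part ` (L \<inter> VF) = {0}"
    using add_subgroup_zero[OF add_subgroup_L] add_subgroup_zero[OF add_subgroup_VF]
    by (auto simp: moved_part_fixed image_iff)
  have "index (L + VF) ((L \<inter> W) + VF) = index (moved_part ` (L + VF)) (moved_part ` ((L \<inter> W) + VF))"
    using subset_plus_right[OF LW, of VF]
    by (intro index_image[symmetric] additive_moved_part add_subgroup_plus add_subgroup_L LW
        add_subgroup_VF set_plus_mono2) (auto simp: moved_part_eq_0_iff)
  also have "\<dots> = index (moved_part ` L) (moved_part ` split_part L)"
    by (simp add: split_part_def image_plus[OF additive_moved_part] zero)
  also have "\<dots> = index L (split_part L)"
    by (intro index_image additive_moved_part add_subgroup_L add_subgroup_split_part
      split_part_subset)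
      (simp add: moved_part_eq_0_iff mem_split_part_iff add_subgroup_L fixed_part_fixed)
  finally show ?thesis .
qed

text \<open>Since \<open>L + VF\<close> contains the annihilator \<open>(L \<inter> W) + VF\<close> of \<open>dual_moved_lattice\<close> with finite
  index, it is its own double annihilator with respect to \<open>dual_moved_lattice\<close>.\<close>

theorem annihilator_moved_dual: "annihilator UNIV (L' \<inter> W) \<beta> = L + VF"
proof -
  let ?D = dual_moved_lattice
  define Z where "Z = annihilator UNIV (L' \<inter> W) \<beta>"
  interpret W: pairing_mod_Z W UNIV \<beta> by (rule pairing_\<beta>[OF add_subgroup_W add_subgroup_UNIV])
  interpret V: pairing_mod_Z UNIV UNIV \<beta> by (rule pairing_\<beta>[OF add_subgroup_UNIV add_subgroup_UNIV])
  have D: "add_subgroup ?D" and Z: "add_subgroup Z"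
    by (simp_all add: dual_moved_lattice_def Z_def W.add_subgroup_annihilator
      V.add_subgroup_annihilator)
  have LVF: "add_subgroup (L + VF)" by (rule add_subgroup_plus[OF add_subgroup_L add_subgroup_VF])
  have flip_\<beta>: "flip \<beta> = \<beta>" by (simp add: fun_eq_iff \<beta>_sym)
  have LZ: "L + VF \<subseteq> Z" unfolding Z_def by (rule plus_VF_subset_annihilator)
  have sub: "(L \<inter> W) + VF \<subseteq> L + VF" by (rule set_plus_mono2) auto
  have annihilator_D: "annihilator E ?D \<beta> = (L \<inter> W) + VF" if "L + VF \<subseteq> E" for E
    using annihilator_dual_moved_lattice that sub unfolding annihilator_def by blast
  have D_Z: "annihilator ?D Z \<beta> = L' \<inter> W"
  proof
    show "annihilator ?D Z \<beta> \<subseteq> L' \<inter> W"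
      unfolding annihilator_plus_VF[symmetric] using LZ by (intro annihilator_mono order_refl)
    have "L' \<inter> W \<subseteq> ?D" unfolding annihilator_plus_VF[symmetric] by (rule annihilator_subset)
    then show "L' \<inter> W \<subseteq> annihilator ?D Z \<beta>"
      using subset_annihilator_annihilator[of "L' \<inter> W" ?D UNIV \<beta>] by (simp add: Z_def flip_\<beta>)
  qed
  interpret LD: pairing_mod_Z "L + VF" ?D \<beta> by (rule pairing_\<beta>[OF LVF D])
  interpret ZD: pairing_mod_Z Z ?D \<beta> by (rule pairing_\<beta>[OF Z D])
  interpret DZ: pairing_mod_Z ?D Z \<beta> by (rule pairing_\<beta>[OF D Z])
  have "index (L + VF) ((L \<inter> W) + VF) > 0"
    using index_split_part_pos[OF sublattice_L] by (simp add: index_plus_VF)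
  then have "index ?D (L' \<inter> W) > 0"
    using LD.index_annihilator_flip by (simp add: annihilator_D flip_\<beta> annihilator_plus_VF)
  then have fin: "index Z (annihilator Z ?D \<beta>) > 0"
    using DZ.index_annihilator_flip by (simp add: flip_\<beta> D_Z)
  have "annihilator Z (annihilator ?D (L + VF) \<beta>) \<beta> = L + VF"
    using ZD.annihilator_annihilator[OF fin LVF _ LZ] annihilator_D[OF LZ] sub by (simp add: flip_\<beta>)
  moreover have "annihilator Z (L' \<inter> W) \<beta> = Z" by (auto simp: Z_def annihilator_def)
  ultimately show ?thesis by (simp add: annihilator_plus_VF Z_def)
qed

lemma B_group_pairing:
  "antisymmetric_pairing_mod_Z (fixed_mod L') (\<lambda>v w. \<beta> v (\<Delta> w))"
  "annihilator (fixed_mod L') (fixed_mod L') (\<lambda>v w. \<beta> v (\<Delta> w)) = fixed_mod L' \<inter> (L + VF)"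
proof -
  have "\<beta> v (\<Delta> w) + \<beta> w (\<Delta> v) \<in> \<int>" if "v \<in> fixed_mod L'" "w \<in> fixed_mod L'" for v w
    using that sublattice_subset[OF sublattice_L'] mem_L'_iff by (auto simp: \<beta>_\<Delta> fixed_mod_def)
  then show "antisymmetric_pairing_mod_Z (fixed_mod L') (\<lambda>v w. \<beta> v (\<Delta> w))"
    by unfold_locales
      (simp_all add: add_subgroup_fixed_mod[OF add_subgroup_L'] additive_mod_Z_def \<beta>_simps
        additive.add[OF additive_\<Delta>])
  have "annihilator (fixed_mod L') (fixed_mod L') (\<lambda>v w. \<beta> v (\<Delta> w)) =
      fixed_mod L' \<inter> annihilator UNIV (\<Delta> ` fixed_mod L') \<beta>"
    by (auto simp: annihilator_def)
  then show "annihilator (fixed_mod L') (fixed_mod L') (\<lambda>v w. \<beta> v (\<Delta> w)) = fixed_mod L' \<inter> (L + VF)"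
    by (simp only: \<Delta>_image_fixed_mod annihilator_moved_dual)
qed

theorem
  shows ex_perfect_antisymmetric_pairing: "\<exists>\<phi>. perfect_pairing (B_group F L L') \<phi> \<and>
      antisymmetric_pairing (B_group F L L') \<phi>"
    and square_or_twice_square_card_B_group:
      "square_or_twice_square (card (carrier (B_group F L L')))"
    and square_or_twice_square_card_torsion:
      "square_or_twice_square (card (torsion (B_group F L L') e))"
proof -
  let ?C = "fixed_mod L'" and ?S = "fixed_mod L' \<inter> (L + VF)" and ?\<phi> = "\<lambda>v w. \<beta> v (\<Delta> w)"
  interpret antisymmetric_pairing_mod_Z ?C ?\<phi> by (rule B_group_pairing)
  interpret quotient_presentation "B_group F L L'" ?C ?S "coset (L + VF)"
    by (rule B_group_presentation[OF add_subgroup_L'])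
  have fin: "index ?C ?S > 0"
    using card_B_group_pos[OF sublattice_L'] by (simp add: card_carrier_presentation)
  interpret paired_presentation "B_group F L L'" ?C ?S "coset (L + VF)" ?\<phi>
    by unfold_locales (use annihilator_flip[of ?C ?C] in \<open>simp_all add: B_group_pairing(2) fin\<close>)
  show "\<exists>\<phi>. perfect_pairing (B_group F L L') \<phi> \<and> antisymmetric_pairing (B_group F L L') \<phi>"
    using perfect_induced_pairing antisymmetric_induced_pairing[OF antisymmetric] by blast
  show "square_or_twice_square (card (carrier (B_group F L L')))"
    using square_or_twice_square_index[OF antisymmetric_pairing_mod_Z_axioms] fin
    by (simp add: card_carrier_presentation B_group_pairing(2))
  show "square_or_twice_square (card (torsion (B_group F L L') e))"
    using square_or_twice_square_index_torsion[of e] fin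
    by (simp add: card_torsion_presentation B_group_pairing(2))
qed

end

theorem theorem1p1p1:
  fixes scale :: "rat \<Rightarrow> 'v::ab_group_add \<Rightarrow> 'v"
    and d r :: nat
    and b :: "nat \<Rightarrow> 'v"
    and L L' :: "'v set"
    and F :: "'v \<Rightarrow> 'v"
    and p :: "int poly"
  assumes "vector_space scale"
    and "lattice_basis scale d b L"
    and "Vector_Spaces.linear scale scale F"
    and "F ` L \<subseteq> L"
    and "{v \<in> L. F v - v = 0} = {v \<in> L. F (F v - v) - (F v - v) = 0}"
    and "full_rank_lattice scale d L'"
    and "L' \<subseteq> L"
    and "F ` L' \<subseteq> L'"
    and "char_poly (lattice_mat scale d b F) = [:-1, 1:] ^ r * p \<or>
         char_poly (lattice_mat scale d b F) = - ([:-1, 1:] ^ r * p)"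
    and "poly p 1 > 0"
  shows
    "rat_of_nat (card (quotient_fixed F L L')) =
       rat_of_nat (card (carrier (add_group (L \<inter> fixed_space F) Mod (L' \<inter> fixed_space F)))) *
       (rat_of_int (poly p 1) /
         (rat_of_nat (card (carrier (B_group F L L'))) *
          rat_of_nat (card (carrier (separation_group F L')))))
     \<and> (\<forall>e::nat. e \<ge> 1 \<longrightarrow>
          card (quotient_fixed F L (scale (of_nat e) ` L')) =
            card (quotient_fixed F L L') * card (torsion (B_group F L L') e) * e ^ r)
     \<and> comm_group (separation_group F L') \<and> finite (carrier (separation_group F L'))
     \<and> comm_group (B_group F L L') \<and> finite (carrier (B_group F L L'))
     \<and> int (card (carrier (separation_group F L')) * card (carrier (B_group F L L'))) dvd poly p 1
     \<and> (\<forall>\<beta>. nondegenerate_symmetric_form scale \<beta> \<and>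
            (\<forall>v w. \<beta> (F v) (F w) = \<beta> v w) \<and>
            L' = dual_lattice \<beta> L \<longrightarrow>
          separation_group F L \<cong> separation_group F L' \<and>
          (\<exists>\<phi>. perfect_pairing (B_group F L L') \<phi> \<and>
               antisymmetric_pairing (B_group F L L') \<phi>) \<and>
          square_or_twice_square (card (carrier (B_group F L L'))) \<and>
          (\<forall>e::nat. e \<ge> 1 \<longrightarrow>
             square_or_twice_square (card (torsion (B_group F L L') e))))"
proof -
  interpret vector_space scale by fact
  interpret rat_lattice scale d b L by unfold_locales fact
  interpret lattice_endomorphism_char_poly scale d b L F r p
    by (intro lattice_endomorphism_char_poly.intro lattice_endomorphism.intro
      lattice_endomorphism_axioms.intro
        lattice_endomorphism_char_poly_axioms.intro rat_lattice_axioms assms)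
  have L': "sublattice L'"
    using index_full_rank_lattice_pos[OF assms(6,7)] assms(7,8) by (simp add: sublattice_def)
  have dual: "dual_lattice_endomorphism scale d b L F \<beta> L'"
    if "nondegenerate_symmetric_form scale \<beta> \<and> (\<forall>v w. \<beta> (F v) (F w) = \<beta> v w) \<and>
      L' = dual_lattice \<beta> L" for \<beta>
    by unfold_locales (use that L' in auto)
  show ?thesis
    using card_quotient_fixed_eq[OF L'] card_quotient_fixed_scale_eq[OF L']
      comm_group_separation_group[OF sublattice_add_subgroup[OF L']]
        card_separation_group_pos[OF L']
      comm_group_B_group[OF sublattice_add_subgroup[OF L']] card_B_group_pos[OF L']
      card_separation_group_B_group_dvd[OF L']
        dual[THEN dual_lattice_endomorphism.separation_groups_iso]
      dual[THEN dual_lattice_endomorphism.ex_perfect_antisymmetric_pairing]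
      dual[THEN dual_lattice_endomorphism.square_or_twice_square_card_B_group]
      dual[THEN dual_lattice_endomorphism.square_or_twice_square_card_torsion]
    by (intro conjI allI impI) (simp_all add: card_gt_0_iff)
qed

end
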